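(* Let $C\in B_2(L)$. For every complete orthonormal system $\{e_j\}_{j\in\mathbb N}$ in $L$ the partial sums $\Delta^+_M(C):=\sum_{j=1}^M a^\dagger(Ce_j)a^\dagger(\bar e_j)$ converge strongly on $D_1$ to an operator $\Delta^+(C)$ that does not depend on the choice of the complete orthonormal system, and \[ \|\Delta^+(C)\Phi\|^2\le\|C\|^2\,\|(N(N+2\,\mathrm{id}))^{1/2}\Phi\|^2+\|C\|_2^2\,\|(N+2\,\mathrm{id})^{1/2}\Phi\|^2,\qquad\Phi\in D_1 . \] Furthermore, $\Delta^+(C^T)=\Delta^+(C)$, and if $C^T=C$ then $\Delta^+(C)=\Delta(C^* )^*$ on $D_1$, i.e. $(\Phi,\Delta^+(C)\Psi)=(\Delta(C^* )\Phi,\Psi)$ for all $\Phi,\Psi\in D_1$, where $\Delta(C^* )$ is the strong limit on $D_1$ of $\sum_{j=1}^M a(C^*e_j)a(\bar e_j)$.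
   Context: $L$ is a separable complex Hilbert space with $\dim L=\infty$, scalar product antilinear in the first argument, and a conjugation $J:f\mapsto\bar f$ (antilinear involution with $(\bar f,\bar g)=(g,f)$); for bounded $C$, $\bar C:=JCJ$ and $C^T:=(\bar C)^*$. $B_2(L)$ denotes the Hilbert–Schmidt operators on $L$, $\|C\|$ the operator norm, $\|C\|_2$ the Hilbert–Schmidt norm. $\mathcal F$ carries a Fock representation of the CCR over $L$: on a dense invariant domain $D$ there are operators $a(f),a^\dagger(f)$, linear in $f$, with $[a(f),a(g)]=0=[a^\dagger(f),a^\dagger(g)]$, $[a(f),a^\dagger(g)]=(\bar f,g)\mathrm{id}$, $(a(f)\Phi,\Psi)=(\Phi,a^\dagger(\bar f)\Psi)$, a unit vacuum $\Omega$ with $a(f)\Omega=0$, and $\mathcal F$ is the closure of the span of all vectors $a^\dagger(f_n)\cdots a^\dagger(f_1)\Omega$. $\mathcal F^{(n)}$ is the closure of the span of such vectors with exactly $n$ creation operators; $\mathcal F=\bigoplus_n\mathcal F^{(n)}$, $\Phi^{(n)}$ the component in $\mathcal F^{(n)}$. $D_\alpha:=\{\Phi:\sum_n(n+1)^{2\alpha}\|\Phi^{(n)}\|^2<\infty\}$. The operators $a(f),a^\dagger(f)$ extend to $D_{1/2}$ (changing particle number by $\mp1$); these extensions are used. $N$ is the number operator, $(N\Phi)^{(n)}=n\Phi^{(n)}$; $(N(N+2\mathrm{id}))^{1/2}$ and $(N+2\mathrm{id})^{1/2}$ act on $\mathcal F^{(n)}$ as multiplication by $\sqrt{n(n+2)}$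 and $\sqrt{n+2}$. *)

theory Defs
  imports "HOL-Analysis.Analysis"
begin

class cvec = ab_group_add +
  fixes scaleC :: "complex \<Rightarrow> 'a \<Rightarrow> 'a" (infixr "*\<^sub>C" 75)
  assumes scaleC_add_right: "c *\<^sub>C (x + y) = c *\<^sub>C x + c *\<^sub>C y"
    and scaleC_add_left: "(b + c) *\<^sub>C x = b *\<^sub>C x + c *\<^sub>C x"
    and scaleC_scaleC: "b *\<^sub>C (c *\<^sub>C x) = (b * c) *\<^sub>C x"
    and scaleC_one: "1 *\<^sub>C x = x"

definition inner_prod :: "('a::cvec \<Rightarrow> 'a \<Rightarrow> complex) \<Rightarrow> bool" where
  "inner_prod ip \<longleftrightarrow>
     (\<forall>x y z. ip (x + y) z = ip x z + ip y z) \<and>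
     (\<forall>c x y. ip (c *\<^sub>C x) y = cnj c * ip x y) \<and>
     (\<forall>x y. ip x y = cnj (ip y x)) \<and>
     (\<forall>x. Im (ip x x) = 0 \<and> Re (ip x x) \<ge> 0) \<and>
     (\<forall>x. ip x x = 0 \<longrightarrow> x = 0)"

definition nrm :: "('a \<Rightarrow> 'a \<Rightarrow> complex) \<Rightarrow> 'a \<Rightarrow> real" where
  "nrm ip x = sqrt (Re (ip x x))"

definition conv :: "('a::cvec \<Rightarrow> 'a \<Rightarrow> complex) \<Rightarrow> (nat \<Rightarrow> 'a) \<Rightarrow> 'a \<Rightarrow> bool" where
  "conv ip s x \<longleftrightarrow> ((\<lambda>k. nrm ip (s k - x)) \<longlonglongrightarrow> 0)"

definition cspan :: "'a::cvec set \<Rightarrow> 'a set" where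
  "cspan S = {x. \<exists>n (c::nat \<Rightarrow> complex) v. (\<forall>i<n. v i \<in> S) \<and> x = (\<Sum>i<n. c i *\<^sub>C v i)}"

definition cclosure :: "('a::cvec \<Rightarrow> 'a \<Rightarrow> complex) \<Rightarrow> 'a set \<Rightarrow> 'a set" where
  "cclosure ip S = {x. \<exists>s. (\<forall>k. s k \<in> S) \<and> conv ip s x}"

definition hilbert :: "('a::cvec \<Rightarrow> 'a \<Rightarrow> complex) \<Rightarrow> bool" where
  "hilbert ip \<longleftrightarrow> inner_prod ip \<and>
     (\<forall>s. (\<forall>\<epsilon>>0. \<exists>N. \<forall>m\<ge>N. \<forall>n\<ge>N. nrm ip (s m - s n) < \<epsilon>) \<longrightarrow> (\<exists>x. conv ip s x))"

definition sep_inf_hilbert :: "('a::cvec \<Rightarrow> 'a \<Rightarrow> complex) \<Rightarrow> bool" where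
  "sep_inf_hilbert ip \<longleftrightarrow> hilbert ip \<and>
     (\<exists>S. countable S \<and> cclosure ip S = UNIV) \<and>
     (\<forall>n. \<exists>v::nat \<Rightarrow> 'a. \<forall>i<n. \<forall>j<n. ip (v i) (v j) = (if i = j then 1 else 0))"

definition conjugation :: "('a::cvec \<Rightarrow> 'a \<Rightarrow> complex) \<Rightarrow> ('a \<Rightarrow> 'a) \<Rightarrow> bool" where
  "conjugation ip J \<longleftrightarrow>
     (\<forall>x y. J (x + y) = J x + J y) \<and> (\<forall>c x. J (c *\<^sub>C x) = cnj c *\<^sub>C J x) \<and>
     (\<forall>x. J (J x) = x) \<and> (\<forall>f g. ip (J f) (J g) = ip g f)"

definition cons :: "('a::cvec \<Rightarrow> 'a \<Rightarrow> complex) \<Rightarrow> (nat \<Rightarrow> 'a) \<Rightarrow> bool" where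
  "cons ip e \<longleftrightarrow> (\<forall>i j. ip (e i) (e j) = (if i = j then 1 else 0)) \<and>
     (\<forall>x. (\<forall>j. ip (e j) x = 0) \<longrightarrow> x = 0)"

definition bounded_op :: "('a::cvec \<Rightarrow> 'a \<Rightarrow> complex) \<Rightarrow> ('a \<Rightarrow> 'a) \<Rightarrow> bool" where
  "bounded_op ip C \<longleftrightarrow> (\<forall>x y. C (x + y) = C x + C y) \<and> (\<forall>c x. C (c *\<^sub>C x) = c *\<^sub>C C x) \<and>
     (\<exists>K. \<forall>x. nrm ip (C x) \<le> K * nrm ip x)"

definition opnorm :: "('a::cvec \<Rightarrow> 'a \<Rightarrow> complex) \<Rightarrow> ('a \<Rightarrow> 'a) \<Rightarrow> real" where
  "opnorm ip C = Sup {nrm ip (C x) | x. nrm ip x \<le> 1}"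

definition adj :: "('a::cvec \<Rightarrow> 'a \<Rightarrow> complex) \<Rightarrow> ('a \<Rightarrow> 'a) \<Rightarrow> 'a \<Rightarrow> 'a" where
  "adj ip C y = (THE z. \<forall>x. ip x z = ip (C x) y)"

definition transp :: "('a::cvec \<Rightarrow> 'a \<Rightarrow> complex) \<Rightarrow> ('a \<Rightarrow> 'a) \<Rightarrow> ('a \<Rightarrow> 'a) \<Rightarrow> 'a \<Rightarrow> 'a" where
  "transp ip J C = adj ip (J \<circ> C \<circ> J)"

definition hs_op :: "('a::cvec \<Rightarrow> 'a \<Rightarrow> complex) \<Rightarrow> ('a \<Rightarrow> 'a) \<Rightarrow> bool" where
  "hs_op ip C \<longleftrightarrow> bounded_op ip C \<and>
     (\<exists>e. cons ip e \<and> summable (\<lambda>j. (nrm ip (C (e j)))\<^sup>2))"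

definition hs_norm_sq :: "('a::cvec \<Rightarrow> 'a \<Rightarrow> complex) \<Rightarrow> ('a \<Rightarrow> 'a) \<Rightarrow> real" where
  "hs_norm_sq ip C = (THE s. \<forall>e. cons ip e \<longrightarrow> (\<lambda>j. (nrm ip (C (e j)))\<^sup>2) sums s)"

definition creation_vectors :: "('l \<Rightarrow> 'f \<Rightarrow> 'f) \<Rightarrow> 'f \<Rightarrow> nat \<Rightarrow> 'f set" where
  "creation_vectors ad \<Omega> n = {foldr ad fs \<Omega> | fs. length fs = n}"

definition nsector :: "('f::cvec \<Rightarrow> 'f \<Rightarrow> complex) \<Rightarrow> ('l \<Rightarrow> 'f \<Rightarrow> 'f) \<Rightarrow> 'f \<Rightarrow> nat \<Rightarrow> 'f set" where
  "nsector ipF ad \<Omega> n = cclosure ipF (cspan (creation_vectors ad \<Omega> n))"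

definition comp :: "('f::cvec \<Rightarrow> 'f \<Rightarrow> complex) \<Rightarrow> ('l \<Rightarrow> 'f \<Rightarrow> 'f) \<Rightarrow> 'f \<Rightarrow> nat \<Rightarrow> 'f \<Rightarrow> 'f" where
  "comp ipF ad \<Omega> n \<Phi> = (THE \<psi>. \<psi> \<in> nsector ipF ad \<Omega> n \<and>
      (\<forall>\<xi>\<in>nsector ipF ad \<Omega> n. ipF \<xi> (\<Phi> - \<psi>) = 0))"

definition Dhalf :: "('f::cvec \<Rightarrow> 'f \<Rightarrow> complex) \<Rightarrow> ('l \<Rightarrow> 'f \<Rightarrow> 'f) \<Rightarrow> 'f \<Rightarrow> 'f set" where
  "Dhalf ipF ad \<Omega> = {\<Phi>. summable (\<lambda>n. real (n + 1) * (nrm ipF (comp ipF ad \<Omega> n \<Phi>))\<^sup>2)}"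

definition Done :: "('f::cvec \<Rightarrow> 'f \<Rightarrow> complex) \<Rightarrow> ('l \<Rightarrow> 'f \<Rightarrow> 'f) \<Rightarrow> 'f \<Rightarrow> 'f set" where
  "Done ipF ad \<Omega> = {\<Phi>. summable (\<lambda>n. (real (n + 1))\<^sup>2 * (nrm ipF (comp ipF ad \<Omega> n \<Phi>))\<^sup>2)}"

text \<open>Fock representation of the CCR over (L, J) on the Hilbert space with scalar product ipF.
  a and ad are given as total functions; on D they are the given operators, and on D_{1/2}
  they are the (unique) extensions by continuity w.r.t. the norm of (N+1)^{1/2}.\<close>
definition fock_rep :: "('l::cvec \<Rightarrow> 'l \<Rightarrow> complex) \<Rightarrow> ('l \<Rightarrow> 'l) \<Rightarrow> ('f::cvec \<Rightarrow> 'f \<Rightarrow> complex)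
    \<Rightarrow> ('l \<Rightarrow> 'f \<Rightarrow> 'f) \<Rightarrow> ('l \<Rightarrow> 'f \<Rightarrow> 'f) \<Rightarrow> 'f \<Rightarrow> 'f set \<Rightarrow> bool" where
  "fock_rep ipL J ipF a ad \<Omega> D \<longleftrightarrow>
     \<comment> \<open>D: dense invariant subspace containing the vacuum\<close>
     0 \<in> D \<and> (\<forall>x\<in>D. \<forall>y\<in>D. x + y \<in> D) \<and> (\<forall>c. \<forall>x\<in>D. c *\<^sub>C x \<in> D) \<and>
     cclosure ipF D = UNIV \<and> \<Omega> \<in> D \<and>
     (\<forall>f. \<forall>\<Phi>\<in>D. a f \<Phi> \<in> D \<and> ad f \<Phi> \<in> D) \<and>
     \<comment> \<open>linearity of the operators on D, and linearity in f\<close>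
     (\<forall>f. \<forall>\<Phi>\<in>D. \<forall>\<Psi>\<in>D. a f (\<Phi> + \<Psi>) = a f \<Phi> + a f \<Psi> \<and> ad f (\<Phi> + \<Psi>) = ad f \<Phi> + ad f \<Psi>) \<and>
     (\<forall>f c. \<forall>\<Phi>\<in>D. a f (c *\<^sub>C \<Phi>) = c *\<^sub>C a f \<Phi> \<and> ad f (c *\<^sub>C \<Phi>) = c *\<^sub>C ad f \<Phi>) \<and>
     (\<forall>f g. \<forall>\<Phi>\<in>D. a (f + g) \<Phi> = a f \<Phi> + a g \<Phi> \<and> ad (f + g) \<Phi> = ad f \<Phi> + ad g \<Phi>) \<and>
     (\<forall>f c. \<forall>\<Phi>\<in>D. a (c *\<^sub>C f) \<Phi> = c *\<^sub>C a f \<Phi> \<and> ad (c *\<^sub>C f) \<Phi> = c *\<^sub>C ad f \<Phi>) \<and>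
     \<comment> \<open>canonical commutation relations\<close>
     (\<forall>f g. \<forall>\<Phi>\<in>D. a f (a g \<Phi>) = a g (a f \<Phi>) \<and> ad f (ad g \<Phi>) = ad g (ad f \<Phi>) \<and>
        a f (ad g \<Phi>) - ad g (a f \<Phi>) = ipL (J f) g *\<^sub>C \<Phi>) \<and>
     \<comment> \<open>(a(f) Phi, Psi) = (Phi, ad(bar f) Psi)\<close>
     (\<forall>f. \<forall>\<Phi>\<in>D. \<forall>\<Psi>\<in>D. ipF (a f \<Phi>) \<Psi> = ipF \<Phi> (ad (J f) \<Psi>)) \<and>
     \<comment> \<open>vacuum\<close>
     ipF \<Omega> \<Omega> = 1 \<and> (\<forall>f. a f \<Omega> = 0) \<and>
     \<comment> \<open>cyclicity of the vacuum\<close>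
     cclosure ipF (cspan (\<Union>n. creation_vectors ad \<Omega> n)) = UNIV \<and>
     \<comment> \<open>on D_{1/2} the extensions by continuity are used\<close>
     (\<forall>f. \<forall>\<Phi>\<in>Dhalf ipF ad \<Omega>. \<forall>s. (\<forall>k. s k \<in> D \<inter> Dhalf ipF ad \<Omega>) \<and>
        (\<lambda>k. \<Sum>n. real (n + 1) * (nrm ipF (comp ipF ad \<Omega> n (s k - \<Phi>)))\<^sup>2) \<longlonglongrightarrow> 0 \<longrightarrow>
        conv ipF (\<lambda>k. a f (s k)) (a f \<Phi>) \<and> conv ipF (\<lambda>k. ad f (s k)) (ad f \<Phi>))"

end

theory Submission
  imports Defs
begin

text \<open>
  On the \<open>n\<close>-particle sector the number operator gives, for orthonormal \<open>u\<close>, the two dual bounds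
  \<open>\<Sum>k. \<parallel>a (u k) \<Psi>\<parallel>\<^sup>2 \<le> n \<parallel>\<Psi>\<parallel>\<^sup>2\<close> and
  \<open>\<parallel>\<Sum>k. ad (u k) (b k)\<parallel>\<^sup>2 \<le> (n + 1) (\<Sum>k. \<parallel>b k\<parallel>\<^sup>2)\<close>; each implies the other
  one particle higher, so both follow by induction from the CCR. Expanding the vectors
  \<open>C (e j)\<close> in a finite orthonormal family and using these bounds on the sectors \<open>n + 2\<close> and \<open>n\<close>
  yields the claimed estimate with the weights \<open>n (n + 2)\<close> and \<open>n + 2\<close>. Applied to the tail
  \<open>m \<le> j < M\<close>, with the operator norm estimated by the Hilbert--Schmidt norm, it makes the partial
  sums Cauchy on \<open>D\<^sub>1\<close>.

  The limit is identified by pairing with finite-particle vectors: the adjoint sums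
  \<open>\<Sum>j. a (e j) (a (J (C (e j))) \<Psi>)\<close> satisfy a recursion in the number of creation operators that
  only involves \<open>C\<^sup>*\<close> and \<open>J C J\<close>, symmetrically. These two operators are exchanged when \<open>C\<close> is
  replaced by its transpose, so the limit depends neither on the basis nor on \<open>C\<close> versus \<open>C\<^sup>T\<close>.
\<close>

subsection \<open>Inner product spaces over \<open>cvec\<close>\<close>

text \<open>The CCR are available only on \<open>D\<close>, while the claim concerns
  \<open>Done\<close>, whose vectors need not lie in \<open>D\<close>; the link is the continuity
  axiom for sequences converging in the weighted norm. Estimates are therefore proved on the
  algebraic spans \<open>S n\<close>, passed to their closures \<open>H n\<close>, where the
  weighted norm is a multiple of the norm, and summed over \<open>n\<close> by orthogonality. The
  two weights arise as follows. On sector \<open>m\<close> the outer creation operators act on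
  \<open>m + 1\<close> particles and cost \<open>m + 2\<close>. For the inner ones the CCR give the
  exact identity |ad(v) Phi|^2 = |v|^2 |Phi|^2 + |a(J v) Phi|^2; the first part sums to the squared
  Hilbert-Schmidt norm, the second to at most \<open>m\<close> times the squared operator norm.
  Estimating the inner operators by their norm alone would lose the operator norm. Independence of
  the basis also serves the adjoint claim: the adjoint of a partial sum of annihilation pairs over a
  basis is a partial sum of creation pairs over the conjugated basis.\<close>

interpretation cvec: vector_space "scaleC :: complex \<Rightarrow> 'a::cvec \<Rightarrow> 'a"
  by unfold_locales (auto simp: scaleC_add_right scaleC_add_left scaleC_scaleC scaleC_one)

lemma cspan_eq_span: "cspan S = cvec.span S"
proof
  show "cspan S \<subseteq> cvec.span S"
    unfolding cspan_def by (auto intro!: cvec.span_sum cvec.span_scale intro: cvec.span_base)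
  show "cvec.span S \<subseteq> cspan S"
  proof
    fix x assume "x \<in> cvec.span S"
    then obtain t r where t: "finite t" "t \<subseteq> S" and x: "x = (\<Sum>v\<in>t. r v *\<^sub>C v)"
      unfolding cvec.span_explicit by blast
    obtain h where h: "bij_betw h {0..<card t} t"
      using ex_bij_betw_nat_finite[OF t(1)] by blast
    have "x = (\<Sum>i<card t. r (h i) *\<^sub>C h i)"
      unfolding x using sum.reindex_bij_betw[OF h, of "\<lambda>v. r v *\<^sub>C v"] by (simp add: atLeast0LessThan)
    moreover have "\<forall>i<card t. h i \<in> S"
      using h t(2) by (auto simp: bij_betw_def)
    ultimately show "x \<in> cspan S"
      unfolding cspan_def
      by (intro CollectI exI[of _ "card t"] exI[of _ "\<lambda>i. r (h i)"] exI[of _ h] conjI)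
  qed
qed

text \<open>Linearity is asked for on \<open>S\<close> only, because \<open>a f\<close> and
  \<open>ad f\<close> are assumed linear on \<open>D\<close> only.\<close>

lemma subspace_preimage:
  assumes S: "cvec.subspace S" and T: "cvec.subspace T"
    and add: "\<And>x y. x \<in> S \<Longrightarrow> y \<in> S \<Longrightarrow> f (x + y) = f x + f y"
    and scale: "\<And>c x. x \<in> S \<Longrightarrow> f (c *\<^sub>C x) = c *\<^sub>C f x"
  shows "cvec.subspace {x \<in> S. f x \<in> T}"
proof -
  have "f 0 = 0"
    using scale[of 0 0] cvec.subspace_0[OF S] by simp
  then show ?thesis
    using S T by (simp add: cvec.subspace_def add scale)
qed

locale ips =
  fixes ip :: "'a::cvec \<Rightarrow> 'a \<Rightarrow> complex"
  assumes inner_prod: "inner_prod ip"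
begin

lemma ip_add_left: "ip (x + y) z = ip x z + ip y z"
  and ip_scale_left: "ip (c *\<^sub>C x) y = cnj c * ip x y"
  and ip_cnj: "ip x y = cnj (ip y x)"
  and ip_self_Im: "Im (ip x x) = 0"
  and ip_self_Re: "0 \<le> Re (ip x x)"
  and ip_self_0: "ip x x = 0 \<Longrightarrow> x = 0"
proof -
  note ax = inner_prod[unfolded inner_prod_def]
  note ax2 = ax[THEN conjunct2] note ax3 = ax2[THEN conjunct2] note ax4 = ax3[THEN conjunct2]
  show "ip (x + y) z = ip x z + ip y z" by (rule ax[THEN conjunct1, rule_format])
  show "ip (c *\<^sub>C x) y = cnj c * ip x y" by (rule ax2[THEN conjunct1, rule_format])
  show "ip x y = cnj (ip y x)" by (rule ax3[THEN conjunct1, rule_format])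
  show "Im (ip x x) = 0" by (rule ax4[THEN conjunct1, rule_format, THEN conjunct1])
  show "0 \<le> Re (ip x x)" by (rule ax4[THEN conjunct1, rule_format, THEN conjunct2])
  show "ip x x = 0 \<Longrightarrow> x = 0" by (rule ax4[THEN conjunct2, rule_format])
qed

lemma ip_add_right: "ip x (y + z) = ip x y + ip x z"
  by (subst (1 2 3) ip_cnj) (simp add: ip_add_left)

lemma ip_scale_right: "ip x (c *\<^sub>C y) = c * ip x y"
  by (subst (1 2) ip_cnj) (simp add: ip_scale_left)

lemma ip_zero_left [simp]: "ip 0 y = 0"
  using ip_scale_left[of 0 0 y] by simp

lemma ip_zero_right [simp]: "ip x 0 = 0"
  using ip_scale_right[of x 0 0] by simp

lemma ip_minus_left: "ip (- x) y = - ip x y"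
  using ip_scale_left[of "-1" x y] by simp

lemma ip_minus_right: "ip x (- y) = - ip x y"
  using ip_scale_right[of x "-1" y] by simp

lemma ip_diff_left: "ip (x - y) z = ip x z - ip y z"
  using ip_add_left[of x "- y" z] by (simp add: ip_minus_left)

lemma ip_diff_right: "ip x (y - z) = ip x y - ip x z"
  using ip_add_right[of x y "- z"] by (simp add: ip_minus_right)

lemma ip_sum_left: "ip (sum f A) y = (\<Sum>i\<in>A. ip (f i) y)"
  by (induction A rule: infinite_finite_induct) (auto simp: ip_add_left)

lemma ip_sum_right: "ip x (sum f A) = (\<Sum>i\<in>A. ip x (f i))"
  by (induction A rule: infinite_finite_induct) (auto simp: ip_add_right)

lemma cmod_ip_commute: "cmod (ip x y) = cmod (ip y x)"
  by (subst ip_cnj) simp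

lemma ip_zero_sym: "ip x y = 0 \<Longrightarrow> ip y x = 0"
  using ip_cnj[of y x] by simp

lemma nrm_ge_0 [simp]: "0 \<le> nrm ip x"
  by (simp add: nrm_def ip_self_Re)

lemma nrm_sq: "(nrm ip x)\<^sup>2 = Re (ip x x)"
  by (simp add: nrm_def ip_self_Re)

lemma ip_self: "ip x x = of_real ((nrm ip x)\<^sup>2)"
  by (simp add: complex_eq_iff nrm_sq ip_self_Im)

lemma nrm_eq_0 [simp]: "nrm ip x = 0 \<longleftrightarrow> x = 0"
  using ip_self[of x] ip_self_0[of x] by (auto simp: nrm_def)

lemma nrm_zero [simp]: "nrm ip 0 = 0"
  by simp

lemma nrm_scale: "nrm ip (c *\<^sub>C x) = cmod c * nrm ip x"
proof -
  have "ip (c *\<^sub>C x) (c *\<^sub>C x) = (c * cnj c) * ip x x"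
    by (simp add: ip_scale_left ip_scale_right)
  also have "c * cnj c = of_real ((cmod c)\<^sup>2)"
    using complex_norm_square[of c] by simp
  finally show ?thesis
    by (simp add: nrm_def real_sqrt_mult)
qed

lemma nrm_minus: "nrm ip (- x) = nrm ip x"
  by (simp add: nrm_def ip_minus_left ip_minus_right)

lemma nrm_diff_commute: "nrm ip (x - y) = nrm ip (y - x)"
  using nrm_minus[of "x - y"] by simp

lemma nrm_add_sq: "(nrm ip (x + y))\<^sup>2 = (nrm ip x)\<^sup>2 + 2 * Re (ip x y) + (nrm ip y)\<^sup>2"
  using ip_cnj[of y x] by (simp add: nrm_sq ip_add_left ip_add_right)

lemma nrm_pyth: "ip x y = 0 \<Longrightarrow> (nrm ip (x + y))\<^sup>2 = (nrm ip x)\<^sup>2 + (nrm ip y)\<^sup>2"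
  by (simp add: nrm_add_sq)

lemma cauchy_schwarz: "cmod (ip x y) \<le> nrm ip x * nrm ip y"
proof (cases "x = 0")
  case False
  define c where "c = ip x y / ip x x"
  have n: "nrm ip x > 0" using False by (simp add: less_le)
  have "ip x x \<noteq> 0" using False ip_self_0 by blast
  then have "ip (c *\<^sub>C x) (y - c *\<^sub>C x) = 0"
    by (simp add: ip_scale_left ip_scale_right ip_diff_right c_def)
  from nrm_pyth[OF this] have "(nrm ip (c *\<^sub>C x))\<^sup>2 \<le> (nrm ip y)\<^sup>2"
    by simp
  then have "nrm ip (c *\<^sub>C x) \<le> nrm ip y"
    by (rule power2_le_imp_le) simp
  moreover have "nrm ip (c *\<^sub>C x) = cmod (ip x y) / nrm ip x"
    using n by (simp add: nrm_scale c_def ip_self norm_divide norm_mult power2_eq_square)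
  ultimately show ?thesis
    using n by (simp add: divide_le_eq mult.commute)
qed simp

lemma nrm_triangle: "nrm ip (x + y) \<le> nrm ip x + nrm ip y"
proof (rule power2_le_imp_le)
  have "Re (ip x y) \<le> nrm ip x * nrm ip y"
    using cauchy_schwarz complex_Re_le_cmod order_trans by blast
  then show "(nrm ip (x + y))\<^sup>2 \<le> (nrm ip x + nrm ip y)\<^sup>2"
    by (simp add: nrm_add_sq power2_sum)
qed simp

lemma nrm_triangle_diff: "nrm ip (x - z) \<le> nrm ip (x - y) + nrm ip (y - z)"
  using nrm_triangle[of "x - y" "y - z"] by simp

lemma nrm_sum_le: "nrm ip (sum f A) \<le> (\<Sum>i\<in>A. nrm ip (f i))"
proof (induction A rule: infinite_finite_induct)
  case (insert i A)
  then show ?case using nrm_triangle[of "f i" "sum f A"] by simp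
qed auto

lemma nrm_abs_diff: "\<bar>nrm ip x - nrm ip y\<bar> \<le> nrm ip (x - y)"
  using nrm_triangle[of "x - y" y] nrm_triangle[of "y - x" x] nrm_diff_commute[of x y] by simp

lemma nrm_sum_orthogonal:
  assumes "finite A" "\<And>i j. i \<in> A \<Longrightarrow> j \<in> A \<Longrightarrow> i \<noteq> j \<Longrightarrow> ip (f i) (f j) = 0"
  shows "(nrm ip (sum f A))\<^sup>2 = (\<Sum>i\<in>A. (nrm ip (f i))\<^sup>2)"
  using assms
proof (induction A rule: finite_induct)
  case (insert i A)
  have "ip (f i) (sum f A) = 0"
    unfolding ip_sum_right using insert by (intro sum.neutral) auto
  then show ?case using insert by (simp add: nrm_pyth)
qed auto

section \<open>Norm convergence and closures of subspaces\<close>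

lemma conv_epsilon: "conv ip s x \<longleftrightarrow> (\<forall>\<epsilon>>0. \<exists>K. \<forall>k\<ge>K. nrm ip (s k - x) < \<epsilon>)"
  by (simp add: conv_def LIMSEQ_iff)

lemma conv_bound:
  assumes "\<And>k. nrm ip (s k - x) \<le> b k" "b \<longlonglongrightarrow> 0"
  shows "conv ip s x"
  unfolding conv_def by (rule tendsto_sandwich[OF _ _ tendsto_const assms(2)]) (auto simp: assms(1))

lemma conv_const: "conv ip (\<lambda>_. x) x"
  by (simp add: conv_def)

lemma conv_add:
  assumes "conv ip s x" "conv ip t y"
  shows "conv ip (\<lambda>k. s k + t k) (x + y)"
proof (rule conv_bound)
  show "nrm ip (s k + t k - (x + y)) \<le> nrm ip (s k - x) + nrm ip (t k - y)" for k
    using nrm_triangle[of "s k - x" "t k - y"] by (simp add: algebra_simps)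
  show "(\<lambda>k. nrm ip (s k - x) + nrm ip (t k - y)) \<longlonglongrightarrow> 0"
    using tendsto_add[OF assms[unfolded conv_def]] by simp
qed

lemma conv_scale:
  assumes "conv ip s x"
  shows "conv ip (\<lambda>k. c *\<^sub>C s k) (c *\<^sub>C x)"
proof -
  have "nrm ip (c *\<^sub>C s k - c *\<^sub>C x) = cmod c * nrm ip (s k - x)" for k
    by (simp add: nrm_scale flip: cvec.scale_right_diff_distrib)
  then show ?thesis
    using tendsto_mult_left[OF assms[unfolded conv_def], of "cmod c"] by (simp add: conv_def)
qed

lemma conv_diff:
  assumes "conv ip s x" "conv ip t y"
  shows "conv ip (\<lambda>k. s k - t k) (x - y)"
  using conv_add[OF assms(1) conv_scale[OF assms(2), of "-1"]] by simp

lemma conv_sum: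
  assumes "\<And>i. i \<in> A \<Longrightarrow> conv ip (s i) (x i)"
  shows "conv ip (\<lambda>k. \<Sum>i\<in>A. s i k) (\<Sum>i\<in>A. x i)"
  using assms
proof (induction A rule: infinite_finite_induct)
  case (insert i A)
  then show ?case using conv_add[of "s i" "x i" "\<lambda>k. \<Sum>i\<in>A. s i k"] by simp
qed (simp_all add: conv_const)

lemma conv_nrm:
  assumes "conv ip s x"
  shows "(\<lambda>k. nrm ip (s k)) \<longlonglongrightarrow> nrm ip x"
proof -
  have "(\<lambda>k. nrm ip (s k) - nrm ip x) \<longlonglongrightarrow> 0"
    by (rule Lim_null_comparison[OF _ assms[unfolded conv_def]]) (simp add: nrm_abs_diff)
  then show ?thesis by (simp add: LIM_zero_iff)
qed

lemma conv_ip: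
  assumes s: "conv ip s x" and t: "conv ip t y"
  shows "(\<lambda>k. ip (s k) (t k)) \<longlonglongrightarrow> ip x y"
proof -
  have "cmod (ip (s k) (t k) - ip x y) \<le> nrm ip (s k) * nrm ip (t k - y) + nrm ip (s k - x) * nrm ip y" for k
  proof -
    have "ip (s k) (t k) - ip x y = ip (s k) (t k - y) + ip (s k - x) y"
      by (simp add: ip_diff_left ip_diff_right)
    then show ?thesis
      using norm_triangle_ineq[of "ip (s k) (t k - y)" "ip (s k - x) y"]
        cauchy_schwarz[of "s k" "t k - y"] cauchy_schwarz[of "s k - x" y] by simp
  qed
  moreover have "(\<lambda>k. nrm ip (s k) * nrm ip (t k - y) + nrm ip (s k - x) * nrm ip y) \<longlonglongrightarrow> nrm ip x * 0 + 0 * nrm ip y"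
    using s t by (intro tendsto_intros conv_nrm) (auto simp: conv_def)
  then have "(\<lambda>k. nrm ip (s k) * nrm ip (t k - y) + nrm ip (s k - x) * nrm ip y) \<longlonglongrightarrow> 0"
    by simp
  ultimately have "(\<lambda>k. ip (s k) (t k) - ip x y) \<longlonglongrightarrow> 0"
    by (rule Lim_null_comparison[OF always_eventually[OF allI]])
  then show ?thesis by (simp add: LIM_zero_iff)
qed

lemma conv_unique:
  assumes "conv ip s x" "conv ip s y"
  shows "x = y"
proof -
  have "conv ip (\<lambda>_. 0) (x - y)"
    using conv_diff[OF assms] by simp
  then have "nrm ip (x - y) = 0"
    by (simp add: conv_def nrm_minus nrm_diff_commute LIMSEQ_const_iff)
  then show ?thesis by simp
qed

text \<open>The epsilon form lets \<open>cclosure_closed\<close> use one triangle inequality in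
  place of a diagonal sequence.\<close>

lemma mem_cclosure_iff: "x \<in> cclosure ip S \<longleftrightarrow> (\<forall>\<epsilon>>0. \<exists>y\<in>S. nrm ip (y - x) < \<epsilon>)"
proof
  assume "x \<in> cclosure ip S"
  then show "\<forall>\<epsilon>>0. \<exists>y\<in>S. nrm ip (y - x) < \<epsilon>"
    unfolding cclosure_def conv_epsilon by blast
next
  assume *: "\<forall>\<epsilon>>0. \<exists>y\<in>S. nrm ip (y - x) < \<epsilon>"
  have "\<exists>y\<in>S. nrm ip (y - x) < inverse (real (Suc k))" for k
    using * by simp
  then obtain s where s: "\<And>k. s k \<in> S" "\<And>k. nrm ip (s k - x) < inverse (real (Suc k))"
    by metis
  have "conv ip s x"
    using s(2) by (intro conv_bound[OF _ LIMSEQ_inverse_real_of_nat]) (simp add: less_imp_le)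
  then show "x \<in> cclosure ip S"
    using s(1) unfolding cclosure_def by blast
qed

lemma cclosure_closed:
  assumes "conv ip s x" "\<And>k. s k \<in> cclosure ip S"
  shows "x \<in> cclosure ip S"
  unfolding mem_cclosure_iff
proof (intro allI impI)
  fix \<epsilon> :: real assume \<epsilon>: "0 < \<epsilon>"
  then obtain k where k: "nrm ip (s k - x) < \<epsilon> / 2"
    using assms(1) unfolding conv_epsilon by (meson half_gt_zero order_refl)
  obtain y where "y \<in> S" "nrm ip (y - s k) < \<epsilon> / 2"
    using assms(2)[of k] \<epsilon> unfolding mem_cclosure_iff by (meson half_gt_zero)
  then show "\<exists>y\<in>S. nrm ip (y - x) < \<epsilon>"
    using k nrm_triangle_diff[of y x "s k"] by (intro bexI[of _ y]) auto
qed

lemma cclosure_base: "x \<in> S \<Longrightarrow> x \<in> cclosure ip S"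
  unfolding cclosure_def by (intro CollectI exI[of _ "\<lambda>_. x"] conjI allI conv_const)

lemma subspace_cclosure:
  assumes "cvec.subspace S"
  shows "cvec.subspace (cclosure ip S)"
  unfolding cvec.subspace_def
proof (intro conjI ballI allI)
  show "0 \<in> cclosure ip S"
    using assms by (intro cclosure_base) (simp add: cvec.subspace_0)
  fix x y c assume x: "x \<in> cclosure ip S"
  then obtain s where s: "\<And>k. s k \<in> S" "conv ip s x" unfolding cclosure_def by blast
  show "c *\<^sub>C x \<in> cclosure ip S"
    unfolding cclosure_def
    by (intro CollectI exI[of _ "\<lambda>k. c *\<^sub>C s k"] conjI allI conv_scale cvec.subspace_scale[OF assms] s)
  assume "y \<in> cclosure ip S"
  then obtain t where t: "\<And>k. t k \<in> S" "conv ip t y" unfolding cclosure_def by blast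
  show "x + y \<in> cclosure ip S"
    unfolding cclosure_def
    by (intro CollectI exI[of _ "\<lambda>k. s k + t k"] conjI allI conv_add cvec.subspace_add[OF assms] s t)
qed

section \<open>Finite orthonormal families and coordinates\<close>

definition orthonormal :: "('i \<Rightarrow> 'a) \<Rightarrow> 'i set \<Rightarrow> bool" where
  "orthonormal e I \<longleftrightarrow> (\<forall>i\<in>I. \<forall>j\<in>I. ip (e i) (e j) = (if i = j then 1 else 0))"

lemma orthonormal_nrm_sum:
  assumes "finite I" "orthonormal e I"
  shows "(nrm ip (\<Sum>i\<in>I. c i *\<^sub>C e i))\<^sup>2 = (\<Sum>i\<in>I. (cmod (c i))\<^sup>2)"
proof -
  have "nrm ip (e i) = 1" if "i \<in> I" for i
    using assms(2) that by (simp add: orthonormal_def nrm_def)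
  then show ?thesis
    using assms by (subst nrm_sum_orthogonal)
      (auto simp: ip_scale_left ip_scale_right orthonormal_def nrm_scale)
qed

lemma orthonormal_ip_sum:
  assumes "finite I" "orthonormal e I" "i \<in> I"
  shows "ip (e i) (\<Sum>j\<in>I. c j *\<^sub>C e j) = c i"
proof -
  have "ip (e i) (\<Sum>j\<in>I. c j *\<^sub>C e j) = (\<Sum>j\<in>I. if i = j then c j else 0)"
    unfolding ip_sum_right using assms by (intro sum.cong) (auto simp: ip_scale_right orthonormal_def)
  then show ?thesis using assms by simp
qed

lemma bessel_diff:
  assumes "finite I" "orthonormal e I"
  shows "(nrm ip (x - (\<Sum>i\<in>I. ip (e i) x *\<^sub>C e i)))\<^sup>2 = (nrm ip x)\<^sup>2 - (\<Sum>i\<in>I. (cmod (ip (e i) x))\<^sup>2)"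
proof -
  let ?p = "\<Sum>i\<in>I. ip (e i) x *\<^sub>C e i"
  have "ip (ip (e i) x *\<^sub>C e i) (x - ?p) = 0" if "i \<in> I" for i
    using orthonormal_ip_sum[OF assms that] by (simp add: ip_scale_left ip_diff_right)
  then have "ip ?p (x - ?p) = 0"
    by (subst ip_sum_left) (rule sum.neutral, blast)
  then show ?thesis
    using nrm_pyth[of ?p "x - ?p"] by (simp add: orthonormal_nrm_sum[OF assms])
qed

lemma bessel:
  assumes "finite I" "orthonormal e I"
  shows "(\<Sum>i\<in>I. (cmod (ip (e i) x))\<^sup>2) \<le> (nrm ip x)\<^sup>2"
  using bessel_diff[OF assms, of x] by (smt (verit) zero_le_power2)

text \<open>Adapts an orthonormal family to finitely many given vectors, so that later estimates
  become finite coordinate computations. The induction keeps the family if the new vector lies in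
  its span and otherwise adjoins the normalised residual.\<close>

lemma gram_schmidt:
  assumes "finite X"
  shows "\<exists>(u :: nat \<Rightarrow> 'a) d. orthonormal u {..<d} \<and> (\<forall>x\<in>X. x = (\<Sum>k<d. ip (u k) x *\<^sub>C u k))"
  using assms
proof (induction X rule: finite_induct)
  case empty
  have "orthonormal (u :: nat \<Rightarrow> 'a) {..<0}" for u by (simp add: orthonormal_def)
  then show ?case by blast
next
  case (insert y X)
  then obtain u d where u: "orthonormal (u :: nat \<Rightarrow> 'a) {..<d}"
    and X: "\<And>x. x \<in> X \<Longrightarrow> x = (\<Sum>k<d. ip (u k) x *\<^sub>C u k)" by blast
  define r where "r = y - (\<Sum>k<d. ip (u k) y *\<^sub>C u k)"
  show ?case
  proof (cases "r = 0")
    case True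
    then show ?thesis using u X unfolding r_def by (intro exI[of _ u] exI[of _ d]) auto
  next
    case False
    then have r: "nrm ip r \<noteq> 0" by simp
    have ur: "ip (u k) r = 0" if "k < d" for k
      using orthonormal_ip_sum[OF _ u, of k] that by (simp add: r_def ip_diff_right)
    define w where "w = complex_of_real (inverse (nrm ip r)) *\<^sub>C r"
    define v where "v = u (d := w)"
    have vk: "v k = u k" if "k < d" for k using that by (simp add: v_def)
    have uw: "ip (u k) w = 0" if "k < d" for k using ur[OF that] by (simp add: w_def ip_scale_right)
    have ww: "ip w w = 1"
      using r by (simp add: ip_self w_def nrm_scale norm_inverse)
    have v: "orthonormal v {..<Suc d}"
      unfolding orthonormal_def
    proof (intro ballI)
      fix i j assume "i \<in> {..<Suc d}" "j \<in> {..<Suc d}"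
      then consider "i < d" "j < d" | "i < d" "j = d" | "i = d" "j < d" | "i = d" "j = d"
        by (auto simp: less_Suc_eq)
      then show "ip (v i) (v j) = (if i = j then 1 else 0)"
        using u ww uw ip_zero_sym[OF uw] by cases (auto simp: v_def orthonormal_def)
    qed
    \<comment> \<open>The old vectors have no component along the new direction, so their expansions
      survive the extension.\<close>
    have wX: "ip w x = 0" if "x \<in> X" for x
    proof -
      have "ip w x = (\<Sum>k<d. ip (u k) x * ip w (u k))"
        by (subst X[OF that]) (simp add: ip_sum_right ip_scale_right)
      also have "\<dots> = 0"
        by (intro sum.neutral) (simp add: ip_zero_sym[OF uw])
      finally show ?thesis .
    qed
    have "x = (\<Sum>k<Suc d. ip (v k) x *\<^sub>C v k)" if "x \<in> X" for x
      using X[OF that] wX[OF that] by (simp add: vk) (simp add: v_def)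
    moreover have "y = (\<Sum>k<Suc d. ip (v k) y *\<^sub>C v k)"
    proof -
      have "ip w y = ip w r"
        unfolding r_def ip_diff_right ip_sum_right ip_scale_right
        by (simp add: ip_zero_sym[OF uw])
      also have "\<dots> = of_real (nrm ip r)"
        using r by (simp add: w_def ip_scale_left ip_self power2_eq_square)
      finally have "ip w y *\<^sub>C w = r"
        using r by (simp add: w_def)
      then show ?thesis by (simp add: vk) (simp add: v_def r_def)
    qed
    ultimately show ?thesis using v by blast
  qed
qed

text \<open>In orthonormal coordinates of the vectors \<open>x i\<close> the matrix acts on each
  coordinate separately, so the scalar bound holds coordinatewise and adds up with the same
  constant. This carries an operator bound on \<open>L\<close> to sums of Fock vectors without a
  dimension factor.\<close>

lemma matrix_bound:
  fixes x :: "'i \<Rightarrow> 'a"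
  assumes "finite I"
    and M: "\<And>t. (\<Sum>k\<in>K. (cmod (\<Sum>i\<in>I. M k i * t i))\<^sup>2) \<le> c * (\<Sum>i\<in>I. (cmod (t i))\<^sup>2)"
  shows "(\<Sum>k\<in>K. (nrm ip (\<Sum>i\<in>I. M k i *\<^sub>C x i))\<^sup>2) \<le> c * (\<Sum>i\<in>I. (nrm ip (x i))\<^sup>2)"
proof -
  obtain u d where u: "orthonormal (u :: nat \<Rightarrow> 'a) {..<d}"
    and x: "\<And>i. i \<in> I \<Longrightarrow> x i = (\<Sum>l<d. ip (u l) (x i) *\<^sub>C u l)"
    using gram_schmidt[of "x ` I"] assms(1) by blast
  have sum_x: "(\<Sum>i\<in>I. m i *\<^sub>C x i) = (\<Sum>l<d. (\<Sum>i\<in>I. m i * ip (u l) (x i)) *\<^sub>C u l)" for m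
  proof -
    have "(\<Sum>i\<in>I. m i *\<^sub>C x i) = (\<Sum>i\<in>I. \<Sum>l<d. (m i * ip (u l) (x i)) *\<^sub>C u l)"
      using x by (intro sum.cong refl) (simp flip: cvec.scale_scale cvec.scale_sum_right)
    also have "\<dots> = (\<Sum>l<d. \<Sum>i\<in>I. (m i * ip (u l) (x i)) *\<^sub>C u l)"
      by (rule sum.swap)
    finally show ?thesis by (simp add: cvec.scale_sum_left)
  qed
  have nrm_x: "(\<Sum>l<d. (cmod (ip (u l) (x i)))\<^sup>2) = (nrm ip (x i))\<^sup>2" if "i \<in> I" for i
    using orthonormal_nrm_sum[OF _ u, of "\<lambda>l. ip (u l) (x i)"] x[OF that] by simp
  have "(\<Sum>k\<in>K. (nrm ip (\<Sum>i\<in>I. M k i *\<^sub>C x i))\<^sup>2)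
      = (\<Sum>k\<in>K. \<Sum>l<d. (cmod (\<Sum>i\<in>I. M k i * ip (u l) (x i)))\<^sup>2)"
    unfolding sum_x orthonormal_nrm_sum[OF finite_lessThan u] ..
  also have "\<dots> = (\<Sum>l<d. \<Sum>k\<in>K. (cmod (\<Sum>i\<in>I. M k i * ip (u l) (x i)))\<^sup>2)"
    by (rule sum.swap)
  also have "\<dots> \<le> (\<Sum>l<d. c * (\<Sum>i\<in>I. (cmod (ip (u l) (x i)))\<^sup>2))"
    by (intro sum_mono M)
  also have "\<dots> = c * (\<Sum>i\<in>I. \<Sum>l<d. (cmod (ip (u l) (x i)))\<^sup>2)"
    unfolding sum_distrib_left[symmetric] by (subst sum.swap) (rule refl)
  also have "\<dots> = c * (\<Sum>i\<in>I. (nrm ip (x i))\<^sup>2)"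
    using nrm_x by simp
  finally show ?thesis .
qed

text \<open>The Hilbert-Schmidt sum dominates the squared operator norm. Applied to a tail of the
  series it supplies a constant that tends to zero.\<close>

lemma nrm_sum_scale_le:
  "(nrm ip (\<Sum>i\<in>I. t i *\<^sub>C f i))\<^sup>2 \<le> (\<Sum>i\<in>I. (nrm ip (f i))\<^sup>2) * (\<Sum>i\<in>I. (cmod (t i))\<^sup>2)"
proof -
  have "nrm ip (\<Sum>i\<in>I. t i *\<^sub>C f i) \<le> (\<Sum>i\<in>I. nrm ip (f i) * cmod (t i))"
    using nrm_sum_le[of "\<lambda>i. t i *\<^sub>C f i" I] by (simp add: nrm_scale mult.commute)
  then have "(nrm ip (\<Sum>i\<in>I. t i *\<^sub>C f i))\<^sup>2 \<le> (\<Sum>i\<in>I. nrm ip (f i) * cmod (t i))\<^sup>2"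
    by (rule power_mono) simp
  then show ?thesis
    using Cauchy_Schwarz_ineq_sum[of "\<lambda>i. nrm ip (f i)" "\<lambda>i. cmod (t i)" I] by (rule order_trans)
qed

lemma cons_orthonormal: "cons ip e \<Longrightarrow> orthonormal e I"
  by (simp add: cons_def orthonormal_def)

end

subsection \<open>Hilbert spaces and Hilbert--Schmidt operators\<close>

locale chs = ips ip for ip :: "'a::cvec \<Rightarrow> 'a \<Rightarrow> complex" +
  assumes complete: "(\<And>\<epsilon>. \<epsilon> > 0 \<Longrightarrow> \<exists>N. \<forall>m\<ge>N. \<forall>n\<ge>N. nrm ip (s m - s n) < \<epsilon>) \<Longrightarrow> \<exists>x. conv ip s x"
begin

text \<open>Fits series whose squared tails are controlled by the tails of a convergent real series:
  \<open>b\<close> is then the sequence of real partial sums.\<close>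

lemma complete_sq:
  assumes "\<And>m n. m \<le> n \<Longrightarrow> (nrm ip (s n - s m))\<^sup>2 \<le> b n - b m" and "convergent b"
  shows "\<exists>x. conv ip s x"
proof (rule complete)
  fix \<epsilon> :: real assume "0 < \<epsilon>"
  then obtain N where N: "\<And>m n. m \<ge> N \<Longrightarrow> n \<ge> N \<Longrightarrow> norm (b m - b n) < \<epsilon>\<^sup>2"
    using CauchyD[OF convergent_Cauchy[OF assms(2)], of "\<epsilon>\<^sup>2"] by auto
  have *: "nrm ip (s n - s m) < \<epsilon>" if "m \<le> n" "N \<le> m" for m n
  proof (rule power2_less_imp_less)
    have "b n - b m < \<epsilon>\<^sup>2"
      using N[of n m] that by auto
    then show "(nrm ip (s n - s m))\<^sup>2 < \<epsilon>\<^sup>2"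
      using assms(1)[OF that(1)] by linarith
  qed (use \<open>0 < \<epsilon>\<close> in simp)
  show "\<exists>N. \<forall>m\<ge>N. \<forall>n\<ge>N. nrm ip (s m - s n) < \<epsilon>"
  proof (intro exI allI impI)
    fix m n assume "N \<le> m" "N \<le> n"
    then show "nrm ip (s m - s n) < \<epsilon>"
      using *[of m n] *[of n m] nrm_diff_commute[of "s m" "s n"] by (cases "m \<le> n") auto
  qed
qed

lemma orthonormal_series_conv:
  assumes e: "\<And>I. orthonormal e I" and c: "summable (\<lambda>j::nat. (cmod (c j))\<^sup>2)"
  shows "\<exists>x. conv ip (\<lambda>M. \<Sum>j<M. c j *\<^sub>C e j) x"
proof (rule complete_sq)
  show "convergent (\<lambda>M. \<Sum>j<M. (cmod (c j))\<^sup>2)"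
    using c by (simp add: summable_iff_convergent)
  fix m n :: nat assume "m \<le> n"
  then have "(\<Sum>j<n. c j *\<^sub>C e j) - (\<Sum>j<m. c j *\<^sub>C e j) = (\<Sum>j\<in>{m..<n}. c j *\<^sub>C e j)"
    "(\<Sum>j<n. (cmod (c j))\<^sup>2) - (\<Sum>j<m. (cmod (c j))\<^sup>2) = (\<Sum>j\<in>{m..<n}. (cmod (c j))\<^sup>2)"
    by (simp_all add: sum_diff_nat_ivl flip: atLeast0LessThan)
  then show "(nrm ip ((\<Sum>j<n. c j *\<^sub>C e j) - (\<Sum>j<m. c j *\<^sub>C e j)))\<^sup>2
      \<le> (\<Sum>j<n. (cmod (c j))\<^sup>2) - (\<Sum>j<m. (cmod (c j))\<^sup>2)"
    using orthonormal_nrm_sum[OF _ e, of "{m..<n}" c] by simp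
qed

text \<open>Completeness in \<open>cons\<close> only says that no nonzero vector is orthogonal to
  all \<open>e j\<close>. Bessel makes the series converge to some \<open>y\<close>, and
  \<open>x - y\<close> is orthogonal to every \<open>e i\<close>.\<close>

lemma cons_expansion:
  assumes "cons ip e"
  shows "conv ip (\<lambda>M. \<Sum>j<M. ip (e j) x *\<^sub>C e j) x"
proof -
  note e = cons_orthonormal[OF assms]
  have "summable (\<lambda>j. (cmod (ip (e j) x))\<^sup>2)"
    by (rule summableI_nonneg_bounded[where x = "(nrm ip x)\<^sup>2"]) (auto intro: bessel e)
  then obtain y where y: "conv ip (\<lambda>M. \<Sum>j<M. ip (e j) x *\<^sub>C e j) y"
    using orthonormal_series_conv[OF e, of "\<lambda>j. ip (e j) x"] by auto
  have "ip (e i) (x - y) = 0" for i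
  proof -
    have "(\<lambda>M. ip (e i) (\<Sum>j<M. ip (e j) x *\<^sub>C e j)) \<longlonglongrightarrow> ip (e i) y"
      by (rule conv_ip[OF conv_const y])
    moreover have "\<forall>\<^sub>F M in sequentially. ip (e i) (\<Sum>j<M. ip (e j) x *\<^sub>C e j) = ip (e i) x"
      using eventually_gt_at_top[of i] by eventually_elim (simp add: orthonormal_ip_sum[OF _ e])
    ultimately have "ip (e i) y = ip (e i) x"
      using LIMSEQ_unique[OF _ tendsto_eventually] by blast
    then show ?thesis by (simp add: ip_diff_right)
  qed
  then have "x = y" using assms unfolding cons_def by (metis eq_iff_diff_eq_0)
  then show ?thesis using y by simp
qed

lemma parseval:
  assumes "cons ip e"
  shows "(\<lambda>j. (cmod (ip (e j) x))\<^sup>2) sums (nrm ip x)\<^sup>2"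
proof -
  have "(\<lambda>M. (nrm ip (\<Sum>j<M. ip (e j) x *\<^sub>C e j))\<^sup>2) \<longlonglongrightarrow> (nrm ip x)\<^sup>2"
    by (intro tendsto_intros conv_nrm cons_expansion assms)
  then show ?thesis
    by (simp add: sums_def orthonormal_nrm_sum[OF _ cons_orthonormal[OF assms]])
qed

text \<open>A relation in place of the \<open>THE\<close> in \<open>adj\<close>: it is symmetric in
  its two operators, and it separates the existence of an adjoint from its use.\<close>

definition adjoint_pair :: "('a \<Rightarrow> 'a) \<Rightarrow> ('a \<Rightarrow> 'a) \<Rightarrow> bool" where
  "adjoint_pair A B \<longleftrightarrow> (\<forall>x y. ip x (B y) = ip (A x) y)"

lemma adjoint_pair_sym: "adjoint_pair A B \<Longrightarrow> adjoint_pair B A"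
  unfolding adjoint_pair_def by (intro allI) (subst (1 2) ip_cnj, simp)

lemma adj_eqI:
  assumes "adjoint_pair A B"
  shows "adj ip A = B"
proof
  fix y
  show "adj ip A y = B y"
    unfolding adj_def
  proof (rule the_equality)
    show "\<forall>x. ip x (B y) = ip (A x) y" using assms by (simp add: adjoint_pair_def)
    fix z assume z: "\<forall>x. ip x z = ip (A x) y"
    have "ip x (z - B y) = 0" for x
      using z assms by (simp add: adjoint_pair_def ip_diff_right)
    then show "z = B y" using ip_self_0[of "z - B y"] by simp
  qed
qed

lemma bounded_op_sum:
  assumes "bounded_op ip C"
  shows "C (\<Sum>i\<in>I. c i *\<^sub>C x i) = (\<Sum>i\<in>I. c i *\<^sub>C C (x i))"
proof -
  have C: "C (x + y) = C x + C y" "C (c *\<^sub>C x) = c *\<^sub>C C x" for c x y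
    using assms unfolding bounded_op_def by blast+
  have "C 0 = 0" using C(2)[of 0 0] by simp
  then show ?thesis
    by (induction I rule: infinite_finite_induct) (auto simp: C)
qed

lemma bounded_op_conv:
  assumes "bounded_op ip C" "conv ip s x"
  shows "conv ip (\<lambda>k. C (s k)) (C x)"
proof -
  obtain K where K: "\<And>x. nrm ip (C x) \<le> K * nrm ip x"
    using assms(1) unfolding bounded_op_def by blast
  have C: "C (x - y) = C x - C y" for x y
    using bounded_op_sum[OF assms(1), of "\<lambda>b. if b then 1 else -1" "\<lambda>b. if b then x else y" UNIV]
    by (simp add: UNIV_bool)
  show ?thesis
  proof (rule conv_bound)
    show "nrm ip (C (s k) - C x) \<le> K * nrm ip (s k - x)" for k
      using K by (simp flip: C)
    show "(\<lambda>k. K * nrm ip (s k - x)) \<longlonglongrightarrow> 0"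
      using tendsto_mult_left[OF assms(2)[unfolded conv_def], of K] by simp
  qed
qed

text \<open>The value at \<open>y\<close> is written down as the series with coefficients
  \<open>ip (C (e j)) y\<close>, which are square summable because \<open>C\<close> is
  Hilbert-Schmidt.\<close>

lemma adjoint_exists:
  assumes C: "hs_op ip C"
  shows "\<exists>B. adjoint_pair C B"
proof -
  from C obtain e where e: "cons ip e" and sm: "summable (\<lambda>j. (nrm ip (C (e j)))\<^sup>2)"
    and b: "bounded_op ip C"
    unfolding hs_op_def by blast
  have "\<exists>z. \<forall>x. ip x z = ip (C x) y" for y
  proof -
    have "summable (\<lambda>j. (cmod (ip (C (e j)) y))\<^sup>2)"
    proof (rule summable_comparison_test'[OF summable_mult2[OF sm, of "(nrm ip y)\<^sup>2"], of 0])
      fix j :: nat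
      show "norm ((cmod (ip (C (e j)) y))\<^sup>2) \<le> (nrm ip (C (e j)))\<^sup>2 * (nrm ip y)\<^sup>2"
        using power_mono[OF cauchy_schwarz[of "C (e j)" y], of 2] by (simp add: power_mult_distrib)
    qed
    then obtain z where z: "conv ip (\<lambda>M. \<Sum>j<M. ip (C (e j)) y *\<^sub>C e j) z"
      using orthonormal_series_conv[OF cons_orthonormal[OF e]] by metis
    have "ip x z = ip (C x) y" for x
    proof (rule LIMSEQ_unique)
      show "(\<lambda>M. ip x (\<Sum>j<M. ip (C (e j)) y *\<^sub>C e j)) \<longlonglongrightarrow> ip x z"
        by (rule conv_ip[OF conv_const z])
      have "(\<lambda>M. ip (C (\<Sum>j<M. ip (e j) x *\<^sub>C e j)) y) \<longlonglongrightarrow> ip (C x) y"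
        by (rule conv_ip[OF bounded_op_conv[OF b cons_expansion[OF e]] conv_const])
      moreover have "ip (C (\<Sum>j<M. ip (e j) x *\<^sub>C e j)) y = ip x (\<Sum>j<M. ip (C (e j)) y *\<^sub>C e j)" for M
        unfolding bounded_op_sum[OF b] ip_sum_left ip_sum_right ip_scale_left ip_scale_right
        by (intro sum.cong refl) (subst (2) ip_cnj, simp add: mult.commute)
      ultimately show "(\<lambda>M. ip x (\<Sum>j<M. ip (C (e j)) y *\<^sub>C e j)) \<longlonglongrightarrow> ip (C x) y"
        by simp
    qed
    then show ?thesis by blast
  qed
  then show ?thesis unfolding adjoint_pair_def by metis
qed

text \<open>Both sides are sums of the squared matrix entries between \<open>e\<close> and
  \<open>g\<close>: Parseval in \<open>e\<close> evaluates finitely many \<open>B (g k)\<close>, and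
  Bessel in \<open>g\<close> bounds the result by the \<open>A (e j)\<close>.\<close>

lemma hs_sum_adjoint_le:
  assumes AB: "adjoint_pair A B" and e: "cons ip e" and g: "cons ip g"
    and sm: "summable (\<lambda>j. (nrm ip (A (e j)))\<^sup>2)"
  shows "summable (\<lambda>j. (nrm ip (B (g j)))\<^sup>2)"
    and "(\<Sum>j. (nrm ip (B (g j)))\<^sup>2) \<le> (\<Sum>j. (nrm ip (A (e j)))\<^sup>2)"
proof -
  have flip: "cmod (ip (e j) (B (g k))) = cmod (ip (g k) (A (e j)))" for j k
    using AB cmod_ip_commute[of "A (e j)" "g k"] unfolding adjoint_pair_def by metis
  have *: "(\<Sum>k<K. (nrm ip (B (g k)))\<^sup>2) \<le> (\<Sum>j. (nrm ip (A (e j)))\<^sup>2)" for K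
  proof -
    have "(\<lambda>j. \<Sum>k<K. (cmod (ip (e j) (B (g k))))\<^sup>2) sums (\<Sum>k<K. (nrm ip (B (g k)))\<^sup>2)"
      by (intro sums_sum parseval e)
    then have s: "(\<lambda>j. \<Sum>k<K. (cmod (ip (g k) (A (e j))))\<^sup>2) sums (\<Sum>k<K. (nrm ip (B (g k)))\<^sup>2)"
      by (simp add: flip)
    show ?thesis
      by (rule sums_le[OF _ s summable_sums[OF sm]]) (intro bessel cons_orthonormal g finite_lessThan)
  qed
  show sB: "summable (\<lambda>j. (nrm ip (B (g j)))\<^sup>2)"
    by (rule summableI_nonneg_bounded[OF _ *]) simp
  show "(\<Sum>j. (nrm ip (B (g j)))\<^sup>2) \<le> (\<Sum>j. (nrm ip (A (e j)))\<^sup>2)"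
    by (rule suminf_le_const[OF sB *])
qed

lemma hs_op_sums:
  assumes C: "hs_op ip C" and g: "cons ip g"
  shows "(\<lambda>j. (nrm ip (C (g j)))\<^sup>2) sums hs_norm_sq ip C"
proof -
  from C obtain e where e: "cons ip e" and sm: "summable (\<lambda>j. (nrm ip (C (e j)))\<^sup>2)"
    unfolding hs_op_def by blast
  obtain B where B: "adjoint_pair C B" using adjoint_exists[OF C] by blast
  note B' = adjoint_pair_sym[OF B]
  have all: "(\<lambda>j. (nrm ip (C (f j)))\<^sup>2) sums (\<Sum>j. (nrm ip (C (e j)))\<^sup>2)" if f: "cons ip f" for f
  proof -
    \<comment> \<open>The four inequalities form a circle from \<open>C\<close> on \<open>e\<close>
      through \<open>B\<close> on \<open>e\<close>, \<open>C\<close> on \<open>f\<close> and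
      \<open>B\<close> on \<open>e\<close> back to \<open>C\<close> on \<open>e\<close>, so all
      these sums are equal.\<close>
    note 1 = hs_sum_adjoint_le[OF B e e sm]
    note 2 = hs_sum_adjoint_le[OF B' e f 1(1)]
    note 3 = hs_sum_adjoint_le[OF B f e 2(1)]
    note 4 = hs_sum_adjoint_le[OF B' e e 3(1)]
    show ?thesis using 1 2 3 4 by (simp add: sums_iff)
  qed
  have "hs_norm_sq ip C = (\<Sum>j. (nrm ip (C (e j)))\<^sup>2)"
    unfolding hs_norm_sq_def
    by (rule the_equality) (use all e sums_unique2 in blast)+
  then show ?thesis using all[OF g] by simp
qed

lemma hs_op_adjoint:
  assumes C: "hs_op ip C" and B: "adjoint_pair C B"
  shows "hs_op ip B"
proof -
  note B' = B[unfolded adjoint_pair_def, rule_format]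
  have eqI: "u = v" if "\<And>x. ip x u = ip x v" for u v
    using ip_self_0[of "u - v"] that[of "u - v"] by (simp add: ip_diff_right)
  have "B (x + y) = B x + B y" for x y
    by (rule eqI) (simp add: B' ip_add_right)
  moreover have "B (c *\<^sub>C x) = c *\<^sub>C B x" for c x
    by (rule eqI) (simp add: B' ip_scale_right)
  moreover
  obtain K where K: "\<And>x. nrm ip (C x) \<le> K * nrm ip x"
    using C unfolding hs_op_def bounded_op_def by blast
  have "nrm ip (B y) \<le> K * nrm ip y" for y
  proof (cases "B y = 0")
    case False
    have "(nrm ip (B y))\<^sup>2 = cmod (ip (B y) (B y))"
      by (simp add: ip_self norm_power)
    also have "\<dots> \<le> nrm ip (C (B y)) * nrm ip y"
      unfolding B' by (rule cauchy_schwarz)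
    also have "\<dots> \<le> (K * nrm ip (B y)) * nrm ip y"
      by (intro mult_right_mono K) simp
    finally have "nrm ip (B y) * nrm ip (B y) \<le> nrm ip (B y) * (K * nrm ip y)"
      by (simp add: power2_eq_square algebra_simps)
    then show ?thesis using False by (simp add: less_le mult_le_cancel_left_pos)
  next
    case True
    \<comment> \<open>The constant \<open>K\<close> carries no sign assumption;
      \<open>K * nrm ip y\<close> is nonnegative because it dominates
      \<open>nrm ip (C y)\<close>.\<close>
    then show ?thesis using K[of y] nrm_ge_0[of "C y"] by (metis nrm_zero order_trans)
  qed
  ultimately have "bounded_op ip B" unfolding bounded_op_def by blast
  moreover obtain e where e: "cons ip e" and sm: "summable (\<lambda>j. (nrm ip (C (e j)))\<^sup>2)"
    using C unfolding hs_op_def by blast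
  ultimately show ?thesis
    unfolding hs_op_def using hs_sum_adjoint_le(1)[OF B e e sm] e by blast
qed

lemma opnorm_bound:
  assumes "bounded_op ip C"
  shows "nrm ip (C x) \<le> opnorm ip C * nrm ip x" "0 \<le> opnorm ip C"
proof -
  obtain K where K: "\<And>x. nrm ip (C x) \<le> K * nrm ip x"
    using assms unfolding bounded_op_def by blast
  have C: "C (c *\<^sub>C x) = c *\<^sub>C C x" for c x
    using assms unfolding bounded_op_def by blast
  have bdd: "bdd_above {nrm ip (C x) |x. nrm ip x \<le> 1}"
  proof (rule bdd_aboveI)
    fix r assume "r \<in> {nrm ip (C x) |x. nrm ip x \<le> 1}"
    then obtain x where r: "r = nrm ip (C x)" and x: "nrm ip x \<le> 1" by blast
    have "K * nrm ip x \<le> \<bar>K\<bar> * 1"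
      using x by (intro mult_mono) auto
    then show "r \<le> \<bar>K\<bar>" using K[of x] r by simp
  qed
  have le: "nrm ip (C x) \<le> opnorm ip C" if "nrm ip x \<le> 1" for x
    unfolding opnorm_def using that by (intro cSup_upper[OF _ bdd]) blast
  show "0 \<le> opnorm ip C"
    using le[of 0] nrm_ge_0[of "C 0"] by (metis nrm_zero order_trans zero_le_one)
  show "nrm ip (C x) \<le> opnorm ip C * nrm ip x"
  proof (cases "x = 0")
    case True
    then show ?thesis using C[of 0 0] by simp
  next
    case False
    then have n: "nrm ip x > 0" by (simp add: less_le)
    let ?c = "complex_of_real (inverse (nrm ip x))"
    have c: "cmod ?c = inverse (nrm ip x)"
      using n by (simp only: norm_of_real) simp
    have "inverse (nrm ip x) * nrm ip (C x) \<le> opnorm ip C"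
      using le[of "?c *\<^sub>C x"] n unfolding C nrm_scale c by (metis left_inverse less_irrefl order_refl)
    then show ?thesis
      using n by (simp add: field_simps)
  qed
qed

end

lemma chs_iff_hilbert: "chs ip \<longleftrightarrow> hilbert ip"
  unfolding chs_def chs_axioms_def ips_def hilbert_def by (rule refl)

subsection \<open>Orthogonal sums of sectors\<close>

text \<open>The sectors \<open>S n\<close> are algebraic spans and need not be closed. Keeping them
  apart from their closures \<open>H n\<close> allows the CCR to be used on \<open>S n\<close>
  before passing to limits.\<close>

locale graded_space = chs ip for ip :: "'a::cvec \<Rightarrow> 'a \<Rightarrow> complex" +
  fixes S :: "nat \<Rightarrow> 'a set"
  assumes subspace_S: "cvec.subspace (S n)"
    and orth_S: "m \<noteq> n \<Longrightarrow> x \<in> S m \<Longrightarrow> y \<in> S n \<Longrightarrow> ip x y = 0"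
    and dense_S: "cclosure ip (cvec.span (\<Union>n. S n)) = UNIV"
begin

definition H :: "nat \<Rightarrow> 'a set" where
  "H n = cclosure ip (S n)"

text \<open>Has the same \<open>THE\<close> body as \<open>comp\<close>, so that the two agree by
  unfolding.\<close>

definition P :: "nat \<Rightarrow> 'a \<Rightarrow> 'a" where
  "P n x = (THE y. y \<in> H n \<and> (\<forall>\<xi>\<in>H n. ip \<xi> (x - y) = 0))"

definition Fin :: "'a set" where
  "Fin = cvec.span (\<Union>n. S n)"

lemma S_H: "x \<in> S n \<Longrightarrow> x \<in> H n"
  unfolding H_def by (rule cclosure_base)

lemma S_Fin: "x \<in> S n \<Longrightarrow> x \<in> Fin"
  unfolding Fin_def by (rule cvec.span_base) blast

lemma subspace_Fin: "cvec.subspace Fin"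
  unfolding Fin_def by (rule cvec.subspace_span)

lemma Fin_dense: "\<exists>s. (\<forall>k. s k \<in> Fin) \<and> conv ip s x"
proof -
  have "x \<in> cclosure ip Fin" using dense_S unfolding Fin_def by simp
  then show ?thesis unfolding cclosure_def by blast
qed

lemma H_closed: "conv ip s x \<Longrightarrow> (\<And>k. s k \<in> H n) \<Longrightarrow> x \<in> H n"
  unfolding H_def by (rule cclosure_closed)

lemma subspace_H: "cvec.subspace (H n)"
  unfolding H_def by (intro subspace_cclosure subspace_S)

lemma H_approx:
  assumes "x \<in> H n"
  obtains s where "\<And>k. s k \<in> S n" "conv ip s x"
  using assms unfolding H_def cclosure_def by blast

lemma ip_H_eqI:
  assumes x: "x \<in> H n" and "\<And>\<xi>. \<xi> \<in> S n \<Longrightarrow> ip \<xi> u = ip \<xi> v"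
  shows "ip x u = ip x v"
proof -
  obtain s where s: "\<And>k. s k \<in> S n" "conv ip s x" using H_approx[OF x] by blast
  have "(\<lambda>k. ip (s k) u) \<longlonglongrightarrow> ip x u" "(\<lambda>k. ip (s k) v) \<longlonglongrightarrow> ip x v"
    by (intro conv_ip s conv_const)+
  moreover have "(\<lambda>k. ip (s k) u) = (\<lambda>k. ip (s k) v)"
    using assms(2) s(1) by blast
  ultimately show ?thesis using LIMSEQ_unique by metis
qed

lemma orth_H:
  assumes "m \<noteq> n" "x \<in> H m" "y \<in> H n"
  shows "ip x y = 0"
proof -
  have "ip \<xi> y = 0" if "\<xi> \<in> S m" for \<xi>
  proof -
    have "ip y \<xi> = ip y 0"
      using orth_S[of n m] assms(1) that by (intro ip_H_eqI[OF assms(3)]) auto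
    then show ?thesis by (intro ip_zero_sym[of y]) simp
  qed
  then have "ip x y = ip x 0"
    by (intro ip_H_eqI[OF assms(2)]) auto
  then show ?thesis by simp
qed

text \<open>Serves to show that the orthogonal projection onto \<open>H n\<close> exists: this is
  clear on each sector, hence on the dense subspace \<open>Fin\<close>, and it survives limits
  because projecting is a contraction.\<close>

definition projectable :: "nat \<Rightarrow> 'a set" where
  "projectable n = {x. \<exists>y\<in>H n. \<forall>\<xi>\<in>H n. ip \<xi> (x - y) = 0}"

lemma subspace_projectable: "cvec.subspace (projectable n)"
  unfolding cvec.subspace_def
proof (intro conjI ballI allI)
  show "0 \<in> projectable n"
    unfolding projectable_def using cvec.subspace_0[OF subspace_H] by (intro CollectI bexI[of _ 0]) auto
  fix x c assume "x \<in> projectable n"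
  then obtain y where y: "y \<in> H n" "\<And>\<xi>. \<xi> \<in> H n \<Longrightarrow> ip \<xi> (x - y) = 0"
    unfolding projectable_def by blast
  show "c *\<^sub>C x \<in> projectable n"
    unfolding projectable_def
    using y cvec.subspace_scale[OF subspace_H y(1)]
    by (intro CollectI bexI[of _ "c *\<^sub>C y"])
      (auto simp: ip_scale_right simp flip: cvec.scale_right_diff_distrib)
  fix x' assume "x' \<in> projectable n"
  then obtain y' where y': "y' \<in> H n" "\<And>\<xi>. \<xi> \<in> H n \<Longrightarrow> ip \<xi> (x' - y') = 0"
    unfolding projectable_def by blast
  have "ip \<xi> (x + x' - (y + y')) = 0" if "\<xi> \<in> H n" for \<xi>
    using y(2)[OF that] y'(2)[OF that] by (simp add: ip_add_right ip_diff_right)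
  then show "x + x' \<in> projectable n"
    unfolding projectable_def
    using cvec.subspace_add[OF subspace_H y(1) y'(1)] by blast
qed

lemma projectable_UNIV: "x \<in> projectable n"
proof -
  have "S m \<subseteq> projectable n" for m
  proof
    fix x assume x: "x \<in> S m"
    show "x \<in> projectable n"
    proof (cases "m = n")
      case True
      then show ?thesis
        unfolding projectable_def using S_H[OF x] by (intro CollectI bexI[of _ x]) auto
    next
      case False
      then have "ip \<xi> (x - 0) = 0" if "\<xi> \<in> H n" for \<xi>
        using orth_H[OF _ that S_H[OF x]] by simp
      then show ?thesis
        unfolding projectable_def using cvec.subspace_0[OF subspace_H] by blast
    qed
  qed
  then have Fin: "Fin \<subseteq> projectable n"
    unfolding Fin_def by (intro cvec.span_minimal subspace_projectable) blast
  obtain s where s: "\<And>k. s k \<in> Fin" "conv ip s x" using Fin_dense by blast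
  have "\<forall>k. \<exists>y. y \<in> H n \<and> (\<forall>\<xi>\<in>H n. ip \<xi> (s k - y) = 0)"
    using Fin s(1) unfolding projectable_def by blast
  then obtain y where y: "\<And>k. y k \<in> H n" "\<And>k \<xi>. \<xi> \<in> H n \<Longrightarrow> ip \<xi> (s k - y k) = 0"
    by metis
  \<comment> \<open>\<open>y k - y l\<close> is the projection of \<open>s k - s l\<close>, so
    Pythagoras transfers the Cauchy property from \<open>s\<close> to \<open>y\<close>.\<close>
  have le: "nrm ip (y k - y l) \<le> nrm ip (s k - s l)" for k l
  proof (rule power2_le_imp_le)
    have "y k - y l \<in> H n" by (intro cvec.subspace_diff subspace_H y)
    then have "ip (y k - y l) ((s k - s l) - (y k - y l)) = 0"
      using y(2)[of "y k - y l"] by (simp add: ip_diff_right)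
    from nrm_pyth[OF this] show "(nrm ip (y k - y l))\<^sup>2 \<le> (nrm ip (s k - s l))\<^sup>2"
      by simp
  qed simp
  have "\<exists>z. conv ip y z"
  proof (rule complete)
    fix \<epsilon> :: real assume "0 < \<epsilon>"
    then obtain K where K: "\<And>k. k \<ge> K \<Longrightarrow> nrm ip (s k - x) < \<epsilon> / 2"
      using s(2) unfolding conv_epsilon by (meson half_gt_zero)
    show "\<exists>N. \<forall>m\<ge>N. \<forall>n\<ge>N. nrm ip (y m - y n) < \<epsilon>"
    proof (intro exI[of _ K] allI impI)
      fix k l assume "K \<le> k" "K \<le> l"
      then show "nrm ip (y k - y l) < \<epsilon>"
        using K[of k] K[of l] le[of k l] nrm_triangle_diff[of "s k" "s l" x] nrm_diff_commute[of "s l" x]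
        by linarith
    qed
  qed
  then obtain z where z: "conv ip y z" by blast
  have "ip \<xi> (x - z) = 0" if "\<xi> \<in> H n" for \<xi>
  proof -
    have "(\<lambda>k. ip \<xi> (s k - y k)) \<longlonglongrightarrow> ip \<xi> (x - z)"
      by (intro conv_ip conv_const conv_diff s z)
    then show ?thesis using y(2)[OF that] by (simp add: LIMSEQ_const_iff)
  qed
  then show ?thesis
    unfolding projectable_def using H_closed[OF z y(1)] by blast
qed

text \<open>Testing against the algebraic sector suffices. This is how the components of
  \<open>a f \<Phi>\<close> and \<open>ad f \<Phi>\<close> are identified later.\<close>

lemma P_unique:
  assumes y: "y \<in> H n" and eq: "\<And>\<xi>. \<xi> \<in> S n \<Longrightarrow> ip \<xi> x = ip \<xi> y"
  shows "P n x = y"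
  unfolding P_def
proof (rule the_equality)
  have *: "ip \<xi> x = ip \<xi> y" if "\<xi> \<in> H n" for \<xi>
    by (rule ip_H_eqI[OF that eq])
  then show "y \<in> H n \<and> (\<forall>\<xi>\<in>H n. ip \<xi> (x - y) = 0)"
    using y by (simp add: ip_diff_right)
  fix z assume z: "z \<in> H n \<and> (\<forall>\<xi>\<in>H n. ip \<xi> (x - z) = 0)"
  have d: "z - y \<in> H n" using z y by (intro cvec.subspace_diff subspace_H) auto
  then have "ip (z - y) (z - y) = 0"
    using *[OF d] z by (simp add: ip_diff_right)
  then show "z = y" using ip_self_0[of "z - y"] by simp
qed

lemma P_H: "P n x \<in> H n" and P_ip: "\<xi> \<in> H n \<Longrightarrow> ip \<xi> (P n x) = ip \<xi> x"
proof -
  obtain y where y: "y \<in> H n" "\<And>\<xi>. \<xi> \<in> H n \<Longrightarrow> ip \<xi> (x - y) = 0"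
    using projectable_UNIV[of x n] unfolding projectable_def by blast
  have eq: "ip \<xi> x = ip \<xi> y" if "\<xi> \<in> H n" for \<xi>
    using y(2)[OF that] by (simp add: ip_diff_right)
  have "P n x = y" by (rule P_unique[OF y(1)]) (rule eq[OF S_H])
  then show "P n x \<in> H n" "\<xi> \<in> H n \<Longrightarrow> ip \<xi> (P n x) = ip \<xi> x"
    using y(1) eq by auto
qed

section \<open>Linearity of the projections and expansion over the sectors\<close>

lemma P_add: "P n (x + y) = P n x + P n y"
  by (rule P_unique) (auto intro: cvec.subspace_add subspace_H P_H simp: ip_add_right P_ip S_H)

lemma P_scale: "P n (c *\<^sub>C x) = c *\<^sub>C P n x"
  by (rule P_unique) (auto intro: cvec.subspace_scale subspace_H P_H simp: ip_scale_right P_ip S_H)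

lemma P_diff: "P n (x - y) = P n x - P n y"
  by (rule P_unique) (auto intro: cvec.subspace_diff subspace_H P_H simp: ip_diff_right P_ip S_H)

lemma P_0 [simp]: "P n 0 = 0"
  using P_diff[of n 0 0] by simp

lemma P_sum: "P n (sum f A) = (\<Sum>i\<in>A. P n (f i))"
  by (induction A rule: infinite_finite_induct) (auto simp: P_add)

lemma P_id: "x \<in> H n \<Longrightarrow> P n x = x"
  by (rule P_unique) auto

lemma P_orth: "x \<in> H m \<Longrightarrow> m \<noteq> n \<Longrightarrow> P n x = 0"
  using orth_H[of n m] by (intro P_unique) (auto intro: cvec.subspace_0 subspace_H S_H)

lemma P_P: "P n (P m x) = (if m = n then P n x else 0)"
  using P_id[OF P_H] P_orth[OF P_H] by auto

lemma P_truncate_nrm: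
  "(nrm ip (\<Sum>n<N. P n x))\<^sup>2 = (\<Sum>n<N. (nrm ip (P n x))\<^sup>2)"
  by (rule nrm_sum_orthogonal) (auto intro: orth_H P_H)

lemma P_truncate_le: "(\<Sum>n<N. (nrm ip (P n x))\<^sup>2) \<le> (nrm ip x)\<^sup>2"
proof -
  let ?t = "\<Sum>n<N. P n x"
  have "ip (P n x) (x - ?t) = 0" if "n < N" for n
  proof -
    have "P n (x - ?t) = 0"
      using that by (simp add: P_diff P_sum P_P)
    then show ?thesis using P_ip[OF P_H, of n x "x - ?t"] by simp
  qed
  then have "ip ?t (x - ?t) = 0"
    by (subst ip_sum_left) (rule sum.neutral, blast intro: lessThan_iff[THEN iffD1])
  from nrm_pyth[OF this] show ?thesis by (simp add: P_truncate_nrm)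
qed

lemma P_nrm_le: "nrm ip (P n x) \<le> nrm ip x"
proof (rule power2_le_imp_le)
  have "(nrm ip (P n x))\<^sup>2 \<le> (\<Sum>k<Suc n. (nrm ip (P k x))\<^sup>2)"
    by (rule member_le_sum) auto
  then show "(nrm ip (P n x))\<^sup>2 \<le> (nrm ip x)\<^sup>2"
    using P_truncate_le order_trans by blast
qed simp

lemma Fin_decompose:
  assumes "x \<in> Fin"
  shows "\<exists>N. \<forall>n. P n x \<in> S n \<and> (\<forall>M\<ge>N. (\<Sum>k<M. P k x) = x)"
proof -
  let ?Q = "{x. \<exists>N. \<forall>n. P n x \<in> S n \<and> (\<forall>M\<ge>N. (\<Sum>k<M. P k x) = x)}"
  have "cvec.subspace ?Q"
    unfolding cvec.subspace_def
  proof (intro conjI ballI allI)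
    show "0 \<in> ?Q" using cvec.subspace_0[OF subspace_S] by simp
    fix x c assume "x \<in> ?Q"
    then obtain N where N: "\<And>n. P n x \<in> S n" "\<And>M. M \<ge> N \<Longrightarrow> (\<Sum>k<M. P k x) = x" by blast
    show "c *\<^sub>C x \<in> ?Q"
      using N cvec.subspace_scale[OF subspace_S N(1)]
      by (auto simp: P_scale simp flip: cvec.scale_sum_right intro!: exI[of _ N])
    fix y assume "y \<in> ?Q"
    then obtain K where K: "\<And>n. P n y \<in> S n" "\<And>M. M \<ge> K \<Longrightarrow> (\<Sum>k<M. P k y) = y" by blast
    show "x + y \<in> ?Q"
      using N K cvec.subspace_add[OF subspace_S N(1) K(1)]
      by (auto simp: P_add sum.distrib intro!: exI[of _ "max N K"])
  qed
  moreover have "(\<Union>n. S n) \<subseteq> ?Q"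
  proof clarify
    fix x m assume x: "x \<in> S m"
    have P: "P n x = (if n = m then x else 0)" for n
      using P_id[OF S_H[OF x]] P_orth[OF S_H[OF x]] by auto
    show "\<exists>N. \<forall>n. P n x \<in> S n \<and> (\<forall>M\<ge>N. (\<Sum>k<M. P k x) = x)"
      using x cvec.subspace_0[OF subspace_S] by (intro exI[of _ "Suc m"]) (auto simp: P)
  qed
  ultimately show ?thesis
    using assms cvec.span_minimal unfolding Fin_def by blast
qed

lemma P_expansion: "conv ip (\<lambda>N. \<Sum>n<N. P n x) x"
  unfolding conv_epsilon
proof (intro allI impI)
  fix \<epsilon> :: real assume "0 < \<epsilon>"
  then obtain y where y: "y \<in> Fin" "nrm ip (y - x) < \<epsilon> / 2"
    using Fin_dense[of x] unfolding conv_epsilon by (meson half_gt_zero order_refl)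
  obtain N where N: "\<And>M. M \<ge> N \<Longrightarrow> (\<Sum>k<M. P k y) = y"
    using Fin_decompose[OF y(1)] by blast
  have "nrm ip ((\<Sum>n<M. P n x) - x) < \<epsilon>" if "M \<ge> N" for M
  proof -
    \<comment> \<open>Truncation is a contraction and fixes \<open>y\<close> once \<open>M\<close>
      exceeds its particle number, so the truncation error of \<open>x\<close> is at most twice its
      distance to \<open>y\<close>.\<close>
    have "nrm ip (\<Sum>n<M. P n (x - y)) \<le> nrm ip (x - y)"
      using P_truncate_le[of "x - y" M] unfolding P_truncate_nrm[symmetric] by (rule power2_le_imp_le) simp
    moreover have "(\<Sum>n<M. P n (x - y)) = (\<Sum>n<M. P n x) - y"
      using N[OF that] by (simp add: P_diff sum_subtractf)
    ultimately show ?thesis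
      using y(2) nrm_triangle_diff[of "\<Sum>n<M. P n x" x y] nrm_diff_commute[of x y] by simp
  qed
  then show "\<exists>N. \<forall>M\<ge>N. nrm ip ((\<Sum>n<M. P n x) - x) < \<epsilon>" by blast
qed

lemma P_parseval: "(\<lambda>n. (nrm ip (P n x))\<^sup>2) sums (nrm ip x)\<^sup>2"
proof -
  have "(\<lambda>N. (nrm ip (\<Sum>n<N. P n x))\<^sup>2) \<longlonglongrightarrow> (nrm ip x)\<^sup>2"
    by (intro tendsto_intros conv_nrm P_expansion)
  then show ?thesis by (simp add: sums_def P_truncate_nrm)
qed

lemma S_eqI:
  assumes "\<And>n \<xi>. \<xi> \<in> S n \<Longrightarrow> ip \<xi> x = ip \<xi> y"
  shows "x = y"
proof -
  have "P n x = P n y" for n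
    by (rule P_unique[OF P_H]) (simp add: assms P_ip S_H)
  then show ?thesis
    using conv_unique[OF P_expansion[of x]] P_expansion[of y] by simp
qed

text \<open>The continuity axiom needs approximants in the weighted norm. The approximant
  \<open>s k\<close> keeps the sectors below \<open>k\<close> and replaces each component there by a
  nearby vector of \<open>S n\<close>; the remaining error is a tail of the series of
  \<open>x\<close>.\<close>

lemma weighted_approx:
  assumes x: "summable (\<lambda>n. real (n + 1) * (nrm ip (P n x))\<^sup>2)"
  obtains s where "\<And>k. s k \<in> Fin" "\<And>k. finite {n. P n (s k) \<noteq> 0}"
    "(\<lambda>k. \<Sum>n. real (n + 1) * (nrm ip (P n (s k - x)))\<^sup>2) \<longlonglongrightarrow> 0"
proof -
  have "\<exists>y\<in>S n. real (n + 1) * (nrm ip (y - P n x))\<^sup>2 \<le> inverse (real (Suc k)) ^ 2" for n k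
  proof -
    \<comment> \<open>With this radius each sector has weighted error at most 1/(k+1)^2, so the
      \<open>k\<close> sectors that are used contribute at most 1/(k+1) together.\<close>
    define \<delta> where "\<delta> = inverse (real (Suc k)) / real (n + 1)"
    have "\<delta> > 0" by (simp add: \<delta>_def)
    then obtain y where y: "y \<in> S n" "nrm ip (y - P n x) < \<delta>"
      using P_H[of n x] unfolding H_def mem_cclosure_iff by blast
    have "real (n + 1) * (nrm ip (y - P n x))\<^sup>2 \<le> real (n + 1) * \<delta>\<^sup>2"
      using y(2) by (intro mult_left_mono power_mono) auto
    also have "\<dots> \<le> (real (n + 1))\<^sup>2 * \<delta>\<^sup>2"
      by (intro mult_right_mono) (auto simp: power2_eq_square)
    also have "\<dots> = inverse (real (Suc k)) ^ 2"
      unfolding \<delta>_def power_mult_distrib[symmetric] by simp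
    finally show ?thesis using y(1) by blast
  qed
  then obtain y where y: "\<And>n k. y n k \<in> S n"
    "\<And>n k. real (n + 1) * (nrm ip (y n k - P n x))\<^sup>2 \<le> inverse (real (Suc k)) ^ 2"
    by metis
  define s where "s k = (\<Sum>n<k. y n k)" for k
  have Ps: "P n (s k) = (if n < k then y n k else 0)" for n k
  proof -
    have "P n (s k) = (\<Sum>m<k. if m = n then y n k else 0)"
      unfolding s_def P_sum using P_id[OF S_H[OF y(1)]] P_orth[OF S_H[OF y(1)]]
      by (intro sum.cong) auto
    then show ?thesis by simp
  qed
  let ?w = "\<lambda>n. real (n + 1) * (nrm ip (P n x))\<^sup>2"
  let ?d = "\<lambda>k n. real (n + 1) * (nrm ip (P n (s k - x)))\<^sup>2"
  have d1: "?d k n = real (n + 1) * (nrm ip (y n k - P n x))\<^sup>2" if "n < k" for n k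
    using that by (simp add: P_diff Ps)
  have d2: "?d k n = ?w n" if "\<not> n < k" for n k
    using that by (simp add: P_diff Ps nrm_minus)
  have sd: "summable (?d k)" for k
    by (rule summable_cong[THEN iffD1, OF _ x], rule eventually_sequentiallyI[of k]) (simp only: d2 not_less)
  have le: "(\<Sum>n. ?d k n) \<le> inverse (real (Suc k)) + (suminf ?w - sum ?w {..<k})" for k
  proof -
    have "(\<Sum>n. ?d k n) = (\<Sum>n. ?d k (n + k)) + sum (?d k) {..<k}"
      by (rule suminf_split_initial_segment[OF sd])
    also have "(\<Sum>n. ?d k (n + k)) = (\<Sum>n. ?w (n + k))"
      by (rule suminf_cong) (rule d2, simp)
    also have "\<dots> = suminf ?w - sum ?w {..<k}"
      by (rule suminf_minus_initial_segment[OF x])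
    also have "sum (?d k) {..<k} \<le> (\<Sum>n<k. inverse (real (Suc k)) ^ 2)"
      by (rule sum_mono) (simp only: d1 y lessThan_iff)
    also have "\<dots> = real k * inverse (real (Suc k)) * inverse (real (Suc k))"
      by (simp add: power2_eq_square)
    also have "\<dots> \<le> 1 * inverse (real (Suc k))"
      by (intro mult_right_mono) (auto simp: field_simps)
    finally show ?thesis by simp
  qed
  have lim: "(\<lambda>k. inverse (real (Suc k)) + (suminf ?w - sum ?w {..<k})) \<longlonglongrightarrow> 0 + (suminf ?w - suminf ?w)"
    by (intro tendsto_intros LIMSEQ_inverse_real_of_nat summable_LIMSEQ x)
  have "(\<lambda>k. \<Sum>n. ?d k n) \<longlonglongrightarrow> 0"
  proof (rule tendsto_sandwich[OF _ _ tendsto_const])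
    show "\<forall>\<^sub>F k in sequentially. 0 \<le> (\<Sum>n. ?d k n)"
      by (intro always_eventually allI suminf_nonneg sd) simp
    show "\<forall>\<^sub>F k in sequentially. (\<Sum>n. ?d k n) \<le> inverse (real (Suc k)) + (suminf ?w - sum ?w {..<k})"
      by (intro always_eventually allI le)
    show "(\<lambda>k. inverse (real (Suc k)) + (suminf ?w - sum ?w {..<k})) \<longlonglongrightarrow> 0"
      using lim by simp
  qed
  moreover have "s k \<in> Fin" for k
    unfolding s_def by (intro cvec.subspace_sum subspace_Fin S_Fin[OF y(1)])
  moreover have "finite {n. P n (s k) \<noteq> 0}" for k
    by (rule finite_subset[of _ "{..<k}"]) (auto simp: Ps)
  ultimately show ?thesis using that by blast
qed

end

subsection \<open>The algebraic Fock representation\<close>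

locale fock = L: chs ipL for ipL :: "'l::cvec \<Rightarrow> 'l \<Rightarrow> complex" +
  fixes J :: "'l \<Rightarrow> 'l" and ipF :: "'f::cvec \<Rightarrow> 'f \<Rightarrow> complex"
    and a ad :: "'l \<Rightarrow> 'f \<Rightarrow> 'f" and \<Omega> :: 'f and D :: "'f set"
  assumes conjugation: "conjugation ipL J"
    and hilbert: "hilbert ipF"
    and fock_rep: "fock_rep ipL J ipF a ad \<Omega> D"
begin

sublocale chs ipF
  using hilbert by (simp add: chs_iff_hilbert)

lemma J_add: "J (x + y) = J x + J y"
  and J_scale: "J (c *\<^sub>C x) = cnj c *\<^sub>C J x"
  and J_J [simp]: "J (J x) = x"
  and ip_J: "ipL (J f) (J g) = ipL g f"
proof -
  note ax = conjugation[unfolded conjugation_def]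
  note ax2 = ax[THEN conjunct2] note ax3 = ax2[THEN conjunct2]
  show "J (x + y) = J x + J y" by (rule ax[THEN conjunct1, rule_format])
  show "J (c *\<^sub>C x) = cnj c *\<^sub>C J x" by (rule ax2[THEN conjunct1, rule_format])
  show "J (J x) = x" by (rule ax3[THEN conjunct1, rule_format])
  show "ipL (J f) (J g) = ipL g f" by (rule ax3[THEN conjunct2, rule_format])
qed

lemma J_sum: "J (\<Sum>i\<in>I. c i *\<^sub>C x i) = (\<Sum>i\<in>I. cnj (c i) *\<^sub>C J (x i))"
proof -
  have "J 0 = 0" using J_scale[of 0 0] by simp
  then show ?thesis by (induction I rule: infinite_finite_induct) (auto simp: J_add J_scale)
qed

lemma J_nrm: "nrm ipL (J x) = nrm ipL x"
  by (simp add: nrm_def ip_J)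

lemma J_orthonormal: "L.orthonormal e I \<Longrightarrow> L.orthonormal (\<lambda>i. J (e i)) I"
  unfolding L.orthonormal_def ip_J by auto

lemma ip_J_left: "ipL (J f) g = ipL (J g) f"
  using ip_J[of f "J g"] by simp

lemma ip_J_right: "ipL f (J g) = ipL g (J f)"
  using ip_J[of "J f" g] by simp

lemma J_cons:
  assumes "cons ipL e"
  shows "cons ipL (\<lambda>j. J (e j))"
  unfolding cons_def
proof (intro conjI allI impI)
  show "ipL (J (e i)) (J (e j)) = (if i = j then 1 else 0)" for i j
    using assms by (auto simp: cons_def ip_J)
  fix x assume "\<forall>j. ipL (J (e j)) x = 0"
  then have "ipL (e j) (J x) = 0" for j
    using L.ip_zero_sym[of "J x" "e j"] ip_J_left[of "e j" x] by simp
  then have "J x = 0" using assms by (simp add: cons_def)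
  then have "J (J x) = 0" using J_scale[of 0 0] by simp
  then show "x = 0" by simp
qed

lemma subspace_D: "cvec.subspace D"
  and D_Omega: "\<Omega> \<in> D"
  and D_a: "\<Phi> \<in> D \<Longrightarrow> a f \<Phi> \<in> D"
  and D_ad: "\<Phi> \<in> D \<Longrightarrow> ad f \<Phi> \<in> D"
  and a_add: "\<Phi> \<in> D \<Longrightarrow> \<Psi> \<in> D \<Longrightarrow> a f (\<Phi> + \<Psi>) = a f \<Phi> + a f \<Psi>"
  and ad_add: "\<Phi> \<in> D \<Longrightarrow> \<Psi> \<in> D \<Longrightarrow> ad f (\<Phi> + \<Psi>) = ad f \<Phi> + ad f \<Psi>"
  and a_scale: "\<Phi> \<in> D \<Longrightarrow> a f (c *\<^sub>C \<Phi>) = c *\<^sub>C a f \<Phi>"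
  and ad_scale: "\<Phi> \<in> D \<Longrightarrow> ad f (c *\<^sub>C \<Phi>) = c *\<^sub>C ad f \<Phi>"
  and a_add_arg: "\<Phi> \<in> D \<Longrightarrow> a (f + g) \<Phi> = a f \<Phi> + a g \<Phi>"
  and ad_add_arg: "\<Phi> \<in> D \<Longrightarrow> ad (f + g) \<Phi> = ad f \<Phi> + ad g \<Phi>"
  and a_scale_arg: "\<Phi> \<in> D \<Longrightarrow> a (c *\<^sub>C f) \<Phi> = c *\<^sub>C a f \<Phi>"
  and ad_scale_arg: "\<Phi> \<in> D \<Longrightarrow> ad (c *\<^sub>C f) \<Phi> = c *\<^sub>C ad f \<Phi>"
  and ad_commute: "\<Phi> \<in> D \<Longrightarrow> ad f (ad g \<Phi>) = ad g (ad f \<Phi>)"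
  and ccr: "\<Phi> \<in> D \<Longrightarrow> a f (ad g \<Phi>) = ad g (a f \<Phi>) + ipL (J f) g *\<^sub>C \<Phi>"
  and ip_a_left: "\<Phi> \<in> D \<Longrightarrow> \<Psi> \<in> D \<Longrightarrow> ipF (a f \<Phi>) \<Psi> = ipF \<Phi> (ad (J f) \<Psi>)"
  and a_Omega: "a f \<Omega> = 0"
  and cyclic: "cclosure ipF (cspan (\<Union>n. creation_vectors ad \<Omega> n)) = UNIV"
  and extension: "\<Phi> \<in> Dhalf ipF ad \<Omega> \<Longrightarrow> (\<And>k. s k \<in> D \<inter> Dhalf ipF ad \<Omega>) \<Longrightarrow>
        (\<lambda>k. \<Sum>n. real (n + 1) * (nrm ipF (comp ipF ad \<Omega> n (s k - \<Phi>)))\<^sup>2) \<longlonglongrightarrow> 0 \<Longrightarrow>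
        conv ipF (\<lambda>k. a f (s k)) (a f \<Phi>) \<and> conv ipF (\<lambda>k. ad f (s k)) (ad f \<Phi>)"
proof -
  note f1 = fock_rep[unfolded fock_rep_def]
  note f2 = f1[THEN conjunct2] note f3 = f2[THEN conjunct2] note f4 = f3[THEN conjunct2]
  note f5 = f4[THEN conjunct2] note f6 = f5[THEN conjunct2] note f7 = f6[THEN conjunct2]
  note f8 = f7[THEN conjunct2] note f9 = f8[THEN conjunct2] note f10 = f9[THEN conjunct2]
  note f11 = f10[THEN conjunct2] note f12 = f11[THEN conjunct2] note f13 = f12[THEN conjunct2]
  note f14 = f13[THEN conjunct2] note f15 = f14[THEN conjunct2] note f16 = f15[THEN conjunct2]
  show "cvec.subspace D"
    unfolding cvec.subspace_def
    using f1[THEN conjunct1] f2[THEN conjunct1] f3[THEN conjunct1] by blast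
  show "\<Omega> \<in> D" by (rule f5[THEN conjunct1])
  show "\<Phi> \<in> D \<Longrightarrow> a f \<Phi> \<in> D" "\<Phi> \<in> D \<Longrightarrow> ad f \<Phi> \<in> D"
    using f6[THEN conjunct1] by blast+
  show "\<Phi> \<in> D \<Longrightarrow> \<Psi> \<in> D \<Longrightarrow> a f (\<Phi> + \<Psi>) = a f \<Phi> + a f \<Psi>"
    "\<Phi> \<in> D \<Longrightarrow> \<Psi> \<in> D \<Longrightarrow> ad f (\<Phi> + \<Psi>) = ad f \<Phi> + ad f \<Psi>"
    by (simp_all add: f7[THEN conjunct1, rule_format])
  show "\<Phi> \<in> D \<Longrightarrow> a f (c *\<^sub>C \<Phi>) = c *\<^sub>C a f \<Phi>" "\<Phi> \<in> D \<Longrightarrow> ad f (c *\<^sub>C \<Phi>) = c *\<^sub>C ad f \<Phi>"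
    by (simp_all add: f8[THEN conjunct1, rule_format])
  show "\<Phi> \<in> D \<Longrightarrow> a (f + g) \<Phi> = a f \<Phi> + a g \<Phi>" "\<Phi> \<in> D \<Longrightarrow> ad (f + g) \<Phi> = ad f \<Phi> + ad g \<Phi>"
    by (simp_all add: f9[THEN conjunct1, rule_format])
  show "\<Phi> \<in> D \<Longrightarrow> a (c *\<^sub>C f) \<Phi> = c *\<^sub>C a f \<Phi>" "\<Phi> \<in> D \<Longrightarrow> ad (c *\<^sub>C f) \<Phi> = c *\<^sub>C ad f \<Phi>"
    by (simp_all add: f10[THEN conjunct1, rule_format])
  show "\<Phi> \<in> D \<Longrightarrow> ad f (ad g \<Phi>) = ad g (ad f \<Phi>)"
    by (rule f11[THEN conjunct1, rule_format, THEN conjunct2, THEN conjunct1])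
  show "\<Phi> \<in> D \<Longrightarrow> a f (ad g \<Phi>) = ad g (a f \<Phi>) + ipL (J f) g *\<^sub>C \<Phi>"
    using f11[THEN conjunct1, rule_format, THEN conjunct2, THEN conjunct2, of \<Phi> f g]
    by (simp add: diff_eq_eq add.commute)
  show "\<Phi> \<in> D \<Longrightarrow> \<Psi> \<in> D \<Longrightarrow> ipF (a f \<Phi>) \<Psi> = ipF \<Phi> (ad (J f) \<Psi>)"
    by (rule f12[THEN conjunct1, rule_format])
  show "a f \<Omega> = 0" by (rule f14[THEN conjunct1, rule_format])
  show "cclosure ipF (cspan (\<Union>n. creation_vectors ad \<Omega> n)) = UNIV"
    by (rule f15[THEN conjunct1])
  show "\<Phi> \<in> Dhalf ipF ad \<Omega> \<Longrightarrow> (\<And>k. s k \<in> D \<inter> Dhalf ipF ad \<Omega>) \<Longrightarrow>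
        (\<lambda>k. \<Sum>n. real (n + 1) * (nrm ipF (comp ipF ad \<Omega> n (s k - \<Phi>)))\<^sup>2) \<longlonglongrightarrow> 0 \<Longrightarrow>
        conv ipF (\<lambda>k. a f (s k)) (a f \<Phi>) \<and> conv ipF (\<lambda>k. ad f (s k)) (ad f \<Phi>)"
    by (rule f16[rule_format]) blast+
qed

lemma ip_ad_left: "\<Phi> \<in> D \<Longrightarrow> \<Psi> \<in> D \<Longrightarrow> ipF (ad f \<Phi>) \<Psi> = ipF \<Phi> (a (J f) \<Psi>)"
  using ip_a_left[of \<Psi> \<Phi> "J f"] by (subst (1 2) ip_cnj) simp

lemma a_zero [simp]: "a f 0 = 0"
  using a_scale[OF D_Omega, of f 0] by simp

lemma ad_zero [simp]: "ad f 0 = 0"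
  using ad_scale[OF D_Omega, of f 0] by simp

lemma D_sum: "(\<And>i. i \<in> I \<Longrightarrow> x i \<in> D) \<Longrightarrow> (\<Sum>i\<in>I. c i *\<^sub>C x i) \<in> D"
  by (intro cvec.subspace_sum cvec.subspace_scale subspace_D)

lemma ad_sum: "(\<And>i. i \<in> I \<Longrightarrow> x i \<in> D) \<Longrightarrow> ad f (\<Sum>i\<in>I. c i *\<^sub>C x i) = (\<Sum>i\<in>I. c i *\<^sub>C ad f (x i))"
  by (induction I rule: infinite_finite_induct)
    (simp_all add: ad_add ad_scale D_sum cvec.subspace_scale[OF subspace_D])

lemma ad_sum_arg: "\<Phi> \<in> D \<Longrightarrow> ad (\<Sum>i\<in>I. c i *\<^sub>C f i) \<Phi> = (\<Sum>i\<in>I. c i *\<^sub>C ad (f i) \<Phi>)"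
  using ad_scale_arg[of \<Phi> 0 0]
  by (induction I rule: infinite_finite_induct) (simp_all add: ad_add_arg ad_scale_arg)

lemma a_sum_arg: "\<Phi> \<in> D \<Longrightarrow> a (\<Sum>i\<in>I. c i *\<^sub>C f i) \<Phi> = (\<Sum>i\<in>I. c i *\<^sub>C a (f i) \<Phi>)"
  using a_scale_arg[of \<Phi> 0 0]
  by (induction I rule: infinite_finite_induct) (simp_all add: a_add_arg a_scale_arg)

section \<open>Algebraic particle sectors\<close>

definition S :: "nat \<Rightarrow> 'f set" where
  "S n = cspan (creation_vectors ad \<Omega> n)"

lemma subspace_sector: "cvec.subspace (S n)"
  unfolding S_def cspan_eq_span by (rule cvec.subspace_span)

lemma creation_vectors_0: "creation_vectors ad \<Omega> 0 = {\<Omega>}"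
  by (simp add: creation_vectors_def)

lemma creation_vectors_Suc: "creation_vectors ad \<Omega> (Suc n) = {ad f v |f v. v \<in> creation_vectors ad \<Omega> n}"
proof (intro equalityI subsetI)
  fix v assume "v \<in> creation_vectors ad \<Omega> (Suc n)"
  then obtain f fs where "v = ad f (foldr ad fs \<Omega>)" "length fs = n"
    by (auto simp: creation_vectors_def length_Suc_conv)
  then show "v \<in> {ad f v |f v. v \<in> creation_vectors ad \<Omega> n}"
    unfolding creation_vectors_def by blast
next
  fix v assume "v \<in> {ad f v |f v. v \<in> creation_vectors ad \<Omega> n}"
  then obtain f fs where "v = foldr ad (f # fs) \<Omega>" "length (f # fs) = Suc n"
    by (auto simp: creation_vectors_def)
  then show "v \<in> creation_vectors ad \<Omega> (Suc n)"
    unfolding creation_vectors_def by blast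
qed

lemma creation_vectors_D: "creation_vectors ad \<Omega> n \<subseteq> D"
  by (induction n) (auto simp: creation_vectors_0 creation_vectors_Suc D_Omega D_ad)

lemma S_D: "S n \<subseteq> D"
  unfolding S_def cspan_eq_span by (intro cvec.span_minimal creation_vectors_D subspace_D)

lemma creation_vectors_S: "creation_vectors ad \<Omega> n \<subseteq> S n"
  unfolding S_def cspan_eq_span by (rule cvec.span_superset)

text \<open>The property has to be closed under linear combinations inside \<open>D\<close> only,
  where the field operators are linear; what remains are products of creation operators on the
  vacuum.\<close>

lemma S_induct [consumes 1, case_names sub base]:
  assumes "\<Psi> \<in> S n" and "cvec.subspace {\<Psi> \<in> D. Q \<Psi>}"
    and "\<And>v. v \<in> creation_vectors ad \<Omega> n \<Longrightarrow> Q v"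
  shows "Q \<Psi>"
proof -
  have "S n \<subseteq> {\<Psi> \<in> D. Q \<Psi>}"
    unfolding S_def cspan_eq_span using assms(3) creation_vectors_D
    by (intro cvec.span_minimal assms(2)) blast
  then show ?thesis using assms(1) by blast
qed

lemma ad_S: "\<Psi> \<in> S n \<Longrightarrow> ad f \<Psi> \<in> S (Suc n)"
proof (induction rule: S_induct)
  case sub
  show ?case by (intro subspace_preimage subspace_D subspace_sector ad_add ad_scale)
next
  case (base v)
  then show ?case using creation_vectors_S[of "Suc n"] unfolding creation_vectors_Suc by blast
qed

lemma a_S_0: "\<Psi> \<in> S 0 \<Longrightarrow> a f \<Psi> = 0"
proof (induction rule: S_induct)
  case sub
  show ?case using subspace_preimage[OF subspace_D cvec.subspace_single_0, of "a f"] by (simp add: a_add a_scale)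
next
  case (base v)
  then show ?case by (simp add: creation_vectors_0 a_Omega)
qed

lemma a_S: "\<Psi> \<in> S (Suc n) \<Longrightarrow> a f \<Psi> \<in> S n"
proof (induction n arbitrary: \<Psi> f)
  \<comment> \<open>On one-particle vectors the term \<open>ad h (a f \<Omega>)\<close> vanishes.
    This case stands apart since the induction hypothesis has no sector below the vacuum to refer
    to.\<close>
  case IH: 0
  from IH show ?case
  proof (induction rule: S_induct)
    case sub
    show ?case by (intro subspace_preimage subspace_D subspace_sector a_add a_scale)
  next
    case (base v)
    then obtain h where "v = ad h \<Omega>" by (auto simp: creation_vectors_Suc creation_vectors_0)
    then show ?case
      using creation_vectors_S[of 0]
      by (simp add: ccr[OF D_Omega] a_Omega creation_vectors_0 cvec.subspace_scale[OF subspace_sector])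
  qed
next
  case IH: (Suc n)
  from IH.prems show ?case
  proof (induction rule: S_induct)
    case sub
    show ?case by (intro subspace_preimage subspace_D subspace_sector a_add a_scale)
  next
    case (base v)
    then obtain h w where v: "v = ad h w" and w: "w \<in> creation_vectors ad \<Omega> (Suc n)"
      unfolding creation_vectors_Suc[of "Suc n"] by blast
    have wS: "w \<in> S (Suc n)" "w \<in> D" using w creation_vectors_S creation_vectors_D by auto
    show ?case
      unfolding v ccr[OF wS(2)]
      by (intro cvec.subspace_add cvec.subspace_scale subspace_sector ad_S IH.IH wS)
  qed
qed

lemma S_orthogonal_Suc_0:
  assumes "\<Phi> \<in> S 0" "\<Psi> \<in> S (Suc m)"
  shows "ipF \<Phi> \<Psi> = 0"
  using assms(2)
proof (induction rule: S_induct)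
  case sub
  show ?case
    by (simp add: cvec.subspace_def ip_add_right ip_scale_right cvec.subspace_0[OF subspace_D]
        cvec.subspace_add[OF subspace_D] cvec.subspace_scale[OF subspace_D])
next
  case (base v)
  then obtain h w where v: "v = ad h w" and w: "w \<in> creation_vectors ad \<Omega> m"
    unfolding creation_vectors_Suc by blast
  have "w \<in> D" "\<Phi> \<in> D" using w creation_vectors_D assms(1) S_D by blast+
  then have "ipF (a (J h) \<Phi>) w = ipF \<Phi> (ad h w)" using ip_a_left[of \<Phi> w "J h"] by simp
  then show ?case using a_S_0[OF assms(1)] v by simp
qed

text \<open>A creation operator on the right moves to the left as an annihilation operator and
  lowers both particle numbers by one, until one side is the vacuum sector.\<close>

lemma S_orthogonal: "m \<noteq> n \<Longrightarrow> \<Phi> \<in> S m \<Longrightarrow> \<Psi> \<in> S n \<Longrightarrow> ipF \<Phi> \<Psi> = 0"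
proof (induction n arbitrary: m \<Phi> \<Psi>)
  case 0
  then obtain k where "m = Suc k" by (cases m) auto
  then show ?case using S_orthogonal_Suc_0[of \<Psi> \<Phi> k] 0 ip_zero_sym by blast
next
  case IH: (Suc n)
  show ?case
  proof (cases m)
    case 0
    then show ?thesis using S_orthogonal_Suc_0 IH.prems by blast
  next
    case (Suc k)
    note \<Phi> = IH.prems(2)[unfolded Suc]
    from IH.prems(3) show ?thesis
    proof (induction rule: S_induct)
      case sub
      show ?case
        by (simp add: cvec.subspace_def ip_add_right ip_scale_right cvec.subspace_0[OF subspace_D]
            cvec.subspace_add[OF subspace_D] cvec.subspace_scale[OF subspace_D])
    next
      case (base v)
      then obtain h w where v: "v = ad h w" and w: "w \<in> creation_vectors ad \<Omega> n"
        unfolding creation_vectors_Suc by blast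
      have "w \<in> D" "\<Phi> \<in> D" using w creation_vectors_D \<Phi> S_D by blast+
      then have "ipF (a (J h) \<Phi>) w = ipF \<Phi> (ad h w)" using ip_a_left[of \<Phi> w "J h"] by simp
      moreover have "ipF (a (J h) \<Phi>) w = 0"
        using IH.prems(1) Suc w creation_vectors_S by (intro IH.IH[OF _ a_S[OF \<Phi>]]) auto
      ultimately show ?case using v by simp
    qed
  qed
qed

sublocale graded_space ipF S
proof unfold_locales
  show "cvec.subspace (S n)" for n by (rule subspace_sector)
  show "m \<noteq> n \<Longrightarrow> x \<in> S m \<Longrightarrow> y \<in> S n \<Longrightarrow> ipF x y = 0" for m n x y by (rule S_orthogonal)
  have "cvec.span (\<Union>n. creation_vectors ad \<Omega> n) \<subseteq> cvec.span (\<Union>n. S n)"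
    using creation_vectors_S by (intro cvec.span_mono) blast
  then have "cclosure ipF (cspan (\<Union>n. creation_vectors ad \<Omega> n)) \<subseteq> cclosure ipF (cvec.span (\<Union>n. S n))"
    unfolding cspan_eq_span cclosure_def by blast
  then show "cclosure ipF (cvec.span (\<Union>n. S n)) = UNIV" unfolding cyclic by blast
qed

lemma comp_eq: "comp ipF ad \<Omega> n \<Phi> = P n \<Phi>"
  by (simp add: comp_def P_def H_def nsector_def S_def)

text \<open>By the CCR the Gram matrix of the vectors \<open>ad (u i) (b i)\<close> is a mixed
  annihilation term plus a diagonal. The diagonal contributes 1 and the mixed terms \<open>n\<close>
  to the factor \<open>Suc n\<close>. The annihilation bound is a premise so that the lemma can
  serve inside the induction that proves it.\<close>

lemma ad_sum_bound_step:
  assumes fin: "finite I" and on: "L.orthonormal u I" and b: "\<And>i. i \<in> I \<Longrightarrow> b i \<in> S n"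
    and IH: "\<And>g \<Psi>. L.orthonormal g I \<Longrightarrow> \<Psi> \<in> S n \<Longrightarrow> (\<Sum>i\<in>I. (nrm ipF (a (g i) \<Psi>))\<^sup>2) \<le> real n * (nrm ipF \<Psi>)\<^sup>2"
  shows "(nrm ipF (\<Sum>i\<in>I. ad (u i) (b i)))\<^sup>2 \<le> real (Suc n) * (\<Sum>i\<in>I. (nrm ipF (b i))\<^sup>2)"
proof -
  define g where "g i = J (u i)" for i
  have g: "L.orthonormal g I" unfolding g_def by (rule J_orthonormal[OF on])
  have bD: "b i \<in> D" if "i \<in> I" for i using b[OF that] S_D by blast
  have term_eq: "ipF (ad (u i) (b i)) (ad (u k) (b k))
      = ipF (a (g k) (b i)) (a (g i) (b k)) + (if i = k then of_real ((nrm ipF (b i))\<^sup>2) else 0)"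
    if i: "i \<in> I" and k: "k \<in> I" for i k
  proof -
    have "ipF (ad (u i) (b i)) (ad (u k) (b k)) = ipF (b i) (a (g i) (ad (u k) (b k)))"
      unfolding g_def by (intro ip_ad_left bD D_ad i k)
    also have "\<dots> = ipF (b i) (ad (u k) (a (g i) (b k))) + ipL (u i) (u k) * ipF (b i) (b k)"
      unfolding ccr[OF bD[OF k]] by (simp add: ip_add_right ip_scale_right g_def)
    also have "ipF (b i) (ad (u k) (a (g i) (b k))) = ipF (a (g k) (b i)) (a (g i) (b k))"
      using ip_a_left[OF bD[OF i] D_a[OF bD[OF k]], of "g k" "g i"] by (simp add: g_def)
    finally show ?thesis
      using on i k by (auto simp: L.orthonormal_def ip_self)
  qed
  \<comment> \<open>The mixed term pairs \<open>a (g k) (b i)\<close> with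
    \<open>a (g i) (b k)\<close>; the two squares of the arithmetic mean differ by exchanging
    \<open>i\<close> and \<open>k\<close>, so they give the same double sum.\<close>
  have le: "Re (ipF (ad (u i) (b i)) (ad (u k) (b k)))
      \<le> ((nrm ipF (a (g k) (b i)))\<^sup>2 + (nrm ipF (a (g i) (b k)))\<^sup>2) / 2 + (if i = k then (nrm ipF (b i))\<^sup>2 else 0)"
    if i: "i \<in> I" and k: "k \<in> I" for i k
  proof -
    have "Re (ipF x y) \<le> ((nrm ipF x)\<^sup>2 + (nrm ipF y)\<^sup>2) / 2" for x y
      using complex_Re_le_cmod[of "ipF x y"] cauchy_schwarz[of x y]
        sum_squares_bound[of "nrm ipF x" "nrm ipF y"] by (simp add: field_simps)
    from this[of "a (g k) (b i)" "a (g i) (b k)"] show ?thesis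
      unfolding term_eq[OF i k] by (cases "i = k") simp_all
  qed
  have "(nrm ipF (\<Sum>i\<in>I. ad (u i) (b i)))\<^sup>2 = (\<Sum>i\<in>I. \<Sum>k\<in>I. Re (ipF (ad (u i) (b i)) (ad (u k) (b k))))"
    by (simp add: nrm_sq ip_sum_left ip_sum_right)
      (subst sum.swap, rule refl)
  also have "\<dots> \<le> (\<Sum>i\<in>I. \<Sum>k\<in>I. ((nrm ipF (a (g k) (b i)))\<^sup>2 + (nrm ipF (a (g i) (b k)))\<^sup>2) / 2
      + (if i = k then (nrm ipF (b i))\<^sup>2 else 0))"
    by (intro sum_mono le)
  also have "\<dots> = (\<Sum>i\<in>I. \<Sum>k\<in>I. (nrm ipF (a (g k) (b i)))\<^sup>2 / 2)
      + (\<Sum>i\<in>I. \<Sum>k\<in>I. (nrm ipF (a (g i) (b k)))\<^sup>2 / 2) + (\<Sum>i\<in>I. (nrm ipF (b i))\<^sup>2)"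
    using fin by (simp add: sum.distrib add_divide_distrib)
  also have "(\<Sum>i\<in>I. \<Sum>k\<in>I. (nrm ipF (a (g i) (b k)))\<^sup>2 / 2) = (\<Sum>i\<in>I. \<Sum>k\<in>I. (nrm ipF (a (g k) (b i)))\<^sup>2 / 2)"
    by (rule sum.swap)
  also have "(\<Sum>i\<in>I. \<Sum>k\<in>I. (nrm ipF (a (g k) (b i)))\<^sup>2 / 2)
      + (\<Sum>i\<in>I. \<Sum>k\<in>I. (nrm ipF (a (g k) (b i)))\<^sup>2 / 2) = (\<Sum>i\<in>I. \<Sum>k\<in>I. (nrm ipF (a (g k) (b i)))\<^sup>2)"
    by (simp flip: sum.distrib)
  also have "\<dots> \<le> (\<Sum>i\<in>I. real n * (nrm ipF (b i))\<^sup>2)"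
    by (intro sum_mono IH g b)
  finally show ?thesis by (simp add: distrib_right flip: sum_distrib_left)
qed

text \<open>Duality: the sum \<open>s\<close> of squares equals the pairing of \<open>\<Psi>\<close>
  with a vector \<open>v\<close> made of creation operators one sector lower, where the induction
  hypothesis gives |v|^2 <= (n+1) s. Cauchy-Schwarz yields s^2 <= (n+1) s |Psi|^2, and a factor
  \<open>s\<close> cancels unless it is zero.\<close>

lemma a_sum_bound:
  assumes "finite I" "L.orthonormal g I" "\<Psi> \<in> S n"
  shows "(\<Sum>i\<in>I. (nrm ipF (a (g i) \<Psi>))\<^sup>2) \<le> real n * (nrm ipF \<Psi>)\<^sup>2"
  using assms(2,3)
proof (induction n arbitrary: g \<Psi>)
  case 0
  then show ?case by (simp add: a_S_0)
next
  case (Suc n)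
  let ?s = "\<Sum>i\<in>I. (nrm ipF (a (g i) \<Psi>))\<^sup>2"
  let ?v = "\<Sum>i\<in>I. ad (J (g i)) (a (g i) \<Psi>)"
  have D: "\<Psi> \<in> D" using Suc.prems(2) S_D by blast
  have v: "(nrm ipF ?v)\<^sup>2 \<le> real (Suc n) * ?s"
    by (intro ad_sum_bound_step assms(1) J_orthonormal Suc a_S)
  have s0: "?s \<ge> 0" by (intro sum_nonneg) simp
  have "of_real ?s = ipF \<Psi> ?v"
    unfolding ip_sum_right of_real_sum ip_self[symmetric] by (intro sum.cong refl ip_a_left D D_a)
  from arg_cong[OF this, of cmod] have "?s = cmod (ipF \<Psi> ?v)"
    unfolding norm_of_real abs_of_nonneg[OF s0] .
  also have "\<dots> \<le> nrm ipF \<Psi> * nrm ipF ?v"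
    by (rule cauchy_schwarz)
  finally have "?s\<^sup>2 \<le> (nrm ipF \<Psi> * nrm ipF ?v)\<^sup>2"
    by (rule power_mono[OF _ s0])
  also have "\<dots> \<le> (nrm ipF \<Psi>)\<^sup>2 * (real (Suc n) * ?s)"
    unfolding power_mult_distrib by (rule mult_left_mono[OF v]) simp
  finally have "?s * ?s \<le> ?s * (real (Suc n) * (nrm ipF \<Psi>)\<^sup>2)"
    by (simp add: power2_eq_square algebra_simps)
  then show ?case
    using s0 by (cases "?s = 0") (simp_all add: less_le mult_le_cancel_left_pos)
qed

lemma ad_sum_bound:
  assumes "finite I" "L.orthonormal u I" "\<And>i. i \<in> I \<Longrightarrow> b i \<in> S n"
  shows "(nrm ipF (\<Sum>i\<in>I. ad (u i) (b i)))\<^sup>2 \<le> real (Suc n) * (\<Sum>i\<in>I. (nrm ipF (b i))\<^sup>2)"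
  by (intro ad_sum_bound_step assms a_sum_bound)

text \<open>Turns bounds for a single operator into the family bounds over the one-point index set
  \<open>{()}\<close>; \<open>f = 0\<close> has no normalisation and is treated apart.\<close>

lemma normalize:
  obtains g where "f = of_real (nrm ipL f) *\<^sub>C g" "f \<noteq> 0 \<Longrightarrow> L.orthonormal (\<lambda>_. g) {()}"
proof (cases "f = 0")
  case False
  then have n: "nrm ipL f \<noteq> 0" by simp
  show ?thesis
  proof (rule that[of "of_real (inverse (nrm ipL f)) *\<^sub>C f"])
    show "f = of_real (nrm ipL f) *\<^sub>C of_real (inverse (nrm ipL f)) *\<^sub>C f"
      using n by simp
    show "L.orthonormal (\<lambda>_. of_real (inverse (nrm ipL f)) *\<^sub>C f) {()}"
      using n by (simp add: L.orthonormal_def L.ip_self L.nrm_scale norm_inverse)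
  qed
qed (use that[of 0] in simp)

lemma a_bound: "\<Psi> \<in> S n \<Longrightarrow> (nrm ipF (a f \<Psi>))\<^sup>2 \<le> real n * (nrm ipL f)\<^sup>2 * (nrm ipF \<Psi>)\<^sup>2"
proof -
  assume \<Psi>: "\<Psi> \<in> S n"
  then have D: "\<Psi> \<in> D" using S_D by blast
  obtain g where g: "f = of_real (nrm ipL f) *\<^sub>C g" "f \<noteq> 0 \<Longrightarrow> L.orthonormal (\<lambda>_. g) {()}"
    using normalize by blast
  have eq: "nrm ipF (a f \<Psi>) = nrm ipL f * nrm ipF (a g \<Psi>)"
    by (subst g(1)) (simp add: a_scale_arg[OF D] nrm_scale)
  show ?thesis
  proof (cases "f = 0")
    case False
    then have "(nrm ipF (a g \<Psi>))\<^sup>2 \<le> real n * (nrm ipF \<Psi>)\<^sup>2"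
      using a_sum_bound[OF _ g(2) \<Psi>] by simp
    from mult_left_mono[OF this, of "(nrm ipL f)\<^sup>2"] show ?thesis
      unfolding eq by (simp add: power_mult_distrib algebra_simps)
  qed (use eq in simp)
qed

lemma ad_bound: "\<Psi> \<in> S n \<Longrightarrow> (nrm ipF (ad f \<Psi>))\<^sup>2 \<le> real (Suc n) * (nrm ipL f)\<^sup>2 * (nrm ipF \<Psi>)\<^sup>2"
proof -
  assume \<Psi>: "\<Psi> \<in> S n"
  then have D: "\<Psi> \<in> D" using S_D by blast
  obtain g where g: "f = of_real (nrm ipL f) *\<^sub>C g" "f \<noteq> 0 \<Longrightarrow> L.orthonormal (\<lambda>_. g) {()}"
    using normalize by blast
  have eq: "nrm ipF (ad f \<Psi>) = nrm ipL f * nrm ipF (ad g \<Psi>)"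
    by (subst g(1)) (simp add: ad_scale_arg[OF D] nrm_scale)
  show ?thesis
  proof (cases "f = 0")
    case False
    then have "(nrm ipF (ad g \<Psi>))\<^sup>2 \<le> real (Suc n) * (nrm ipF \<Psi>)\<^sup>2"
      using ad_sum_bound[OF _ g(2), of "\<lambda>_. \<Psi>" n] \<Psi> by simp
    then have "(nrm ipL f)\<^sup>2 * (nrm ipF (ad g \<Psi>))\<^sup>2 \<le> (nrm ipL f)\<^sup>2 * (real (Suc n) * (nrm ipF \<Psi>)\<^sup>2)"
      by (rule mult_left_mono) simp
    then show ?thesis
      unfolding eq power_mult_distrib by (simp only: mult_ac)
  qed (use eq in simp)
qed

subsection \<open>Extension to the weighted domains\<close>

lemma mem_Dhalf: "\<Phi> \<in> Dhalf ipF ad \<Omega> \<longleftrightarrow> summable (\<lambda>n. real (n + 1) * (nrm ipF (P n \<Phi>))\<^sup>2)"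
  by (simp add: Dhalf_def comp_eq)

lemma mem_Done: "\<Phi> \<in> Done ipF ad \<Omega> \<longleftrightarrow> summable (\<lambda>n. (real (n + 1))\<^sup>2 * (nrm ipF (P n \<Phi>))\<^sup>2)"
  by (simp add: Done_def comp_eq)

lemma H_Done: "\<Phi> \<in> H n \<Longrightarrow> \<Phi> \<in> Done ipF ad \<Omega>"
  unfolding mem_Done by (rule summable_finite[of "{n}"]) (auto simp: P_orth)

lemma Done_Dhalf: "\<Phi> \<in> Done ipF ad \<Omega> \<Longrightarrow> \<Phi> \<in> Dhalf ipF ad \<Omega>"
  unfolding mem_Done mem_Dhalf
  by (rule summable_comparison_test'[where N = 0], assumption)
    (simp add: power2_eq_square mult_right_mono)

lemma H_Dhalf: "\<Phi> \<in> H n \<Longrightarrow> \<Phi> \<in> Dhalf ipF ad \<Omega>"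
  by (intro Done_Dhalf H_Done)

lemma S_Dhalf: "\<Phi> \<in> S n \<Longrightarrow> \<Phi> \<in> D \<inter> Dhalf ipF ad \<Omega>"
  using H_Dhalf[OF S_H] S_D by blast

text \<open>On a single sector the weighted distance is \<open>n + 1\<close> times the squared norm
  distance, so ordinary convergence already meets the premise of the continuity axiom.\<close>

lemma H_continuous:
  assumes s: "\<And>k. s k \<in> S n" "conv ipF s \<Phi>"
  shows "conv ipF (\<lambda>k. a f (s k)) (a f \<Phi>)" "conv ipF (\<lambda>k. ad f (s k)) (ad f \<Phi>)"
proof -
  have \<Phi>: "\<Phi> \<in> H n" by (rule H_closed[OF s(2) S_H[OF s(1)]])
  have "(\<Sum>m. real (m + 1) * (nrm ipF (P m (s k - \<Phi>)))\<^sup>2) = real (n + 1) * (nrm ipF (s k - \<Phi>))\<^sup>2" for k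
  proof -
    have d: "s k - \<Phi> \<in> H n"
      by (intro cvec.subspace_diff subspace_H S_H s \<Phi>)
    have "(\<Sum>m. real (m + 1) * (nrm ipF (P m (s k - \<Phi>)))\<^sup>2)
        = (\<Sum>m\<in>{n}. real (m + 1) * (nrm ipF (P m (s k - \<Phi>)))\<^sup>2)"
      by (rule suminf_finite) (use P_orth[OF d] in auto)
    then show ?thesis by (simp add: P_id[OF d])
  qed
  moreover have "(\<lambda>k. real (n + 1) * (nrm ipF (s k - \<Phi>))\<^sup>2) \<longlonglongrightarrow> real (n + 1) * 0\<^sup>2"
    using s(2) unfolding conv_def by (intro tendsto_intros)
  ultimately have "(\<lambda>k. \<Sum>m. real (m + 1) * (nrm ipF (comp ipF ad \<Omega> m (s k - \<Phi>)))\<^sup>2) \<longlonglongrightarrow> 0"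
    by (simp add: comp_eq)
  from extension[OF H_Dhalf[OF \<Phi>] S_Dhalf[OF s(1)] this]
  show "conv ipF (\<lambda>k. a f (s k)) (a f \<Phi>)" "conv ipF (\<lambda>k. ad f (s k)) (ad f \<Phi>)"
    by auto
qed

lemma Fin_D: "\<Phi> \<in> Fin \<Longrightarrow> \<Phi> \<in> D"
proof -
  have "Fin \<subseteq> D" unfolding Fin_def using S_D by (intro cvec.span_minimal subspace_D) blast
  then show "\<Phi> \<in> Fin \<Longrightarrow> \<Phi> \<in> D" by blast
qed

text \<open>One sequence serves all \<open>f\<close> and both kinds of operators at once, so adjoint
  relations pass from \<open>D\<close> to \<open>Dhalf\<close> by continuity of the inner
  product.\<close>

lemma Dhalf_approx:
  assumes \<Phi>: "\<Phi> \<in> Dhalf ipF ad \<Omega>"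
  obtains s where "\<And>k. s k \<in> D" "conv ipF s \<Phi>"
    "\<And>f. conv ipF (\<lambda>k. a f (s k)) (a f \<Phi>)" "\<And>f. conv ipF (\<lambda>k. ad f (s k)) (ad f \<Phi>)"
proof -
  note sm = \<Phi>[unfolded mem_Dhalf]
  obtain s where s: "\<And>k. s k \<in> Fin" "\<And>k. finite {n. P n (s k) \<noteq> 0}"
    and lim: "(\<lambda>k. \<Sum>n. real (n + 1) * (nrm ipF (P n (s k - \<Phi>)))\<^sup>2) \<longlonglongrightarrow> 0"
    by (rule weighted_approx[OF sm]) (rule that)
  have half: "s k \<in> D \<inter> Dhalf ipF ad \<Omega>" for k
  proof -
    have "summable (\<lambda>n. real (n + 1) * (nrm ipF (P n (s k)))\<^sup>2)"
      by (rule summable_finite[OF s(2)[of k]]) simp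
    then show ?thesis using Fin_D[OF s(1)] by (simp add: mem_Dhalf)
  qed
  \<comment> \<open>Beyond the finitely many sectors of \<open>s k\<close> this series agrees with
    that of \<open>\<Phi>\<close>. Summability ensures that the infinite sum is a genuine value that
    dominates the squared norm.\<close>
  have sd: "summable (\<lambda>n. real (n + 1) * (nrm ipF (P n (s k - \<Phi>)))\<^sup>2)" for k
  proof (rule summable_cong[THEN iffD1, OF _ sm])
    obtain N where N: "\<And>n. P n (s k) \<noteq> 0 \<Longrightarrow> n < N"
      using s(2)[of k] unfolding finite_nat_set_iff_bounded by blast
    show "\<forall>\<^sub>F n in sequentially. real (n + 1) * (nrm ipF (P n \<Phi>))\<^sup>2
        = real (n + 1) * (nrm ipF (P n (s k - \<Phi>)))\<^sup>2"
    proof (rule eventually_sequentiallyI[of N])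
      fix n assume "N \<le> n"
      then have "P n (s k) = 0" using N[of n] by fastforce
      then show "real (n + 1) * (nrm ipF (P n \<Phi>))\<^sup>2 = real (n + 1) * (nrm ipF (P n (s k - \<Phi>)))\<^sup>2"
        by (simp add: P_diff nrm_minus)
    qed
  qed
  have "(nrm ipF (s k - \<Phi>))\<^sup>2 \<le> (\<Sum>n. real (n + 1) * (nrm ipF (P n (s k - \<Phi>)))\<^sup>2)" for k
    by (rule sums_le[OF _ P_parseval summable_sums[OF sd]]) (simp add: mult_le_cancel_right1)
  then have le: "nrm ipF (s k - \<Phi>) \<le> sqrt (\<Sum>n. real (n + 1) * (nrm ipF (P n (s k - \<Phi>)))\<^sup>2)" for k
    by (rule real_le_rsqrt)
  have "conv ipF s \<Phi>"
    by (rule conv_bound[OF le]) (use tendsto_real_sqrt[OF lim] in simp)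
  then show ?thesis
    using that[of s] half extension[OF \<Phi> half] lim by (simp add: comp_eq)
qed

lemma ip_a_half:
  assumes "\<Phi> \<in> Dhalf ipF ad \<Omega>" "\<Psi> \<in> Dhalf ipF ad \<Omega>"
  shows "ipF (a f \<Phi>) \<Psi> = ipF \<Phi> (ad (J f) \<Psi>)"
proof -
  obtain s where s: "\<And>k. s k \<in> D" "conv ipF s \<Phi>" "\<And>f. conv ipF (\<lambda>k. a f (s k)) (a f \<Phi>)"
    "\<And>f. conv ipF (\<lambda>k. ad f (s k)) (ad f \<Phi>)"
    by (rule Dhalf_approx[OF assms(1)]) (rule that)
  obtain t where t: "\<And>k. t k \<in> D" "conv ipF t \<Psi>" "\<And>f. conv ipF (\<lambda>k. a f (t k)) (a f \<Psi>)"
    "\<And>f. conv ipF (\<lambda>k. ad f (t k)) (ad f \<Psi>)"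
    by (rule Dhalf_approx[OF assms(2)]) (rule that)
  have "(\<lambda>k. ipF (a f (s k)) (t k)) \<longlonglongrightarrow> ipF (a f \<Phi>) \<Psi>"
    by (intro conv_ip s t)
  moreover have "(\<lambda>k. ipF (s k) (ad (J f) (t k))) \<longlonglongrightarrow> ipF \<Phi> (ad (J f) \<Psi>)"
    by (intro conv_ip s t)
  ultimately show ?thesis
    unfolding ip_a_left[OF s(1) t(1)] by (rule LIMSEQ_unique)
qed

lemma ip_ad_half:
  assumes "\<Phi> \<in> Dhalf ipF ad \<Omega>" "\<Psi> \<in> Dhalf ipF ad \<Omega>"
  shows "ipF (ad f \<Phi>) \<Psi> = ipF \<Phi> (a (J f) \<Psi>)"
  using ip_a_half[OF assms(2,1), of "J f"] by (subst (1 2) ip_cnj) simp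

lemma ad_H: "\<Phi> \<in> H n \<Longrightarrow> ad f \<Phi> \<in> H (Suc n)"
  by (rule H_approx, assumption) (rule H_closed[OF H_continuous(2)], auto intro: S_H ad_S)

lemma a_H: "\<Phi> \<in> H (Suc n) \<Longrightarrow> a f \<Phi> \<in> H n"
  by (rule H_approx, assumption) (rule H_closed[OF H_continuous(1)], auto intro: S_H a_S)

text \<open>Moved to the test vector, the operator becomes \<open>a (J f)\<close> and lands in
  sector \<open>n\<close>, where only the component \<open>P n \<Phi>\<close> is seen.\<close>

lemma P_ad_Suc:
  assumes "\<Phi> \<in> Dhalf ipF ad \<Omega>"
  shows "P (Suc n) (ad f \<Phi>) = ad f (P n \<Phi>)"
proof (rule P_unique)
  show "ad f (P n \<Phi>) \<in> H (Suc n)" by (intro ad_H P_H)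
  fix \<xi> assume \<xi>: "\<xi> \<in> S (Suc n)"
  have "ipF \<xi> (ad f \<Psi>) = ipF (a (J f) \<xi>) \<Psi>" if "\<Psi> \<in> Dhalf ipF ad \<Omega>" for \<Psi>
    using ip_a_half[OF H_Dhalf[OF S_H[OF \<xi>]] that, of "J f"] by simp
  then show "ipF \<xi> (ad f \<Phi>) = ipF \<xi> (ad f (P n \<Phi>))"
    using P_ip[OF S_H[OF a_S[OF \<xi>]]] assms H_Dhalf[OF P_H] by simp
qed

lemma P_ad_0:
  assumes "\<Phi> \<in> Dhalf ipF ad \<Omega>"
  shows "P 0 (ad f \<Phi>) = 0"
proof (rule P_unique)
  show "0 \<in> H 0" by (rule cvec.subspace_0[OF subspace_H])
  fix \<xi> assume \<xi>: "\<xi> \<in> S 0"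
  show "ipF \<xi> (ad f \<Phi>) = ipF \<xi> 0"
    using ip_a_half[OF H_Dhalf[OF S_H[OF \<xi>]] assms, of "J f"] a_S_0[OF \<xi>] by simp
qed

lemma P_a:
  assumes "\<Phi> \<in> Dhalf ipF ad \<Omega>"
  shows "P n (a f \<Phi>) = a f (P (Suc n) \<Phi>)"
proof (rule P_unique)
  show "a f (P (Suc n) \<Phi>) \<in> H n" by (intro a_H P_H)
  fix \<xi> assume \<xi>: "\<xi> \<in> S n"
  have "ipF \<xi> (a f \<Psi>) = ipF (ad (J f) \<xi>) \<Psi>" if "\<Psi> \<in> Dhalf ipF ad \<Omega>" for \<Psi>
    using ip_ad_half[OF H_Dhalf[OF S_H[OF \<xi>]] that, of "J f"] by simp
  then show "ipF \<xi> (a f \<Phi>) = ipF \<xi> (a f (P (Suc n) \<Phi>))"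
    using P_ip[OF S_H[OF ad_S[OF \<xi>]]] assms H_Dhalf[OF P_H] by simp
qed

lemma ad_H_bound:
  assumes "\<Phi> \<in> H n"
  shows "(nrm ipF (ad f \<Phi>))\<^sup>2 \<le> real (Suc n) * (nrm ipL f)\<^sup>2 * (nrm ipF \<Phi>)\<^sup>2"
proof -
  obtain s where s: "\<And>k. s k \<in> S n" "conv ipF s \<Phi>" using H_approx[OF assms] by blast
  show ?thesis
    by (rule LIMSEQ_le[OF tendsto_power[OF conv_nrm[OF H_continuous(2)[OF s]]]
          tendsto_mult_left[OF tendsto_power[OF conv_nrm[OF s(2)]]]])
      (use ad_bound[OF s(1)] in blast)
qed

lemma a_H_bound:
  assumes "\<Phi> \<in> H n"
  shows "(nrm ipF (a f \<Phi>))\<^sup>2 \<le> real n * (nrm ipL f)\<^sup>2 * (nrm ipF \<Phi>)\<^sup>2"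
proof -
  obtain s where s: "\<And>k. s k \<in> S n" "conv ipF s \<Phi>" using H_approx[OF assms] by blast
  show ?thesis
    by (rule LIMSEQ_le[OF tendsto_power[OF conv_nrm[OF H_continuous(1)[OF s]]]
          tendsto_mult_left[OF tendsto_power[OF conv_nrm[OF s(2)]]]])
      (use a_bound[OF s(1)] in blast)
qed

lemma a_sum_H_bound:
  assumes "finite I" "L.orthonormal g I" "\<Phi> \<in> H n"
  shows "(\<Sum>i\<in>I. (nrm ipF (a (g i) \<Phi>))\<^sup>2) \<le> real n * (nrm ipF \<Phi>)\<^sup>2"
proof -
  obtain s where s: "\<And>k. s k \<in> S n" "conv ipF s \<Phi>" using H_approx[OF assms(3)] by blast
  show ?thesis
    by (rule LIMSEQ_le[OF tendsto_sum[OF tendsto_power[OF conv_nrm[OF H_continuous(1)[OF s]]]]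
          tendsto_mult_left[OF tendsto_power[OF conv_nrm[OF s(2)]]]])
      (use a_sum_bound[OF assms(1,2) s(1)] in blast)
qed

text \<open>Makes a second field operator applicable. The factor 2 absorbs the shift of the weight,
  n + 2 <= 2 (n + 1), and the bound for \<open>ad f\<close> uses up the other power of n +
  1.\<close>

lemma ad_Done:
  assumes "\<Phi> \<in> Done ipF ad \<Omega>"
  shows "ad f \<Phi> \<in> Dhalf ipF ad \<Omega>"
proof -
  have "summable (\<lambda>n. real (Suc n + 1) * (nrm ipF (P (Suc n) (ad f \<Phi>)))\<^sup>2)"
  proof (rule summable_comparison_test'[where N = 0])
    show "summable (\<lambda>n. 2 * (nrm ipL f)\<^sup>2 * ((real (n + 1))\<^sup>2 * (nrm ipF (P n \<Phi>))\<^sup>2))"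
      by (intro summable_mult assms[unfolded mem_Done])
    fix n :: nat
    have "real (Suc n + 1) * (nrm ipF (ad f (P n \<Phi>)))\<^sup>2
        \<le> (2 * real (n + 1)) * (real (n + 1) * (nrm ipL f)\<^sup>2 * (nrm ipF (P n \<Phi>))\<^sup>2)"
      using ad_H_bound[OF P_H, of f n \<Phi>] by (intro mult_mono) auto
    also have "\<dots> = 2 * (nrm ipL f)\<^sup>2 * ((real (n + 1))\<^sup>2 * (nrm ipF (P n \<Phi>))\<^sup>2)"
      by (simp only: power2_eq_square mult_ac)
    finally show "norm (real (Suc n + 1) * (nrm ipF (P (Suc n) (ad f \<Phi>)))\<^sup>2)
        \<le> 2 * (nrm ipL f)\<^sup>2 * ((real (n + 1))\<^sup>2 * (nrm ipF (P n \<Phi>))\<^sup>2)"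
      unfolding P_ad_Suc[OF Done_Dhalf[OF assms]] by simp
  qed
  then show ?thesis unfolding mem_Dhalf by (subst summable_Suc_iff[symmetric])
qed

lemma a_Done:
  assumes "\<Phi> \<in> Done ipF ad \<Omega>"
  shows "a f \<Phi> \<in> Dhalf ipF ad \<Omega>"
  unfolding mem_Dhalf
proof (rule summable_comparison_test'[where N = 0])
  have "summable (\<lambda>n. (real (Suc n + 1))\<^sup>2 * (nrm ipF (P (Suc n) \<Phi>))\<^sup>2)"
    using assms[unfolded mem_Done] by (subst summable_Suc_iff)
  then show "summable (\<lambda>n. (nrm ipL f)\<^sup>2 * ((real (Suc n + 1))\<^sup>2 * (nrm ipF (P (Suc n) \<Phi>))\<^sup>2))"
    by (rule summable_mult)
  fix n :: nat
  have "real (n + 1) * (nrm ipF (a f (P (Suc n) \<Phi>)))\<^sup>2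
      \<le> real (Suc n + 1) * (real (Suc n) * (nrm ipL f)\<^sup>2 * (nrm ipF (P (Suc n) \<Phi>))\<^sup>2)"
    using a_H_bound[OF P_H, of f "Suc n" \<Phi>] by (intro mult_mono) auto
  also have "\<dots> \<le> real (Suc n + 1) * (real (Suc n + 1) * (nrm ipL f)\<^sup>2 * (nrm ipF (P (Suc n) \<Phi>))\<^sup>2)"
    by (intro mult_left_mono mult_right_mono) auto
  also have "\<dots> = (nrm ipL f)\<^sup>2 * ((real (Suc n + 1))\<^sup>2 * (nrm ipF (P (Suc n) \<Phi>))\<^sup>2)"
    by (simp only: power2_eq_square mult_ac)
  finally show "norm (real (n + 1) * (nrm ipF (P n (a f \<Phi>)))\<^sup>2)
      \<le> (nrm ipL f)\<^sup>2 * ((real (Suc n + 1))\<^sup>2 * (nrm ipF (P (Suc n) \<Phi>))\<^sup>2)"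
    unfolding P_a[OF Done_Dhalf[OF assms]] by simp
qed

text \<open>A vector of \<open>Done\<close> need not lie in \<open>D\<close>, so commutation is
  carried over by continuity within each sector and then compared component by component.\<close>

lemma ad_ad_commute_Done:
  assumes "\<Phi> \<in> Done ipF ad \<Omega>"
  shows "ad f (ad g \<Phi>) = ad g (ad f \<Phi>)"
proof -
  have H: "ad f (ad g \<Psi>) = ad g (ad f \<Psi>)" if \<Psi>: "\<Psi> \<in> H n" for f g \<Psi> n
  proof -
    obtain s where s: "\<And>k. s k \<in> S n" "conv ipF s \<Psi>" using H_approx[OF \<Psi>] by blast
    have lim: "conv ipF (\<lambda>k. ad f (ad g (s k))) (ad f (ad g \<Psi>))" for f g
      by (rule H_continuous(2)[OF ad_S[OF s(1)] H_continuous(2)[OF s]])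
    have "ad f (ad g (s k)) = ad g (ad f (s k))" for k
      using s(1) S_D by (intro ad_commute) blast
    then show ?thesis
      using conv_unique[OF lim[of f g]] lim[of g f] by simp
  qed
  have PP: "P n (ad f (ad g \<Phi>)) = (case n of Suc (Suc m) \<Rightarrow> ad f (ad g (P m \<Phi>)) | _ \<Rightarrow> 0)" for n f g
    by (simp add: P_ad_Suc P_ad_0 ad_Done assms Done_Dhalf split: nat.split)
  have "P n (ad f (ad g \<Phi>)) = P n (ad g (ad f \<Phi>))" for n
    unfolding PP H[OF P_H, of f g] ..
  then show ?thesis
    using conv_unique[OF P_expansion[of "ad f (ad g \<Phi>)"]] P_expansion[of "ad g (ad f \<Phi>)"] by simp
qed

subsection \<open>Bounds for pairs of creation operators\<close>

text \<open>Splits the inner creation operator into the part that yields the Hilbert-Schmidt term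
  and the part that yields the operator-norm term.\<close>

lemma nrm_ad_sq:
  assumes "\<Phi> \<in> D"
  shows "(nrm ipF (ad v \<Phi>))\<^sup>2 = (nrm ipL v)\<^sup>2 * (nrm ipF \<Phi>)\<^sup>2 + (nrm ipF (a (J v) \<Phi>))\<^sup>2"
proof -
  have "ipF (ad v \<Phi>) (ad v \<Phi>) = ipF \<Phi> (ad v (a (J v) \<Phi>)) + ipL v v * ipF \<Phi> \<Phi>"
    using assms by (simp add: ip_ad_left D_ad ccr ip_add_right ip_scale_right)
  also have "ipF \<Phi> (ad v (a (J v) \<Phi>)) = ipF (a (J v) \<Phi>) (a (J v) \<Phi>)"
    using assms ip_a_left[of \<Phi> "a (J v) \<Phi>" "J v"] by (simp add: D_a)
  finally show ?thesis by (simp add: nrm_sq L.nrm_sq L.ip_self_Im ip_self_Im)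
qed

text \<open>Expanding the \<open>f i\<close> in an orthonormal family \<open>u\<close> turns the sum into
  \<open>\<Sum>k. ad (u k) (ad (J (w k)) \<Phi>)\<close>, which is controlled by the number operator
  on the sectors \<open>m + 2\<close> and \<open>m\<close>.\<close>
lemma creation_pair_bound_S:
  assumes fin: "finite I" and e: "L.orthonormal e I" and \<Phi>: "\<Phi> \<in> S m"
    and c: "\<And>t. (nrm ipL (\<Sum>i\<in>I. t i *\<^sub>C f i))\<^sup>2 \<le> c * (\<Sum>i\<in>I. (cmod (t i))\<^sup>2)" and c0: "0 \<le> c"
  shows "(nrm ipF (\<Sum>i\<in>I. ad (f i) (ad (J (e i)) \<Phi>)))\<^sup>2
    \<le> real (m + 2) * (c * real m + (\<Sum>i\<in>I. (nrm ipL (f i))\<^sup>2)) * (nrm ipF \<Phi>)\<^sup>2"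
proof -
  have D: "\<Phi> \<in> D" using \<Phi> S_D by blast
  obtain u d where u: "L.orthonormal (u :: nat \<Rightarrow> 'l) {..<d}"
    and f: "\<And>i. i \<in> I \<Longrightarrow> f i = (\<Sum>k<d. ipL (u k) (f i) *\<^sub>C u k)"
    using L.gram_schmidt[of "f ` I"] fin by blast
  \<comment> \<open>\<open>w k\<close> is the adjoint of the finite-rank map sending
    \<open>e i\<close> to \<open>f i\<close>, applied to \<open>u k\<close>; for
    \<open>f i = C (e i)\<close> it is a truncated adjoint of \<open>C\<close> at
    \<open>u k\<close>.\<close>
  define w where "w k = (\<Sum>i\<in>I. ipL (f i) (u k) *\<^sub>C e i)" for k
  have Jw: "J (w k) = (\<Sum>i\<in>I. ipL (u k) (f i) *\<^sub>C J (e i))" for k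
    unfolding w_def J_sum by (intro sum.cong refl arg_cong2[where f = scaleC] L.ip_cnj[symmetric])
  have "ad (f i) (ad (J (e i)) \<Phi>) = (\<Sum>k<d. ipL (u k) (f i) *\<^sub>C ad (u k) (ad (J (e i)) \<Phi>))" if "i \<in> I" for i
    by (subst f[OF that]) (rule ad_sum_arg[OF D_ad[OF D]])
  then have "(\<Sum>i\<in>I. ad (f i) (ad (J (e i)) \<Phi>))
      = (\<Sum>i\<in>I. \<Sum>k<d. ipL (u k) (f i) *\<^sub>C ad (u k) (ad (J (e i)) \<Phi>))"
    by (intro sum.cong refl)
  also have "\<dots> = (\<Sum>k<d. \<Sum>i\<in>I. ipL (u k) (f i) *\<^sub>C ad (u k) (ad (J (e i)) \<Phi>))"
    by (rule sum.swap)
  also have "\<dots> = (\<Sum>k<d. ad (u k) (ad (J (w k)) \<Phi>))"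
    unfolding Jw ad_sum_arg[OF D] by (intro sum.cong refl ad_sum[symmetric] D_ad D)
  \<comment> \<open>The vectors \<open>ad (J (w k)) \<Phi>\<close> lie in sector
    \<open>m + 1\<close>, so the outer creation operators cost the factor
    \<open>m + 2\<close>.\<close>
  finally have "(nrm ipF (\<Sum>i\<in>I. ad (f i) (ad (J (e i)) \<Phi>)))\<^sup>2
      \<le> real (Suc (Suc m)) * (\<Sum>k<d. (nrm ipF (ad (J (w k)) \<Phi>))\<^sup>2)"
    using ad_sum_bound[OF finite_lessThan u, of "\<lambda>k. ad (J (w k)) \<Phi>" "Suc m"] ad_S[OF \<Phi>] by simp
  moreover have "(\<Sum>k<d. (nrm ipF (ad (J (w k)) \<Phi>))\<^sup>2)
      = (\<Sum>k<d. (nrm ipL (w k))\<^sup>2) * (nrm ipF \<Phi>)\<^sup>2 + (\<Sum>k<d. (nrm ipF (a (w k) \<Phi>))\<^sup>2)"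
    by (simp add: nrm_ad_sq[OF D] J_nrm sum.distrib sum_distrib_right)
  moreover have w1: "(\<Sum>k<d. (nrm ipL (w k))\<^sup>2) \<le> (\<Sum>i\<in>I. (nrm ipL (f i))\<^sup>2)"
  proof -
    have "(\<Sum>k<d. (nrm ipL (w k))\<^sup>2) = (\<Sum>k<d. \<Sum>i\<in>I. (cmod (ipL (u k) (f i)))\<^sup>2)"
      unfolding w_def L.orthonormal_nrm_sum[OF fin e]
      by (intro sum.cong refl) (subst L.cmod_ip_commute, rule refl)
    also have "\<dots> = (\<Sum>i\<in>I. \<Sum>k<d. (cmod (ipL (u k) (f i)))\<^sup>2)"
      by (rule sum.swap)
    also have "\<dots> \<le> (\<Sum>i\<in>I. (nrm ipL (f i))\<^sup>2)"
      by (intro sum_mono L.bessel finite_lessThan u)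
    finally show ?thesis .
  qed
  moreover have w2: "(\<Sum>k<d. (nrm ipF (a (w k) \<Phi>))\<^sup>2) \<le> c * (real m * (nrm ipF \<Phi>)\<^sup>2)"
  proof -
    have "(\<Sum>k<d. (nrm ipF (a (w k) \<Phi>))\<^sup>2) = (\<Sum>k<d. (nrm ipF (\<Sum>i\<in>I. ipL (f i) (u k) *\<^sub>C a (e i) \<Phi>))\<^sup>2)"
      unfolding w_def a_sum_arg[OF D] ..
    \<comment> \<open>The scalar bound for the matrix of entries \<open>ipL (f i) (u k)\<close> is
      Bessel in \<open>u\<close> followed by the hypothesis on \<open>c\<close>; conjugating
      \<open>t\<close> moves the coefficients into the inner product.\<close>
    also have "\<dots> \<le> c * (\<Sum>i\<in>I. (nrm ipF (a (e i) \<Phi>))\<^sup>2)"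
    proof (rule matrix_bound[OF fin])
      fix t :: "'a \<Rightarrow> complex"
      let ?x = "\<Sum>i\<in>I. cnj (t i) *\<^sub>C f i"
      have "(\<Sum>i\<in>I. ipL (f i) (u k) * t i) = ipL ?x (u k)" for k
        by (simp add: L.ip_sum_left L.ip_scale_left mult.commute)
      then have "(\<Sum>k<d. (cmod (\<Sum>i\<in>I. ipL (f i) (u k) * t i))\<^sup>2) = (\<Sum>k<d. (cmod (ipL (u k) ?x))\<^sup>2)"
        by (simp only: L.cmod_ip_commute[of ?x])
      also have "\<dots> \<le> (nrm ipL ?x)\<^sup>2"
        by (rule L.bessel[OF finite_lessThan u])
      also have "\<dots> \<le> c * (\<Sum>i\<in>I. (cmod (t i))\<^sup>2)"
        using c[of "\<lambda>i. cnj (t i)"] by simp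
      finally show "(\<Sum>k<d. (cmod (\<Sum>i\<in>I. ipL (f i) (u k) * t i))\<^sup>2) \<le> c * (\<Sum>i\<in>I. (cmod (t i))\<^sup>2)" .
    qed
    also have "\<dots> \<le> c * (real m * (nrm ipF \<Phi>)\<^sup>2)"
      by (rule mult_left_mono[OF a_sum_bound[OF fin e \<Phi>] c0])
    finally show ?thesis .
  qed
  ultimately have "(nrm ipF (\<Sum>i\<in>I. ad (f i) (ad (J (e i)) \<Phi>)))\<^sup>2
      \<le> real (Suc (Suc m)) * ((\<Sum>k<d. (nrm ipL (w k))\<^sup>2) * (nrm ipF \<Phi>)\<^sup>2 + (\<Sum>k<d. (nrm ipF (a (w k) \<Phi>))\<^sup>2))"
    by simp
  also have "\<dots> \<le> real (Suc (Suc m)) * ((\<Sum>i\<in>I. (nrm ipL (f i))\<^sup>2) * (nrm ipF \<Phi>)\<^sup>2 + c * (real m * (nrm ipF \<Phi>)\<^sup>2))"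
    by (rule mult_left_mono[OF add_mono[OF mult_right_mono[OF w1] w2]]) simp_all
  also have "\<dots> = real (m + 2) * (c * real m + (\<Sum>i\<in>I. (nrm ipL (f i))\<^sup>2)) * (nrm ipF \<Phi>)\<^sup>2"
    by (simp add: algebra_simps)
  finally show ?thesis .
qed

lemma creation_pair_bound_H:
  assumes "finite I" "L.orthonormal e I" and \<Phi>: "\<Phi> \<in> H m"
    and "\<And>t. (nrm ipL (\<Sum>i\<in>I. t i *\<^sub>C f i))\<^sup>2 \<le> c * (\<Sum>i\<in>I. (cmod (t i))\<^sup>2)" "0 \<le> c"
  shows "(nrm ipF (\<Sum>i\<in>I. ad (f i) (ad (J (e i)) \<Phi>)))\<^sup>2
    \<le> real (m + 2) * (c * real m + (\<Sum>i\<in>I. (nrm ipL (f i))\<^sup>2)) * (nrm ipF \<Phi>)\<^sup>2"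
proof -
  obtain s where s: "\<And>k. s k \<in> S m" "conv ipF s \<Phi>" using H_approx[OF \<Phi>] by blast
  have lim: "conv ipF (\<lambda>k. \<Sum>i\<in>I. ad (f i) (ad (J (e i)) (s k))) (\<Sum>i\<in>I. ad (f i) (ad (J (e i)) \<Phi>))"
    by (intro conv_sum H_continuous(2)[OF ad_S[OF s(1)]] H_continuous(2)[OF s])
  show ?thesis
    by (rule LIMSEQ_le[OF tendsto_power[OF conv_nrm[OF lim]]
          tendsto_mult_left[OF tendsto_power[OF conv_nrm[OF s(2)]]]])
      (use creation_pair_bound_S[OF assms(1,2) s(1) assms(4,5)] in blast)
qed

text \<open>Pairs of creation operators raise sector \<open>m\<close> to \<open>m + 2\<close>, so
  images of different sectors stay orthogonal and sector bounds add up. Components 0 and 1 of the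
  image vanish, which allows the index shift by two.\<close>

lemma creation_pair_sums:
  assumes "\<Phi> \<in> Done ipF ad \<Omega>"
  shows "(\<lambda>m. (nrm ipF (\<Sum>i\<in>I. ad (f i) (ad (g i) (P m \<Phi>))))\<^sup>2)
    sums (nrm ipF (\<Sum>i\<in>I. ad (f i) (ad (g i) \<Phi>)))\<^sup>2"
proof -
  let ?X = "\<Sum>i\<in>I. ad (f i) (ad (g i) \<Phi>)"
  have 2: "P (Suc (Suc m)) ?X = (\<Sum>i\<in>I. ad (f i) (ad (g i) (P m \<Phi>)))" for m
    by (simp add: P_sum P_ad_Suc ad_Done Done_Dhalf assms)
  have 1: "P (Suc 0) ?X = 0" and 0: "P 0 ?X = 0"
    by (simp_all add: P_sum P_ad_Suc P_ad_0 ad_Done Done_Dhalf assms)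
  have "(\<lambda>n. (nrm ipF (P (Suc (Suc n)) ?X))\<^sup>2) sums (nrm ipF ?X)\<^sup>2"
    by (subst sums_Suc_iff, subst sums_Suc_iff) (use P_parseval[of ?X] in \<open>simp add: 0 1\<close>)
  then show ?thesis unfolding 2 .
qed

text \<open>The squared norm of the square root of N + 2 applied to \<open>\<Phi>\<close>;
  \<open>weight2\<close> is the same for N (N + 2).\<close>

definition weight1 :: "'f \<Rightarrow> real" where
  "weight1 \<Phi> = (\<Sum>n. real (n + 2) * (nrm ipF (P n \<Phi>))\<^sup>2)"

definition weight2 :: "'f \<Rightarrow> real" where
  "weight2 \<Phi> = (\<Sum>n. real n * real (n + 2) * (nrm ipF (P n \<Phi>))\<^sup>2)"

lemma weight_sums:
  assumes "\<Phi> \<in> Done ipF ad \<Omega>"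
  shows "(\<lambda>n. real (n + 2) * (nrm ipF (P n \<Phi>))\<^sup>2) sums weight1 \<Phi>"
    and "(\<lambda>n. real n * real (n + 2) * (nrm ipF (P n \<Phi>))\<^sup>2) sums weight2 \<Phi>"
proof -
  note sm = summable_mult[OF assms[unfolded mem_Done], of 2]
  have "real (n + 2) \<le> 2 * (real (n + 1))\<^sup>2" "real n * real (n + 2) \<le> 2 * (real (n + 1))\<^sup>2" for n
    by (simp_all add: power2_eq_square algebra_simps)
  note le = this[THEN mult_right_mono[OF _ zero_le_power2]]
  have "summable (\<lambda>n. real (n + 2) * (nrm ipF (P n \<Phi>))\<^sup>2)"
    by (rule summable_comparison_test'[OF sm, where N = 0]) (use le(1) in \<open>simp add: mult.assoc\<close>)
  then show "(\<lambda>n. real (n + 2) * (nrm ipF (P n \<Phi>))\<^sup>2) sums weight1 \<Phi>"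
    unfolding weight1_def by (rule summable_sums)
  have "summable (\<lambda>n. real n * real (n + 2) * (nrm ipF (P n \<Phi>))\<^sup>2)"
    by (rule summable_comparison_test'[OF sm, where N = 0]) (use le(2) in \<open>simp add: mult.assoc\<close>)
  then show "(\<lambda>n. real n * real (n + 2) * (nrm ipF (P n \<Phi>))\<^sup>2) sums weight2 \<Phi>"
    unfolding weight2_def by (rule summable_sums)
qed

lemma weight_nonneg:
  assumes "\<Phi> \<in> Done ipF ad \<Omega>"
  shows "0 \<le> weight1 \<Phi>" "0 \<le> weight2 \<Phi>"
  using sums_le[OF _ sums_zero weight_sums(1)[OF assms]] sums_le[OF _ sums_zero weight_sums(2)[OF assms]]
  by simp_all

lemma creation_pair_bound:
  assumes "finite I" "L.orthonormal e I" and \<Phi>: "\<Phi> \<in> Done ipF ad \<Omega>"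
    and "\<And>t. (nrm ipL (\<Sum>i\<in>I. t i *\<^sub>C f i))\<^sup>2 \<le> c * (\<Sum>i\<in>I. (cmod (t i))\<^sup>2)" "0 \<le> c"
  shows "(nrm ipF (\<Sum>i\<in>I. ad (f i) (ad (J (e i)) \<Phi>)))\<^sup>2
    \<le> c * weight2 \<Phi> + (\<Sum>i\<in>I. (nrm ipL (f i))\<^sup>2) * weight1 \<Phi>"
proof (rule sums_le[OF _ creation_pair_sums[OF \<Phi>]
        sums_add[OF sums_mult[OF weight_sums(2)[OF \<Phi>]] sums_mult[OF weight_sums(1)[OF \<Phi>]]]])
  fix n
  show "(nrm ipF (\<Sum>i\<in>I. ad (f i) (ad (J (e i)) (P n \<Phi>))))\<^sup>2
      \<le> c * (real n * real (n + 2) * (nrm ipF (P n \<Phi>))\<^sup>2)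
        + (\<Sum>i\<in>I. (nrm ipL (f i))\<^sup>2) * (real (n + 2) * (nrm ipF (P n \<Phi>))\<^sup>2)"
    using creation_pair_bound_H[OF assms(1,2) P_H assms(4,5), of n \<Phi>] by (simp add: algebra_simps)
qed

lemma creation_pair_converges:
  assumes C: "hs_op ipL C" and e: "cons ipL e" and \<Phi>: "\<Phi> \<in> Done ipF ad \<Omega>"
  shows "\<exists>X. conv ipF (\<lambda>M. \<Sum>j<M. ad (C (e j)) (ad (J (e j)) \<Phi>)) X"
proof (rule complete_sq)
  \<comment> \<open>For a tail the Hilbert-Schmidt sum also serves as the constant \<open>c\<close>,
    so both weights carry the same vanishing factor.\<close>
  let ?b = "\<lambda>M. (\<Sum>j<M. (nrm ipL (C (e j)))\<^sup>2) * (weight2 \<Phi> + weight1 \<Phi>)"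
  show "convergent ?b"
    by (rule convergentI[OF tendsto_mult_right[OF L.hs_op_sums[OF C e, unfolded sums_def]]])
  fix m n :: nat assume "m \<le> n"
  then have "(\<Sum>j<n. ad (C (e j)) (ad (J (e j)) \<Phi>)) - (\<Sum>j<m. ad (C (e j)) (ad (J (e j)) \<Phi>))
      = (\<Sum>j\<in>{m..<n}. ad (C (e j)) (ad (J (e j)) \<Phi>))"
    "?b n - ?b m = (\<Sum>j\<in>{m..<n}. (nrm ipL (C (e j)))\<^sup>2) * (weight2 \<Phi> + weight1 \<Phi>)"
    by (simp_all add: sum_diff_nat_ivl flip: atLeast0LessThan left_diff_distrib)
  then show "(nrm ipF ((\<Sum>j<n. ad (C (e j)) (ad (J (e j)) \<Phi>)) - (\<Sum>j<m. ad (C (e j)) (ad (J (e j)) \<Phi>))))\<^sup>2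
      \<le> ?b n - ?b m"
    using creation_pair_bound[OF _ L.cons_orthonormal[OF e] \<Phi> L.nrm_sum_scale_le, of "{m..<n}" "\<lambda>j. C (e j)"]
    by (simp add: distrib_left sum_nonneg)
qed

lemma creation_pair_limit_bound:
  assumes C: "hs_op ipL C" and e: "cons ipL e" and \<Phi>: "\<Phi> \<in> Done ipF ad \<Omega>"
    and X: "conv ipF (\<lambda>M. \<Sum>j<M. ad (C (e j)) (ad (J (e j)) \<Phi>)) X"
  shows "(nrm ipF X)\<^sup>2 \<le> (opnorm ipL C)\<^sup>2 * weight2 \<Phi> + hs_norm_sq ipL C * weight1 \<Phi>"
proof (rule LIMSEQ_le_const2[OF tendsto_power[OF conv_nrm[OF X]]], intro exI allI impI)
  fix M :: nat
  have b: "bounded_op ipL C" using C unfolding hs_op_def by blast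
  note on = L.cons_orthonormal[OF e]
  \<comment> \<open>Here \<open>c\<close> is the squared operator norm, uniformly in
    \<open>M\<close>: the sum is \<open>C\<close> applied to a vector with orthonormal coordinates
    \<open>t j\<close>.\<close>
  have "(nrm ipL (\<Sum>j<M. t j *\<^sub>C C (e j)))\<^sup>2 \<le> (opnorm ipL C)\<^sup>2 * (\<Sum>j<M. (cmod (t j))\<^sup>2)" for t
  proof -
    have "(nrm ipL (C (\<Sum>j<M. t j *\<^sub>C e j)))\<^sup>2 \<le> (opnorm ipL C * nrm ipL (\<Sum>j<M. t j *\<^sub>C e j))\<^sup>2"
      by (rule power_mono[OF L.opnorm_bound(1)[OF b]]) simp
    then show ?thesis
      unfolding L.bounded_op_sum[OF b] power_mult_distrib L.orthonormal_nrm_sum[OF finite_lessThan on] .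
  qed
  then have "(nrm ipF (\<Sum>j<M. ad (C (e j)) (ad (J (e j)) \<Phi>)))\<^sup>2
      \<le> (opnorm ipL C)\<^sup>2 * weight2 \<Phi> + (\<Sum>j<M. (nrm ipL (C (e j)))\<^sup>2) * weight1 \<Phi>"
    by (rule creation_pair_bound[OF finite_lessThan on \<Phi>]) simp
  also have "(\<Sum>j<M. (nrm ipL (C (e j)))\<^sup>2) \<le> hs_norm_sq ipL C"
    using sum_le_suminf[OF sums_summable[OF L.hs_op_sums[OF C e]], of "{..<M}"]
      sums_unique[OF L.hs_op_sums[OF C e]] by simp
  finally show "(nrm ipF (\<Sum>j<M. ad (C (e j)) (ad (J (e j)) \<Phi>)))\<^sup>2
      \<le> (opnorm ipL C)\<^sup>2 * weight2 \<Phi> + hs_norm_sq ipL C * weight1 \<Phi>"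
    using weight_nonneg(1)[OF \<Phi>] by (simp add: mult_right_mono)
qed

subsection \<open>Identification of the limit\<close>

lemma J_conv:
  assumes "conv ipL s x"
  shows "conv ipL (\<lambda>k. J (s k)) (J x)"
proof -
  have "J (x - y) = J x - J y" for x y
    using J_add[of "x - y" y] by simp
  then have "nrm ipL (J (s k) - J x) = nrm ipL (s k - x)" for k
    using J_nrm[of "s k - x"] by simp
  then show ?thesis using assms by (simp add: conv_def)
qed

lemma a_conv_arg:
  assumes f: "conv ipL s f" and \<Psi>: "\<Psi> \<in> S n"
  shows "conv ipF (\<lambda>k. a (s k) \<Psi>) (a f \<Psi>)"
proof (rule conv_bound)
  have D: "\<Psi> \<in> D" using \<Psi> S_D by blast
  fix k
  have "a (s k - f) \<Psi> = a (s k) \<Psi> - a f \<Psi>"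
    using a_add_arg[OF D, of "s k - f" f] by simp
  then have "(nrm ipF (a (s k) \<Psi> - a f \<Psi>))\<^sup>2 \<le> real n * (nrm ipL (s k - f))\<^sup>2 * (nrm ipF \<Psi>)\<^sup>2"
    using a_bound[OF \<Psi>, of "s k - f"] by simp
  then have "nrm ipF (a (s k) \<Psi> - a f \<Psi>) \<le> sqrt (real n * (nrm ipL (s k - f))\<^sup>2 * (nrm ipF \<Psi>)\<^sup>2)"
    by (rule real_le_rsqrt)
  then show "nrm ipF (a (s k) \<Psi> - a f \<Psi>) \<le> sqrt (real n) * nrm ipF \<Psi> * nrm ipL (s k - f)"
    by (simp add: real_sqrt_mult mult_ac)
next
  show "(\<lambda>k. sqrt (real n) * nrm ipF \<Psi> * nrm ipL (s k - f)) \<longlonglongrightarrow> 0"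
    using tendsto_mult_left[OF f[unfolded conv_def], of "sqrt (real n) * nrm ipF \<Psi>"] by simp
qed

text \<open>Truncated subtraction keeps the statement valid at \<open>n = 0\<close>, where the
  result is zero and lies in \<open>S 0\<close>.\<close>

lemma a_S_pred: "\<Psi> \<in> S n \<Longrightarrow> a f \<Psi> \<in> S (n - 1)"
  by (cases n) (auto simp: a_S a_S_0 cvec.subspace_0[OF subspace_sector])

lemma a_H_pred: "\<Phi> \<in> H n \<Longrightarrow> a f \<Phi> \<in> H (n - 1)"
  by (rule H_approx, assumption) (rule H_closed[OF H_continuous(1) S_H[OF a_S_pred]])

text \<open>Moving \<open>ad h\<close> to the left past both annihilation operators leaves two
  commutator terms. Their coefficients are the basis coordinates of \<open>B h\<close> and the
  conjugated ones of \<open>J h\<close>, so these terms converge to vectors that do not depend on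
  \<open>e\<close>.\<close>

lemma annihilation_pair_creation:
  assumes A: "bounded_op ipL A" and AB: "L.adjoint_pair A B" and e: "cons ipL e"
    and \<Psi>: "\<Psi> \<in> S n" and Y: "conv ipF (\<lambda>M. \<Sum>j<M. a (e j) (a (J (A (e j))) \<Psi>)) Y"
  shows "conv ipF (\<lambda>M. \<Sum>j<M. a (e j) (a (J (A (e j))) (ad h \<Psi>)))
    (ad h Y + a (B h) \<Psi> + a (J (A (J h))) \<Psi>)"
proof -
  have D: "\<Psi> \<in> D" using \<Psi> S_D by blast
  have ip1: "ipL (A (e j)) h = ipL (e j) (B h)" for j
    using AB unfolding L.adjoint_pair_def by simp
  have ip2: "ipL (J (e j)) h = cnj (ipL (e j) (J h))" for j
    using ip_J_left[of "e j" h] L.ip_cnj[of "J h" "e j"] by simp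
  have term_eq: "a (e j) (a (J (A (e j))) (ad h \<Psi>)) = 1 *\<^sub>C ad h (a (e j) (a (J (A (e j))) \<Psi>))
      + ipL (e j) (B h) *\<^sub>C a (e j) \<Psi> + cnj (ipL (e j) (J h)) *\<^sub>C a (J (A (e j))) \<Psi>" for j
    using D by (simp add: ccr a_add a_scale D_a D_ad cvec.subspace_scale[OF subspace_D] ip1 ip2)
  have sum_eq: "(\<Sum>j<M. a (e j) (a (J (A (e j))) (ad h \<Psi>)))
      = ad h (\<Sum>j<M. a (e j) (a (J (A (e j))) \<Psi>)) + a (\<Sum>j<M. ipL (e j) (B h) *\<^sub>C e j) \<Psi>
        + a (J (A (\<Sum>j<M. ipL (e j) (J h) *\<^sub>C e j))) \<Psi>" for M
  proof -
    have "ad h (\<Sum>j<M. a (e j) (a (J (A (e j))) \<Psi>)) = (\<Sum>j<M. 1 *\<^sub>C ad h (a (e j) (a (J (A (e j))) \<Psi>)))"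
      using ad_sum[of "{..<M}" "\<lambda>j. a (e j) (a (J (A (e j))) \<Psi>)" h "\<lambda>_. 1"] D by (simp add: D_a)
    then show ?thesis
      unfolding term_eq sum.distrib a_sum_arg[OF D] L.bounded_op_sum[OF A] J_sum by simp
  qed
  \<comment> \<open>All partial sums lie in one sector, on which \<open>ad h\<close> is continuous
    and can be interchanged with the limit.\<close>
  have "(\<Sum>j<M. a (e j) (a (J (A (e j))) \<Psi>)) \<in> S (n - 1 - 1)" for M
    by (intro cvec.subspace_sum subspace_sector a_S_pred \<Psi>)
  then show ?thesis
    unfolding sum_eq
    by (intro conv_add H_continuous(2)[OF _ Y] a_conv_arg[OF _ \<Psi>] J_conv L.bounded_op_conv[OF A] L.cons_expansion e)
qed

definition conj_op :: "('l \<Rightarrow> 'l) \<Rightarrow> 'l \<Rightarrow> 'l" where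
  "conj_op A x = J (A (J x))"

lemma adjoint_pair_conj_op:
  assumes "L.adjoint_pair A B"
  shows "L.adjoint_pair (conj_op A) (conj_op B)"
  unfolding L.adjoint_pair_def
proof (intro allI)
  fix x y
  have "ipL x (conj_op B y) = ipL (B (J y)) (J x)"
    unfolding conj_op_def by (rule ip_J_right)
  also have "\<dots> = ipL (J y) (A (J x))"
    using L.adjoint_pair_sym[OF assms] by (simp add: L.adjoint_pair_def)
  also have "\<dots> = ipL (conj_op A x) y"
    unfolding conj_op_def by (rule ip_J_left)
  finally show "ipL x (conj_op B y) = ipL (conj_op A x) y" .
qed

lemma hs_op_conj_op:
  assumes "hs_op ipL A"
  shows "hs_op ipL (conj_op A)"
proof -
  from assms obtain e K where e: "cons ipL e" and sm: "summable (\<lambda>j. (nrm ipL (A (e j)))\<^sup>2)"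
    and K: "\<And>x. nrm ipL (A x) \<le> K * nrm ipL x"
    and A: "\<And>x y. A (x + y) = A x + A y" "\<And>c x. A (c *\<^sub>C x) = c *\<^sub>C A x"
    unfolding hs_op_def bounded_op_def by blast
  have "nrm ipL (conj_op A x) \<le> K * nrm ipL x" for x
    using K[of "J x"] by (simp add: conj_op_def J_nrm)
  then have "bounded_op ipL (conj_op A)"
    unfolding bounded_op_def by (auto simp: conj_op_def J_add J_scale A)
  moreover have "summable (\<lambda>j. (nrm ipL (conj_op A (J (e j))))\<^sup>2)"
    using sm by (simp add: conj_op_def J_nrm)
  ultimately show ?thesis
    unfolding hs_op_def using J_cons[OF e] by blast
qed

lemma transp_eq: "L.adjoint_pair A B \<Longrightarrow> transp ipL J A = conj_op B"
proof -
  assume "L.adjoint_pair A B"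
  moreover have "J \<circ> A \<circ> J = conj_op A" by (simp add: conj_op_def fun_eq_iff)
  ultimately show ?thesis
    unfolding transp_def by (simp add: L.adj_eqI adjoint_pair_conj_op)
qed

text \<open>The transpose of \<open>A\<close> is \<open>conj_op B\<close>, so exchanging \<open>A\<close> with its transpose exchanges
  \<open>B\<close> with \<open>conj_op A\<close> and leaves the recursion of \<open>annihilation_pair_creation\<close> invariant.\<close>
lemma annihilation_pair_limit:
  assumes A: "bounded_op ipL A" and B: "bounded_op ipL (conj_op B)" and AB: "L.adjoint_pair A B"
    and \<Psi>: "\<Psi> \<in> S n"
  shows "\<exists>Y. \<forall>e. cons ipL e \<longrightarrow> conv ipF (\<lambda>M. \<Sum>j<M. a (e j) (a (J (A (e j))) \<Psi>)) Y
    \<and> conv ipF (\<lambda>M. \<Sum>j<M. a (e j) (a (J (conj_op B (e j))) \<Psi>)) Y"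
    (is "\<exists>Y. ?Q \<Psi> Y")
  using \<Psi>
proof (induction rule: S_induct)
  case sub
  show ?case
    unfolding cvec.subspace_def
  proof (intro conjI ballI allI)
    show "0 \<in> {\<Psi> \<in> D. \<exists>Y. ?Q \<Psi> Y}"
      by (auto simp: cvec.subspace_0[OF subspace_D] intro!: exI[of _ 0] conv_const)
    fix \<Psi> c assume "\<Psi> \<in> {\<Psi> \<in> D. \<exists>Y. ?Q \<Psi> Y}"
    then obtain Y where D: "\<Psi> \<in> D" and Y: "?Q \<Psi> Y" by blast
    have "?Q (c *\<^sub>C \<Psi>) (c *\<^sub>C Y)"
      using Y by (simp add: a_scale D D_a conv_scale flip: cvec.scale_sum_right)
    then show "c *\<^sub>C \<Psi> \<in> {\<Psi> \<in> D. \<exists>Y. ?Q \<Psi> Y}"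
      using cvec.subspace_scale[OF subspace_D D] by blast
    fix \<Psi>' assume "\<Psi>' \<in> {\<Psi> \<in> D. \<exists>Y. ?Q \<Psi> Y}"
    then obtain Y' where D': "\<Psi>' \<in> D" and Y': "?Q \<Psi>' Y'" by blast
    have "?Q (\<Psi> + \<Psi>') (Y + Y')"
      using Y Y' by (simp add: a_add D D' D_a sum.distrib conv_add)
    then show "\<Psi> + \<Psi>' \<in> {\<Psi> \<in> D. \<exists>Y. ?Q \<Psi> Y}"
      using cvec.subspace_add[OF subspace_D D D'] by blast
  qed
next
  case (base v)
  then show ?case
  proof (induction n arbitrary: v)
    case 0
    then have "?Q v 0" by (simp add: creation_vectors_0 a_Omega conv_const)
    then show ?case by blast
  next
    case (Suc n)
    then obtain h w where v: "v = ad h w" and w: "w \<in> creation_vectors ad \<Omega> n"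
      unfolding creation_vectors_Suc by blast
    obtain Y where Y: "?Q w Y" using Suc.IH[OF w] by blast
    have wS: "w \<in> S n" using w creation_vectors_S by blast
    have BA: "L.adjoint_pair (conj_op B) (conj_op A)"
      by (rule adjoint_pair_conj_op[OF L.adjoint_pair_sym[OF AB]])
    have "conv ipF (\<lambda>M. \<Sum>j<M. a (e j) (a (J (A (e j))) v)) (ad h Y + a (B h) w + a (J (A (J h))) w)
      \<and> conv ipF (\<lambda>M. \<Sum>j<M. a (e j) (a (J (conj_op B (e j))) v)) (ad h Y + a (B h) w + a (J (A (J h))) w)"
      if e: "cons ipL e" for e
    proof
      show "conv ipF (\<lambda>M. \<Sum>j<M. a (e j) (a (J (A (e j))) v)) (ad h Y + a (B h) w + a (J (A (J h))) w)"
        unfolding v by (rule annihilation_pair_creation[OF A AB e wS Y[rule_format, OF e, THEN conjunct1]])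
      \<comment> \<open>For \<open>conj_op B\<close> the two commutator terms appear in the opposite
        order; \<open>J\<close> being an involution, their sum is the same.\<close>
      from annihilation_pair_creation[OF B BA e wS Y[rule_format, OF e, THEN conjunct2], of h]
      show "conv ipF (\<lambda>M. \<Sum>j<M. a (e j) (a (J (conj_op B (e j))) v)) (ad h Y + a (B h) w + a (J (A (J h))) w)"
        unfolding v by (simp add: conj_op_def add_ac)
    qed
    then show ?case by blast
  qed
qed

lemma ip_creation_pairs:
  assumes \<Phi>: "\<Phi> \<in> Done ipF ad \<Omega>" and \<Psi>: "\<Psi> \<in> S n"
  shows "ipF (\<Sum>j\<in>I. ad (f j) (ad (J (e j)) \<Phi>)) \<Psi> = ipF \<Phi> (\<Sum>j\<in>I. a (e j) (a (J (f j)) \<Psi>))"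
  unfolding ip_sum_left ip_sum_right
proof (intro sum.cong refl)
  fix j
  note H = H_Dhalf[OF S_H]
  show "ipF (ad (f j) (ad (J (e j)) \<Phi>)) \<Psi> = ipF \<Phi> (a (e j) (a (J (f j)) \<Psi>))"
    by (simp add: ip_ad_half ad_Done[OF \<Phi>] Done_Dhalf[OF \<Phi>] H[OF \<Psi>] H[OF a_S_pred[OF \<Psi>]])
qed

text \<open>The disjunction for \<open>A'\<close> covers the change of basis and the passage to the
  transpose in one argument: all partial sums pair with \<open>\<Psi>\<close> to the same
  limit.\<close>

lemma creation_pair_limit_unique:
  assumes A: "hs_op ipL A" and AB: "L.adjoint_pair A B" and A': "A' = A \<or> A' = conj_op B"
    and e: "cons ipL e" and e': "cons ipL e'" and \<Phi>: "\<Phi> \<in> Done ipF ad \<Omega>"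
    and X: "conv ipF (\<lambda>M. \<Sum>j<M. ad (A (e j)) (ad (J (e j)) \<Phi>)) X"
    and X': "conv ipF (\<lambda>M. \<Sum>j<M. ad (A' (e' j)) (ad (J (e' j)) \<Phi>)) X'"
  shows "X = X'"
proof (rule S_eqI)
  fix n \<Psi> assume \<Psi>: "\<Psi> \<in> S n"
  have bA: "bounded_op ipL A" using A unfolding hs_op_def by blast
  have bB: "bounded_op ipL (conj_op B)"
    using hs_op_conj_op[OF L.hs_op_adjoint[OF A AB]] unfolding hs_op_def by blast
  obtain Y where Y: "\<And>e. cons ipL e \<Longrightarrow> conv ipF (\<lambda>M. \<Sum>j<M. a (e j) (a (J (A (e j))) \<Psi>)) Y"
    "\<And>e. cons ipL e \<Longrightarrow> conv ipF (\<lambda>M. \<Sum>j<M. a (e j) (a (J (conj_op B (e j))) \<Psi>)) Y"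
    using annihilation_pair_limit[OF bA bB AB \<Psi>] by blast
  have ip: "ipF Z \<Psi> = ipF \<Phi> Y"
    if Z: "conv ipF (\<lambda>M. \<Sum>j<M. ad (T (g j)) (ad (J (g j)) \<Phi>)) Z"
      and T: "conv ipF (\<lambda>M. \<Sum>j<M. a (g j) (a (J (T (g j))) \<Psi>)) Y" for T g Z
    using conv_ip[OF Z conv_const, of \<Psi>] conv_ip[OF conv_const T, of \<Phi>]
    unfolding ip_creation_pairs[OF \<Phi> \<Psi>] by (rule LIMSEQ_unique)
  have "ipF X \<Psi> = ipF \<Phi> Y" by (rule ip[OF X Y(1)[OF e]])
  moreover have "ipF X' \<Psi> = ipF \<Phi> Y"
    using A' ip[OF X'] Y[OF e'] by blast
  ultimately show "ipF \<Psi> X = ipF \<Psi> X'"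
    using ip_cnj[of \<Psi> X] ip_cnj[of \<Psi> X'] by simp
qed

subsection \<open>Pairs of annihilation operators\<close>

text \<open>Only convergence on \<open>Done\<close> is needed here, so a cruder estimate suffices:
  the outer operator and the family \<open>a (g i)\<close> each cost a factor \<open>n\<close>,
  separated by Cauchy-Schwarz. The square of \<open>n + 1\<close> matches the weight of
  \<open>Done\<close>.\<close>

lemma annihilation_pair_bound_H:
  assumes fin: "finite I" and g: "L.orthonormal g I" and \<Phi>: "\<Phi> \<in> H n"
  shows "(nrm ipF (\<Sum>i\<in>I. a (f i) (a (g i) \<Phi>)))\<^sup>2
    \<le> (\<Sum>i\<in>I. (nrm ipL (f i))\<^sup>2) * ((real (n + 1))\<^sup>2 * (nrm ipF \<Phi>)\<^sup>2)"
proof -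
  have "nrm ipF (a (f i) (a (g i) \<Phi>)) \<le> nrm ipL (f i) * (sqrt (real n) * nrm ipF (a (g i) \<Phi>))" for i
  proof -
    have "(nrm ipF (a (f i) (a (g i) \<Phi>)))\<^sup>2 \<le> real (n - 1) * (nrm ipL (f i))\<^sup>2 * (nrm ipF (a (g i) \<Phi>))\<^sup>2"
      by (rule a_H_bound[OF a_H_pred[OF \<Phi>]])
    also have "\<dots> \<le> real n * (nrm ipL (f i))\<^sup>2 * (nrm ipF (a (g i) \<Phi>))\<^sup>2"
      by (intro mult_right_mono) auto
    finally have "nrm ipF (a (f i) (a (g i) \<Phi>)) \<le> sqrt (real n * (nrm ipL (f i))\<^sup>2 * (nrm ipF (a (g i) \<Phi>))\<^sup>2)"
      by (rule real_le_rsqrt)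
    then show ?thesis by (simp add: real_sqrt_mult mult_ac)
  qed
  then have "nrm ipF (\<Sum>i\<in>I. a (f i) (a (g i) \<Phi>)) \<le> (\<Sum>i\<in>I. nrm ipL (f i) * (sqrt (real n) * nrm ipF (a (g i) \<Phi>)))"
    by (intro order_trans[OF nrm_sum_le sum_mono])
  then have "(nrm ipF (\<Sum>i\<in>I. a (f i) (a (g i) \<Phi>)))\<^sup>2
      \<le> (\<Sum>i\<in>I. nrm ipL (f i) * (sqrt (real n) * nrm ipF (a (g i) \<Phi>)))\<^sup>2"
    by (rule power_mono) simp
  also have "\<dots> \<le> (\<Sum>i\<in>I. (nrm ipL (f i))\<^sup>2) * (\<Sum>i\<in>I. (sqrt (real n) * nrm ipF (a (g i) \<Phi>))\<^sup>2)"
    by (rule Cauchy_Schwarz_ineq_sum)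
  also have "(\<Sum>i\<in>I. (sqrt (real n) * nrm ipF (a (g i) \<Phi>))\<^sup>2) = real n * (\<Sum>i\<in>I. (nrm ipF (a (g i) \<Phi>))\<^sup>2)"
    by (simp add: power_mult_distrib sum_distrib_left)
  also have "(\<Sum>i\<in>I. (nrm ipL (f i))\<^sup>2) * (real n * (\<Sum>i\<in>I. (nrm ipF (a (g i) \<Phi>))\<^sup>2))
      \<le> (\<Sum>i\<in>I. (nrm ipL (f i))\<^sup>2) * (real n * (real n * (nrm ipF \<Phi>)\<^sup>2))"
    by (intro mult_left_mono[OF mult_left_mono[OF a_sum_H_bound[OF fin g \<Phi>]]] sum_nonneg) auto
  also have "real n * (real n * (nrm ipF \<Phi>)\<^sup>2) = (real n)\<^sup>2 * (nrm ipF \<Phi>)\<^sup>2"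
    by (simp add: power2_eq_square)
  also have "(\<Sum>i\<in>I. (nrm ipL (f i))\<^sup>2) * ((real n)\<^sup>2 * (nrm ipF \<Phi>)\<^sup>2)
      \<le> (\<Sum>i\<in>I. (nrm ipL (f i))\<^sup>2) * ((real (n + 1))\<^sup>2 * (nrm ipF \<Phi>)\<^sup>2)"
    by (intro mult_left_mono[OF mult_right_mono[OF power_mono]] sum_nonneg) auto
  finally show ?thesis .
qed

lemma annihilation_pair_bound:
  assumes fin: "finite I" and g: "L.orthonormal g I" and \<Phi>: "\<Phi> \<in> Done ipF ad \<Omega>"
  shows "(nrm ipF (\<Sum>i\<in>I. a (f i) (a (g i) \<Phi>)))\<^sup>2
    \<le> (\<Sum>i\<in>I. (nrm ipL (f i))\<^sup>2) * (\<Sum>n. (real (n + 1))\<^sup>2 * (nrm ipF (P n \<Phi>))\<^sup>2)"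
proof -
  let ?X = "\<Sum>i\<in>I. a (f i) (a (g i) \<Phi>)"
  let ?t = "\<lambda>n. (nrm ipF (\<Sum>i\<in>I. a (f i) (a (g i) (P n \<Phi>))))\<^sup>2"
  have "P m ?X = (\<Sum>i\<in>I. a (f i) (a (g i) (P (Suc (Suc m)) \<Phi>)))" for m
    by (simp add: P_sum P_a a_Done Done_Dhalf \<Phi>)
  then have "(\<lambda>m. ?t (Suc (Suc m))) sums (nrm ipF ?X)\<^sup>2"
    using P_parseval[of ?X] by simp
  \<comment> \<open>Adding the nonnegative terms for sectors 0 and 1 gives a series indexed from 0,
    comparable term by term with that of \<open>\<Phi>\<close>.\<close>
  then have t: "?t sums ((nrm ipF ?X)\<^sup>2 + ?t (Suc 0) + ?t 0)"
    by (simp only: sums_Suc_iff[of "\<lambda>n. ?t (Suc n)"] sums_Suc_iff[of ?t])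
  have "(nrm ipF ?X)\<^sup>2 + ?t (Suc 0) + ?t 0
      \<le> (\<Sum>i\<in>I. (nrm ipL (f i))\<^sup>2) * (\<Sum>n. (real (n + 1))\<^sup>2 * (nrm ipF (P n \<Phi>))\<^sup>2)"
    by (rule sums_le[OF _ t sums_mult[OF summable_sums[OF \<Phi>[unfolded mem_Done]]]])
      (rule annihilation_pair_bound_H[OF fin g P_H])
  then show ?thesis using zero_le_power2[of "nrm ipF (\<Sum>i\<in>I. a (f i) (a (g i) (P 0 \<Phi>)))"]
      zero_le_power2[of "nrm ipF (\<Sum>i\<in>I. a (f i) (a (g i) (P (Suc 0) \<Phi>)))"] by linarith
qed

lemma annihilation_pair_converges:
  assumes f: "summable (\<lambda>j. (nrm ipL (f j))\<^sup>2)" and e: "cons ipL e" and \<Phi>: "\<Phi> \<in> Done ipF ad \<Omega>"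
  shows "\<exists>X. conv ipF (\<lambda>M. \<Sum>j<M. a (f j) (a (e j) \<Phi>)) X"
proof (rule complete_sq)
  let ?w = "\<Sum>n. (real (n + 1))\<^sup>2 * (nrm ipF (P n \<Phi>))\<^sup>2"
  let ?b = "\<lambda>M. (\<Sum>j<M. (nrm ipL (f j))\<^sup>2) * ?w"
  show "convergent ?b"
    by (rule convergentI[OF tendsto_mult_right[OF summable_LIMSEQ[OF f]]])
  fix m n :: nat assume "m \<le> n"
  then have "(\<Sum>j<n. a (f j) (a (e j) \<Phi>)) - (\<Sum>j<m. a (f j) (a (e j) \<Phi>)) = (\<Sum>j\<in>{m..<n}. a (f j) (a (e j) \<Phi>))"
    "?b n - ?b m = (\<Sum>j\<in>{m..<n}. (nrm ipL (f j))\<^sup>2) * ?w"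
    by (simp_all add: sum_diff_nat_ivl flip: atLeast0LessThan left_diff_distrib)
  then show "(nrm ipF ((\<Sum>j<n. a (f j) (a (e j) \<Phi>)) - (\<Sum>j<m. a (f j) (a (e j) \<Phi>))))\<^sup>2 \<le> ?b n - ?b m"
    using annihilation_pair_bound[OF _ L.cons_orthonormal[OF e] \<Phi>, of "{m..<n}" f] by simp
qed

lemma ip_annihilation_pairs:
  assumes \<Phi>: "\<Phi> \<in> Done ipF ad \<Omega>" and \<Psi>: "\<Psi> \<in> Done ipF ad \<Omega>"
  shows "ipF (\<Sum>j\<in>I. a (f j) (a (g j) \<Phi>)) \<Psi> = ipF \<Phi> (\<Sum>j\<in>I. ad (J (f j)) (ad (J (g j)) \<Psi>))"
  unfolding ip_sum_left ip_sum_right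
proof (intro sum.cong refl)
  fix j
  show "ipF (a (f j) (a (g j) \<Phi>)) \<Psi> = ipF \<Phi> (ad (J (f j)) (ad (J (g j)) \<Psi>))"
    \<comment> \<open>Taking adjoints reverses the order of the two operators; commuting the
      creation operators restores it.\<close>
    by (subst ad_ad_commute_Done[OF \<Psi>])
      (simp add: ip_a_half a_Done[OF \<Phi>] ad_Done[OF \<Psi>] Done_Dhalf[OF \<Phi>] Done_Dhalf[OF \<Psi>])
qed

lemma creation_pair_operator:
  assumes C: "hs_op ipL C"
  obtains \<Delta>p where "\<And>e \<Phi>. cons ipL e \<Longrightarrow> \<Phi> \<in> Done ipF ad \<Omega> \<Longrightarrow>
      conv ipF (\<lambda>M. \<Sum>j<M. ad (C (e j)) (ad (J (e j)) \<Phi>)) (\<Delta>p \<Phi>)"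
    and "\<And>e \<Phi>. cons ipL e \<Longrightarrow> \<Phi> \<in> Done ipF ad \<Omega> \<Longrightarrow>
      conv ipF (\<lambda>M. \<Sum>j<M. ad (transp ipL J C (e j)) (ad (J (e j)) \<Phi>)) (\<Delta>p \<Phi>)"
proof -
  obtain e0 where e0: "cons ipL e0" using C unfolding hs_op_def by blast
  obtain B where B: "L.adjoint_pair C B" using L.adjoint_exists[OF C] by blast
  have T: "transp ipL J C = conj_op B" "hs_op ipL (conj_op B)"
    using transp_eq[OF B] hs_op_conj_op[OF L.hs_op_adjoint[OF C B]] by auto
  \<comment> \<open>The operator is fixed by one reference basis; uniqueness of the limit then
    identifies it with the limits over all bases and for the transpose.\<close>
  define \<Delta>p where "\<Delta>p \<Phi> = (SOME X. conv ipF (\<lambda>M. \<Sum>j<M. ad (C (e0 j)) (ad (J (e0 j)) \<Phi>)) X)" for \<Phi>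
  have lim: "conv ipF (\<lambda>M. \<Sum>j<M. ad (A (e j)) (ad (J (e j)) \<Phi>)) (\<Delta>p \<Phi>)"
    if A: "hs_op ipL A" "A = C \<or> A = conj_op B" and e: "cons ipL e" and \<Phi>: "\<Phi> \<in> Done ipF ad \<Omega>" for A e \<Phi>
  proof -
    have 0: "conv ipF (\<lambda>M. \<Sum>j<M. ad (C (e0 j)) (ad (J (e0 j)) \<Phi>)) (\<Delta>p \<Phi>)"
      unfolding \<Delta>p_def by (rule someI_ex[OF creation_pair_converges[OF C e0 \<Phi>]])
    obtain X where X: "conv ipF (\<lambda>M. \<Sum>j<M. ad (A (e j)) (ad (J (e j)) \<Phi>)) X"
      using creation_pair_converges[OF A(1) e \<Phi>] by blast
    show ?thesis
      using X creation_pair_limit_unique[OF C B A(2) e0 e \<Phi> 0 X] by simp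
  qed
  show ?thesis
    by (rule that[of \<Delta>p]) (use lim C T in auto)
qed

end

theorem theorem5p11:
  fixes ipL :: "'l::cvec \<Rightarrow> 'l \<Rightarrow> complex" and J :: "'l \<Rightarrow> 'l"
    and ipF :: "'f::cvec \<Rightarrow> 'f \<Rightarrow> complex" and a ad :: "'l \<Rightarrow> 'f \<Rightarrow> 'f"
    and \<Omega> :: 'f and D :: "'f set" and C :: "'l \<Rightarrow> 'l"
  assumes L: "sep_inf_hilbert ipL"
    and J: "conjugation ipL J"
    and F: "hilbert ipF"
    and fock: "fock_rep ipL J ipF a ad \<Omega> D"
    and C: "hs_op ipL C"
  shows "\<exists>\<Delta>p :: 'f \<Rightarrow> 'f.
     (\<forall>e. cons ipL e \<longrightarrow> (\<forall>\<Phi>\<in>Done ipF ad \<Omega>.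
        conv ipF (\<lambda>M. \<Sum>j<M. ad (C (e j)) (ad (J (e j)) \<Phi>)) (\<Delta>p \<Phi>))) \<and>
     (\<forall>\<Phi>\<in>Done ipF ad \<Omega>.
        (nrm ipF (\<Delta>p \<Phi>))\<^sup>2 \<le>
          (opnorm ipL C)\<^sup>2 * (\<Sum>n. real n * real (n + 2) * (nrm ipF (comp ipF ad \<Omega> n \<Phi>))\<^sup>2)
          + hs_norm_sq ipL C * (\<Sum>n. real (n + 2) * (nrm ipF (comp ipF ad \<Omega> n \<Phi>))\<^sup>2)) \<and>
     (\<forall>e. cons ipL e \<longrightarrow> (\<forall>\<Phi>\<in>Done ipF ad \<Omega>.
        conv ipF (\<lambda>M. \<Sum>j<M. ad (transp ipL J C (e j)) (ad (J (e j)) \<Phi>)) (\<Delta>p \<Phi>))) \<and>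
     (transp ipL J C = C \<longrightarrow>
        (\<forall>e. cons ipL e \<longrightarrow> (\<forall>\<Phi>\<in>Done ipF ad \<Omega>. \<exists>X.
           conv ipF (\<lambda>M. \<Sum>j<M. a (adj ipL C (e j)) (a (J (e j)) \<Phi>)) X \<and>
           (\<forall>\<Psi>\<in>Done ipF ad \<Omega>. ipF \<Phi> (\<Delta>p \<Psi>) = ipF X \<Psi>))))"
proof -
  interpret fock ipL J ipF a ad \<Omega> D
    using L by (intro fock.intro fock_axioms.intro J F fock) (simp add: chs_iff_hilbert sep_inf_hilbert_def)
  obtain \<Delta>p where lim: "\<And>e \<Phi>. cons ipL e \<Longrightarrow> \<Phi> \<in> Done ipF ad \<Omega> \<Longrightarrow>
      conv ipF (\<lambda>M. \<Sum>j<M. ad (C (e j)) (ad (J (e j)) \<Phi>)) (\<Delta>p \<Phi>)"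
    and limT: "\<And>e \<Phi>. cons ipL e \<Longrightarrow> \<Phi> \<in> Done ipF ad \<Omega> \<Longrightarrow>
      conv ipF (\<lambda>M. \<Sum>j<M. ad (transp ipL J C (e j)) (ad (J (e j)) \<Phi>)) (\<Delta>p \<Phi>)"
    by (rule creation_pair_operator[OF C]) (rule that)
  obtain e0 where e0: "cons ipL e0" using C unfolding hs_op_def by blast
  have bound: "(nrm ipF (\<Delta>p \<Phi>))\<^sup>2 \<le>
          (opnorm ipL C)\<^sup>2 * (\<Sum>n. real n * real (n + 2) * (nrm ipF (comp ipF ad \<Omega> n \<Phi>))\<^sup>2)
          + hs_norm_sq ipL C * (\<Sum>n. real (n + 2) * (nrm ipF (comp ipF ad \<Omega> n \<Phi>))\<^sup>2)"
    if "\<Phi> \<in> Done ipF ad \<Omega>" for \<Phi>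
    using creation_pair_limit_bound[OF C e0 that lim[OF e0 that]]
    unfolding weight1_def weight2_def comp_eq .
  have adjoint: "\<exists>X. conv ipF (\<lambda>M. \<Sum>j<M. a (adj ipL C (e j)) (a (J (e j)) \<Phi>)) X \<and>
           (\<forall>\<Psi>\<in>Done ipF ad \<Omega>. ipF \<Phi> (\<Delta>p \<Psi>) = ipF X \<Psi>)"
    if sym: "transp ipL J C = C" and e: "cons ipL e" and \<Phi>: "\<Phi> \<in> Done ipF ad \<Omega>" for e \<Phi>
  proof -
    obtain B where B: "L.adjoint_pair C B" using L.adjoint_exists[OF C] by blast
    have adj: "adj ipL C = B" by (rule L.adj_eqI[OF B])
    \<comment> \<open>Symmetry of \<open>C\<close> says \<open>conj_op B = C\<close>; moving one
      \<open>J\<close> across gives this intertwining relation.\<close>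
    have JB: "J (B x) = C (J x)" for x
      using transp_eq[OF B] sym by (metis J_J conj_op_def)
    have "summable (\<lambda>j. (nrm ipL (B (e j)))\<^sup>2)"
      by (rule sums_summable[OF L.hs_op_sums[OF L.hs_op_adjoint[OF C B] e]])
    then obtain X where X: "conv ipF (\<lambda>M. \<Sum>j<M. a (B (e j)) (a (J (e j)) \<Phi>)) X"
      using annihilation_pair_converges[OF _ J_cons[OF e] \<Phi>, of "\<lambda>j. B (e j)"] by blast
    have "ipF \<Phi> (\<Delta>p \<Psi>) = ipF X \<Psi>" if \<Psi>: "\<Psi> \<in> Done ipF ad \<Omega>" for \<Psi>
    proof (rule LIMSEQ_unique)
      \<comment> \<open>By \<open>JB\<close> the adjoint of the annihilation sum over
        \<open>e\<close> is exactly the creation sum over the basis \<open>J (e j)\<close>, whose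
        limit is again \<open>\<Delta>p \<Psi>\<close> by independence of the basis.\<close>
      show "(\<lambda>M. ipF \<Phi> (\<Sum>j<M. ad (C (J (e j))) (ad (J (J (e j))) \<Psi>))) \<longlonglongrightarrow> ipF \<Phi> (\<Delta>p \<Psi>)"
        by (rule conv_ip[OF conv_const lim[OF J_cons[OF e] \<Psi>]])
      show "(\<lambda>M. ipF \<Phi> (\<Sum>j<M. ad (C (J (e j))) (ad (J (J (e j))) \<Psi>))) \<longlonglongrightarrow> ipF X \<Psi>"
        using conv_ip[OF X conv_const, of \<Psi>] unfolding ip_annihilation_pairs[OF \<Phi> \<Psi>] JB .
    qed
    then show ?thesis unfolding adj using X by blast
  qed
  show ?thesis
    by (intro exI[of _ \<Delta>p] conjI allI impI ballI lim bound limT adjoint)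
qed
end
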